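(* Let $\Omega\subset\mathbb{R}^2$ be a bounded, possibly multiply connected domain with Lipschitz boundary and let $f\in H^{-1}(\Omega)$. Let $c=c(\Omega)>0$ be a constant such that $$\int_\Omega \xi\,\nabla^\perp\psi\cdot\nabla T\,d\mathbf{x}\le c\,\|\nabla\xi\|_{L^2}\|\nabla\psi\|_{L^2}\|\nabla T\|_{L^2}\qquad\forall\,\xi,T\in H^1_0(\Omega),\ \psi\in\mathcal{H}.$$ Then for every $\mathrm{Pe}\ge0$, $$\mathcal{J}(\mathrm{Pe})\ \ge\ \mathcal{L}(\mathrm{Pe})\ \ge\ \frac{\|f\|_{H^{-1}}^2}{1+c^2\,\mathrm{Pe}^2}.$$ Consequently, if $f\neq0$, the optimal cooling efficiency $\mathcal{E}(\mathrm{Pe}):=\|f\|_{H^{-1}}^2/\mathcal{J}(\mathrm{Pe})$ satisfies $\mathcal{E}(\mathrm{Pe})\le 1+c^2\,\mathrm{Pe}^2$ for every $\mathrm{Pe}\ge 0$.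
   Context: Optimal cooling problem. Admissible velocities are $\mathbf{u}\in L^2(\Omega;\mathbb{R}^2)$ that are weakly divergence free and satisfy $\mathbf{u}\cdot\hat{\mathbf{n}}=0$ on $\partial\Omega$ in the weak sense (i.e. $\int_\Omega \mathbf{u}\cdot\nabla\varphi\,d\mathbf{x}=0$ for all $\varphi\in H^1(\Omega)$), with $\|\mathbf{u}\|_{L^2}\le \mathrm{Pe}$. For each such $\mathbf{u}$, $T\in H^1_0(\Omega)$ is the unique weak solution of $-\Delta T+\mathbf{u}\cdot\nabla T=f$ in $\Omega$, $T=0$ on $\partial\Omega$, i.e. $\int_\Omega (\nabla\xi\cdot\nabla T+\xi\,\mathbf{u}\cdot\nabla T-f\xi)\,d\mathbf{x}=0$ for all $\xi\in H^1_0(\Omega)$. Then $\mathcal{J}(\mathrm{Pe})$ is the minimum (infimum) of $\int_\Omega|\nabla T|^2\,d\mathbf{x}$ over all such $\mathbf{u}$. The pairing of $f\in H^{-1}(\Omega)$ with $\xi\in H^1_0(\Omega)$ is written $\int_\Omega f\xi\,d\mathbf{x}$. Norm. $\|f\|_{H^{-1}}=\sup_{0\ne\varphi\in H^1_0(\Omega)}\left|\int_\Omega f\varphi\,d\mathbf{x}\right|/\|\nabla\varphi\|_{L^2}=\|\nabla\Delta^{-1}f\|_{L^2}$, where $\Delta^{-1}$ is the inverse Laplacian with homogeneous Dirichlet boundary conditions. Streamfunctions. Let $\Gamma_0$ be the exterior boundary of $\Omega$ and $\Gamma_1,\dots,\Gamma_p$ the other connected components of $\partial\Omega$ (if any). $\mathcal{H}$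 is the space of $\psi\in H^1(\Omega)$ with $\psi|_{\Gamma_0}=0$ and $\psi|_{\Gamma_i}$ equal to a constant $c_i\in\mathbb{R}$ for each $1\le i\le p$; thus $\mathcal{H}=H^1_0(\Omega)$ if $\Omega$ is simply connected. With $\nabla^\perp\psi=(\partial_y\psi,-\partial_x\psi)$, every weakly divergence-free $\mathbf{u}\in L^2(\Omega;\mathbb{R}^2)$ with $\mathbf{u}\cdot\hat{\mathbf n}=0$ on $\partial\Omega$ equals $\mathrm{Pe}\,\nabla^\perp\psi$ for some $\psi\in\mathcal{H}$ (when $\mathrm{Pe}>0$). Trilinear term. The integral $\int_\Omega \xi\,\nabla^\perp\psi\cdot\nabla T\,d\mathbf{x}$ is understood as the continuous extension in $\xi$ from $H^1_0(\Omega)\cap L^\infty(\Omega)$; a constant $c(\Omega)$ as in the claim exists by compensated-compactness estimates of Coifman, Lions, Meyer and Semmes. The term $\int_\Omega\xi\,\mathbf{u}\cdot\nabla T\,d\mathbf{x}$ is understood in the same way. Dual problem. For $(a,\xi)\in\mathbb{R}\times H^1_0(\Omega)$ let $$\mathcal{Q}(a,\xi)[\psi,\theta]=\int_\Omega \big(a|\nabla\psi|^2+|\nabla\theta|^2-\mathrm{Pe}\,\xi\,\nabla^\perp\psi\cdot\nabla\theta\big)\,d\mathbf{x},\qquad (\psi,\theta)\in\mathcal{H}\times H^1_0(\Omega),$$ and write $\mathcal{Q}(a,\xi)\succeq0$ if this is nonnegative for all $(\psi,\theta)\in\mathcal{H}\times H^1_0(\Omega)$. Then $$\mathcal{L}(\mathrm{Pe})=\max\left\{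 \int_\Omega \Big( f\xi-\tfrac14|\nabla\xi|^2\Big)\,d\mathbf{x} - a \;:\; a\in\mathbb{R},\ \xi\in H^1_0(\Omega),\ \mathcal{Q}(a,\xi)\succeq 0\right\}.$$ *)

theory Defs
  imports "HOL-Analysis.Analysis"
begin

type_synonym plane = "real ^ 2"

section \<open>Square-integrable and smooth functions\<close>

text \<open>
  Functions on the open set \<open>\<Omega>\<close> are represented by total functions on the plane, of which
  only the values on \<open>\<Omega>\<close>, up to Lebesgue null sets, matter.
\<close>

definition L2 :: "plane set \<Rightarrow> (plane \<Rightarrow> 'b::euclidean_space) \<Rightarrow> bool" where
  "L2 \<Omega> u \<longleftrightarrow> u \<in> borel_measurable (lebesgue_on \<Omega>) \<and>
    integrable (lebesgue_on \<Omega>) (\<lambda>x. (norm (u x))\<^sup>2)"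

definition L2norm :: "plane set \<Rightarrow> (plane \<Rightarrow> 'b::euclidean_space) \<Rightarrow> real" where
  "L2norm \<Omega> u = sqrt (\<integral>x. (norm (u x))\<^sup>2 \<partial>lebesgue_on \<Omega>)"

definition ess_bounded :: "plane set \<Rightarrow> (plane \<Rightarrow> real) \<Rightarrow> bool" where
  "ess_bounded \<Omega> u \<longleftrightarrow> (\<exists>M. AE x in lebesgue_on \<Omega>. \<bar>u x\<bar> \<le> M)"

definition partial_deriv :: "2 \<Rightarrow> (plane \<Rightarrow> real) \<Rightarrow> plane \<Rightarrow> real" where
  "partial_deriv i \<phi> x = frechet_derivative \<phi> (at x) (axis i 1)"

primrec Ck :: "nat \<Rightarrow> (plane \<Rightarrow> real) \<Rightarrow> bool" where
  "Ck 0 \<phi> \<longleftrightarrow> continuous_on UNIV \<phi>"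
| "Ck (Suc k) \<phi> \<longleftrightarrow> \<phi> differentiable_on UNIV \<and> (\<forall>i. Ck k (partial_deriv i \<phi>))"

definition smooth :: "(plane \<Rightarrow> real) \<Rightarrow> bool" where
  "smooth \<phi> \<longleftrightarrow> (\<forall>k. Ck k \<phi>)"

definition test_fun :: "plane set \<Rightarrow> (plane \<Rightarrow> real) set" where
  "test_fun \<Omega> = {\<phi>. smooth \<phi> \<and> compact (closure {x. \<phi> x \<noteq> 0}) \<and> closure {x. \<phi> x \<noteq> 0} \<subseteq> \<Omega>}"


section \<open>Sobolev spaces\<close>

definition weak_gradient :: "plane set \<Rightarrow> (plane \<Rightarrow> real) \<Rightarrow> (plane \<Rightarrow> plane) \<Rightarrow> bool" where
  "weak_gradient \<Omega> u g \<longleftrightarrow> (\<forall>\<phi>\<in>test_fun \<Omega>. \<forall>i.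
     (\<integral>x. u x * partial_deriv i \<phi> x \<partial>lebesgue_on \<Omega>) = - (\<integral>x. g x $ i * \<phi> x \<partial>lebesgue_on \<Omega>))"

definition H1 :: "plane set \<Rightarrow> (plane \<Rightarrow> real) set" where
  "H1 \<Omega> = {u. L2 \<Omega> u \<and> (\<exists>g. L2 \<Omega> g \<and> weak_gradient \<Omega> u g)}"

text \<open>The choice below is unique up to null sets.\<close>

definition grad :: "plane set \<Rightarrow> (plane \<Rightarrow> real) \<Rightarrow> plane \<Rightarrow> plane" where
  "grad \<Omega> u = (SOME g. L2 \<Omega> g \<and> weak_gradient \<Omega> u g)"

definition perp_grad :: "plane set \<Rightarrow> (plane \<Rightarrow> real) \<Rightarrow> plane \<Rightarrow> plane" where
  "perp_grad \<Omega> \<psi> x = vector [grad \<Omega> \<psi> x $ 2, - grad \<Omega> \<psi> x $ 1]"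

definition H1norm :: "plane set \<Rightarrow> (plane \<Rightarrow> real) \<Rightarrow> real" where
  "H1norm \<Omega> u = sqrt ((L2norm \<Omega> u)\<^sup>2 + (L2norm \<Omega> (grad \<Omega> u))\<^sup>2)"

definition H1_conv :: "plane set \<Rightarrow> (nat \<Rightarrow> plane \<Rightarrow> real) \<Rightarrow> (plane \<Rightarrow> real) \<Rightarrow> bool" where
  "H1_conv \<Omega> v u \<longleftrightarrow> (\<lambda>n. H1norm \<Omega> (\<lambda>x. v n x - u x)) \<longlonglongrightarrow> 0"

definition H10 :: "plane set \<Rightarrow> (plane \<Rightarrow> real) set" where
  "H10 \<Omega> = {u \<in> H1 \<Omega>. \<exists>\<phi>. (\<forall>n. \<phi> n \<in> test_fun \<Omega>) \<and> H1_conv \<Omega> \<phi> u}"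

text \<open>
  An element \<open>f\<close> of \<open>Hminus1 \<Omega>\<close> is a bounded linear functional on \<open>H10 \<Omega>\<close>; the pairing
  of \<open>f\<close> with \<open>\<xi>\<close> is \<open>f \<xi>\<close>.
\<close>

definition Hminus1 :: "plane set \<Rightarrow> ((plane \<Rightarrow> real) \<Rightarrow> real) set" where
  "Hminus1 \<Omega> = {f.
     (\<forall>\<phi>\<in>H10 \<Omega>. \<forall>\<eta>\<in>H10 \<Omega>. f (\<lambda>x. \<phi> x + \<eta> x) = f \<phi> + f \<eta>) \<and>
     (\<forall>r. \<forall>\<phi>\<in>H10 \<Omega>. f (\<lambda>x. r * \<phi> x) = r * f \<phi>) \<and>
     (\<exists>C. \<forall>\<phi>\<in>H10 \<Omega>. \<bar>f \<phi>\<bar> \<le> C * L2norm \<Omega> (grad \<Omega> \<phi>))}"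

definition Hminus1_norm :: "plane set \<Rightarrow> ((plane \<Rightarrow> real) \<Rightarrow> real) \<Rightarrow> real" where
  "Hminus1_norm \<Omega> f =
     (SUP \<phi> \<in> {\<phi> \<in> H10 \<Omega>. \<not> (AE x in lebesgue_on \<Omega>. \<phi> x = 0)}. \<bar>f \<phi>\<bar> / L2norm \<Omega> (grad \<Omega> \<phi>))"


section \<open>Lipschitz boundaries, traces and streamfunctions\<close>

definition lipschitz_boundary :: "plane set \<Rightarrow> bool" where
  "lipschitz_boundary \<Omega> \<longleftrightarrow> (\<forall>z \<in> frontier \<Omega>. \<exists>r > 0. \<exists>R \<gamma> K.
     orthogonal_transformation (R :: plane \<Rightarrow> plane) \<and> K-lipschitz_on UNIV (\<gamma> :: real \<Rightarrow> real) \<and>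
     \<Omega> \<inter> ball z r = {x \<in> ball z r. \<gamma> (R x $ 1) < R x $ 2})"

text \<open>
  One-dimensional Hausdorff outer measure. It is a measure on the Borel sets (being a metric
  outer measure), so that \<open>measure_of\<close> does not degenerate, and on the boundary of a Lipschitz
  domain it is the arc length. Boundedness of the covering sets is required explicitly because
  \<open>diameter\<close> is meaningless for unbounded sets.
\<close>

definition hausdorff1 :: "plane set \<Rightarrow> ennreal" where
  "hausdorff1 A = (SUP \<delta> \<in> {0<..}. INF C \<in> {C :: nat \<Rightarrow> plane set.
      A \<subseteq> (\<Union>i. C i) \<and> (\<forall>i. bounded (C i) \<and> diameter (C i) \<le> \<delta>)}.
      \<Sum>i. ennreal (diameter (C i)))"

definition arc_measure :: "plane measure" where
  "arc_measure = measure_of UNIV (sets borel) hausdorff1"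

text \<open>
  The trace operator is the continuous extension to \<open>H1 \<Omega>\<close>, with values in \<open>L\<^sup>2\<close> of the boundary,
  of the restriction to the boundary of functions smooth up to the boundary;
  \<open>has_trace \<Omega> u g\<close> says that \<open>g\<close> represents the trace of \<open>u\<close>.
\<close>

definition has_trace :: "plane set \<Rightarrow> (plane \<Rightarrow> real) \<Rightarrow> (plane \<Rightarrow> real) \<Rightarrow> bool" where
  "has_trace \<Omega> u g \<longleftrightarrow> g \<in> borel_measurable borel \<and>
     (\<exists>\<phi>. (\<forall>n. smooth (\<phi> n)) \<and> H1_conv \<Omega> \<phi> u \<and>
       (\<lambda>n. \<integral>\<^sup>+x\<in>frontier \<Omega>. ennreal ((\<phi> n x - g x)\<^sup>2) \<partial>arc_measure) \<longlonglongrightarrow> 0)"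

definition exterior_boundary :: "plane set \<Rightarrow> plane set" where
  "exterior_boundary \<Omega> = frontier (outside (closure \<Omega>))"

definition streamfunctions :: "plane set \<Rightarrow> (plane \<Rightarrow> real) set" where
  "streamfunctions \<Omega> = {\<psi> \<in> H1 \<Omega>. \<exists>g. has_trace \<Omega> \<psi> g \<and>
     (AE x in arc_measure. x \<in> exterior_boundary \<Omega> \<longrightarrow> g x = 0) \<and>
     (\<forall>\<Gamma> \<in> components (frontier \<Omega>) - {exterior_boundary \<Omega>}.
        \<exists>c. AE x in arc_measure. x \<in> \<Gamma> \<longrightarrow> g x = c)}"


section \<open>The trilinear term\<close>

text \<open>
  \<open>advection \<Omega> u T \<xi>\<close> is the integral of \<open>\<xi> * (u \<bullet> grad \<Omega> T)\<close>, which is absolutely convergent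
  for bounded \<open>\<xi>\<close>, and its continuous extension in \<open>\<xi>\<close> from \<open>H10 \<Omega> \<inter> L\<^sup>\<infinity>\<close> to \<open>H10 \<Omega>\<close> otherwise.
\<close>

definition advection ::
    "plane set \<Rightarrow> (plane \<Rightarrow> plane) \<Rightarrow> (plane \<Rightarrow> real) \<Rightarrow> (plane \<Rightarrow> real) \<Rightarrow> real" where
  "advection \<Omega> u T \<xi> =
     (if ess_bounded \<Omega> \<xi> then \<integral>x. \<xi> x * (u x \<bullet> grad \<Omega> T x) \<partial>lebesgue_on \<Omega>
      else THE l. \<forall>\<eta>. (\<forall>n. \<eta> n \<in> H10 \<Omega> \<and> ess_bounded \<Omega> (\<eta> n)) \<and> H1_conv \<Omega> \<eta> \<xi> \<longrightarrow>
             (\<lambda>n. \<integral>x. \<eta> n x * (u x \<bullet> grad \<Omega> T x) \<partial>lebesgue_on \<Omega>) \<longlonglongrightarrow> l)"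


section \<open>The optimal cooling problem and its dual\<close>

definition admissible :: "plane set \<Rightarrow> real \<Rightarrow> (plane \<Rightarrow> plane) set" where
  "admissible \<Omega> Pe = {u. L2 \<Omega> u \<and>
     (\<forall>\<phi>\<in>H1 \<Omega>. (\<integral>x. u x \<bullet> grad \<Omega> \<phi> x \<partial>lebesgue_on \<Omega>) = 0) \<and> L2norm \<Omega> u \<le> Pe}"

definition weak_solution ::
    "plane set \<Rightarrow> ((plane \<Rightarrow> real) \<Rightarrow> real) \<Rightarrow> (plane \<Rightarrow> plane) \<Rightarrow> (plane \<Rightarrow> real) \<Rightarrow> bool" where
  "weak_solution \<Omega> f u T \<longleftrightarrow> T \<in> H10 \<Omega> \<and> (\<forall>\<xi>\<in>H10 \<Omega>.
     (\<integral>x. grad \<Omega> \<xi> x \<bullet> grad \<Omega> T x \<partial>lebesgue_on \<Omega>) + advection \<Omega> u T \<xi> - f \<xi> = 0)"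

text \<open>
  The optimal values are extended reals, so that no unspecified value of an infimum or supremum
  in the reals can enter.
\<close>

definition primal_value :: "plane set \<Rightarrow> ((plane \<Rightarrow> real) \<Rightarrow> real) \<Rightarrow> real \<Rightarrow> ereal" where
  "primal_value \<Omega> f Pe =
     (INF (u, T) \<in> {(u, T). u \<in> admissible \<Omega> Pe \<and> weak_solution \<Omega> f u T}.
        ereal (\<integral>x. (norm (grad \<Omega> T x))\<^sup>2 \<partial>lebesgue_on \<Omega>))"

definition dual_form ::
    "plane set \<Rightarrow> real \<Rightarrow> real \<Rightarrow> (plane \<Rightarrow> real) \<Rightarrow> (plane \<Rightarrow> real) \<Rightarrow> (plane \<Rightarrow> real) \<Rightarrow> real" where
  "dual_form \<Omega> Pe a \<xi> \<psi> \<theta> =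
     (\<integral>x. a * (norm (grad \<Omega> \<psi> x))\<^sup>2 + (norm (grad \<Omega> \<theta> x))\<^sup>2 \<partial>lebesgue_on \<Omega>)
     - Pe * advection \<Omega> (perp_grad \<Omega> \<psi>) \<theta> \<xi>"

definition dual_feasible :: "plane set \<Rightarrow> real \<Rightarrow> real \<Rightarrow> (plane \<Rightarrow> real) \<Rightarrow> bool" where
  "dual_feasible \<Omega> Pe a \<xi> \<longleftrightarrow> \<xi> \<in> H10 \<Omega> \<and>
     (\<forall>\<psi>\<in>streamfunctions \<Omega>. \<forall>\<theta>\<in>H10 \<Omega>. dual_form \<Omega> Pe a \<xi> \<psi> \<theta> \<ge> 0)"

definition dual_value :: "plane set \<Rightarrow> ((plane \<Rightarrow> real) \<Rightarrow> real) \<Rightarrow> real \<Rightarrow> ereal" where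
  "dual_value \<Omega> f Pe =
     (SUP (a, \<xi>) \<in> {(a, \<xi>). dual_feasible \<Omega> Pe a \<xi>}.
        ereal (f \<xi> - (\<integral>x. (norm (grad \<Omega> \<xi> x))\<^sup>2 \<partial>lebesgue_on \<Omega>) / 4 - a))"

definition cooling_efficiency :: "plane set \<Rightarrow> ((plane \<Rightarrow> real) \<Rightarrow> real) \<Rightarrow> real \<Rightarrow> ereal" where
  "cooling_efficiency \<Omega> f Pe = ereal ((Hminus1_norm \<Omega> f)\<^sup>2) / primal_value \<Omega> f Pe"

end

theory Submission
  imports Defs
begin

text \<open>
  Write an admissible velocity as \<open>u = Pe \<nabla>\<^sup>\<bottom>\<psi>\<close> with \<open>\<parallel>\<nabla>\<psi>\<parallel> \<le> 1\<close>. Testing the equation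
  for \<open>T\<close> with a dual variable \<open>\<xi>\<close> and putting \<open>\<theta> = T - \<xi> / 2\<close> turns the duality gap into the dual
  quadratic form at \<open>(\<psi>, \<theta>)\<close>, up to a nonnegative term. The choice
  \<open>a = c\<^sup>2 Pe\<^sup>2 \<parallel>\<nabla>\<xi>\<parallel>\<^sup>2 / 4\<close> is feasible by the trilinear estimate, and optimising the dual
  objective over multiples of a fixed function gives the lower bound.

  The stream function is the integral of the first component of \<open>u\<close> (extended by zero) along vertical
  lines. It is constant on every connected part of the exterior and zero on the unbounded one. After a
  partition of unity, subtracting the local exterior constant leaves pieces that vanish outside the
  closure of \<open>\<Omega>\<close>; the Lipschitz condition allows them to be mollified into \<open>\<Omega>\<close>, hence they lie in
  \<open>H10 \<Omega>\<close>. So the stream function is an element of \<open>H10 \<Omega>\<close> plus a smooth function with constant boundary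
  values on each component, which is its trace.
\<close>

section \<open>Smooth functions\<close>

text \<open>Since u is merely square integrable, \<open>advection\<close> may be a limit picked out
  by THE, and little can be proved about it without a continuity estimate. The hypothesis gives one
  only for rotated gradients of \<open>streamfunctions\<close>, so u must be represented by a stream
  function before the equation for T becomes usable; the cancellation of the term with \<xi> in both
  slots then passes from test functions to \<xi>. The obstacle is membership in
  \<open>streamfunctions\<close>, which asks for a trace. Approximants of the form test function
  plus smooth w agree with w on the boundary exactly, so the boundary integrals in
  \<open>has_trace\<close> are zero, not merely small. The denominator: the multiplier a has the
  same shape as the quadratic term already present in the dual objective, and the two merge into the
  factor K = 1 + c^2 Pe^2; the maximum over t of t m - K N^2 t^2 / 4 is m^2 / (K N^2).\<close>

lemma partial_deriv_eq:
  assumes "(\<phi> has_derivative D) (at x)"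
  shows "partial_deriv i \<phi> x = D (axis i 1)"
  using frechet_derivative_at[OF assms] by (simp add: partial_deriv_def)

lemma has_derivative_partial_deriv:
  fixes \<phi> :: "plane \<Rightarrow> real"
  assumes "\<phi> differentiable at x"
  shows "(\<phi> has_derivative (\<lambda>h. \<Sum>i\<in>UNIV. h $ i * partial_deriv i \<phi> x)) (at x)"
proof -
  have D: "(\<phi> has_derivative frechet_derivative \<phi> (at x)) (at x)"
    using assms frechet_derivative_works by blast
  have lin: "linear (frechet_derivative \<phi> (at x))"
    using D has_derivative_linear by blast
  have "frechet_derivative \<phi> (at x) h = (\<Sum>i\<in>UNIV. h $ i * partial_deriv i \<phi> x)" for h
  proof -
    have "frechet_derivative \<phi> (at x) h = frechet_derivative \<phi> (at x) (\<Sum>i\<in>UNIV. h $ i *\<^sub>R axis i 1)"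
      by (simp add: basis_expansion scalar_mult_eq_scaleR[symmetric])
    also have "\<dots> = (\<Sum>i\<in>UNIV. h $ i * partial_deriv i \<phi> x)"
      by (simp add: linear_sum[OF lin] linear_cmul[OF lin] partial_deriv_def)
    finally show ?thesis .
  qed
  then show ?thesis using D by presburger
qed

text \<open>The product rule pairs a derivative with an undifferentiated factor, which has to be
  lowered by one order before the induction in \<open>Ck_mult\<close> applies.\<close>

lemma Ck_Suc_imp: "Ck (Suc k) \<phi> \<Longrightarrow> Ck k \<phi>"
  by (induction k arbitrary: \<phi>) (auto simp: differentiable_imp_continuous_on)

lemma Ck_const: "Ck k (\<lambda>x. a)"
proof (induction k arbitrary: a)
  case (Suc k)
  have "partial_deriv i (\<lambda>x. a) = (\<lambda>x. 0)" for i
    by (rule ext) (rule partial_deriv_eq[OF has_derivative_const])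
  with Suc show ?case by simp
qed simp

lemma partial_deriv_add:
  assumes "f differentiable_on UNIV" "g differentiable_on UNIV"
  shows "partial_deriv i (\<lambda>x. f x + g x) = (\<lambda>x. partial_deriv i f x + partial_deriv i g x)"
proof
  fix x
  have "f differentiable at x" "g differentiable at x"
    using assms by (auto simp: differentiable_on_def)
  then have "((\<lambda>x. f x + g x) has_derivative
     (\<lambda>h. frechet_derivative f (at x) h + frechet_derivative g (at x) h)) (at x)"
    by (intro has_derivative_add) (auto simp: frechet_derivative_works)
  from partial_deriv_eq[OF this]
  show "partial_deriv i (\<lambda>x. f x + g x) x = partial_deriv i f x + partial_deriv i g x"
    by (simp add: partial_deriv_def)
qed

lemma partial_deriv_mult:
  assumes "f differentiable_on UNIV" "g differentiable_on UNIV"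
  shows "partial_deriv i (\<lambda>x. f x * g x)
    = (\<lambda>x. f x * partial_deriv i g x + partial_deriv i f x * g x)"
proof
  fix x
  have "f differentiable at x" "g differentiable at x"
    using assms by (auto simp: differentiable_on_def)
  then have "((\<lambda>x. f x * g x) has_derivative
     (\<lambda>h. f x * frechet_derivative g (at x) h + frechet_derivative f (at x) h * g x)) (at x)"
    by (intro has_derivative_mult) (auto simp: frechet_derivative_works)
  from partial_deriv_eq[OF this]
  show "partial_deriv i (\<lambda>x. f x * g x) x = f x * partial_deriv i g x + partial_deriv i f x * g x"
    by (simp add: partial_deriv_def)
qed

text \<open>One form covers three substitutions: translation (s = 1), reflection inside convolutions
  (s = - 1), and rescaling of the bump.\<close>

lemma partial_deriv_affine:
  assumes "f differentiable_on UNIV"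
  shows "partial_deriv i (\<lambda>x. f (a + s *\<^sub>R x)) = (\<lambda>x. s * partial_deriv i f (a + s *\<^sub>R x))"
proof
  fix x
  have "f differentiable at (a + s *\<^sub>R x)"
    using assms by (auto simp: differentiable_on_def)
  then have D: "(f has_derivative frechet_derivative f (at (a + s *\<^sub>R x))) (at (a + s *\<^sub>R x))"
    by (simp add: frechet_derivative_works)
  have "((\<lambda>x. a + s *\<^sub>R x) has_derivative (\<lambda>h. s *\<^sub>R h)) (at x)"
    by (auto intro!: derivative_eq_intros)
  from has_derivative_compose[OF this D]
  have "((\<lambda>x. f (a + s *\<^sub>R x)) has_derivative
      (\<lambda>h. frechet_derivative f (at (a + s *\<^sub>R x)) (s *\<^sub>R h))) (at x)" .
  from partial_deriv_eq[OF this] linear_cmul[OF has_derivative_linear[OF D]]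
  show "partial_deriv i (\<lambda>x. f (a + s *\<^sub>R x)) x = s * partial_deriv i f (a + s *\<^sub>R x)"
    by (simp add: partial_deriv_def)
qed

lemma differentiable_on_UNIV_iff: "f differentiable_on UNIV \<longleftrightarrow> (\<forall>x. f differentiable at x)"
  by (simp add: differentiable_on_def)

lemma differentiable_affine:
  fixes f :: "plane \<Rightarrow> real"
  assumes "f differentiable_on UNIV"
  shows "(\<lambda>x. f (a + s *\<^sub>R x)) differentiable_on UNIV"
  unfolding differentiable_on_UNIV_iff
proof
  fix x
  have "(\<lambda>x. a + s *\<^sub>R x) differentiable at x"
    by (rule differentiableI[where f' = "\<lambda>h. s *\<^sub>R h"]) (auto intro!: derivative_eq_intros)
  then show "(\<lambda>x. f (a + s *\<^sub>R x)) differentiable at x"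
    using assms differentiable_compose[of f "\<lambda>x. a + s *\<^sub>R x" x UNIV]
    by (auto simp: differentiable_on_UNIV_iff)
qed

lemma Ck_add: "Ck k f \<Longrightarrow> Ck k g \<Longrightarrow> Ck k (\<lambda>x. f x + g x)"
  by (induction k arbitrary: f g)
     (auto simp: partial_deriv_add continuous_on_add intro!: differentiable_on_add)

lemma Ck_mult: "Ck k f \<Longrightarrow> Ck k g \<Longrightarrow> Ck k (\<lambda>x. f x * g x)"
proof (induction k arbitrary: f g)
  case (Suc k)
  have fg: "Ck k f" "Ck k g" using Suc.prems Ck_Suc_imp by blast+
  show ?case
    using Suc.prems fg by (auto simp: partial_deriv_mult intro!: differentiable_on_mult Ck_add Suc.IH)
qed (auto intro: continuous_on_mult)

lemma Ck_affine: "Ck k f \<Longrightarrow> Ck k (\<lambda>x. f (a + s *\<^sub>R x))"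
proof (induction k arbitrary: f)
  case 0
  then have "continuous_on UNIV f" by simp
  then have "continuous_on UNIV (\<lambda>x. f (a + s *\<^sub>R x))"
    by (rule continuous_on_compose2) (auto intro!: continuous_intros)
  then show ?case by simp
next
  case (Suc k)
  then show ?case
    by (auto simp: partial_deriv_affine intro!: differentiable_affine Ck_mult Ck_const)
qed

lemma smooth_const: "smooth (\<lambda>x. r)"
  and smooth_add: "smooth f \<Longrightarrow> smooth g \<Longrightarrow> smooth (\<lambda>x. f x + g x)"
  and smooth_mult: "smooth f \<Longrightarrow> smooth g \<Longrightarrow> smooth (\<lambda>x. f x * g x)"
  and smooth_affine: "smooth f \<Longrightarrow> smooth (\<lambda>x. f (a + s *\<^sub>R x))"
  by (simp_all add: smooth_def Ck_const Ck_add Ck_mult Ck_affine)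

lemma smooth_cmult: "smooth f \<Longrightarrow> smooth (\<lambda>x. r * f x)"
  by (simp add: smooth_mult smooth_const)

lemma smooth_diff: "smooth f \<Longrightarrow> smooth g \<Longrightarrow> smooth (\<lambda>x. f x - g x)"
  using smooth_add[OF _ smooth_cmult[of g "-1"]] by simp

lemma smooth_sum: "(\<And>k. k \<in> A \<Longrightarrow> smooth (f k)) \<Longrightarrow> smooth (\<lambda>x. \<Sum>k\<in>A. f k x)"
  by (induction A rule: infinite_finite_induct) (auto simp: smooth_const smooth_add)

lemma smooth_prod: "(\<And>k. k \<in> A \<Longrightarrow> smooth (f k)) \<Longrightarrow> smooth (\<lambda>x. \<Prod>k\<in>A. f k x)"
  by (induction A rule: infinite_finite_induct) (auto simp: smooth_const smooth_mult)

lemma smooth_partial_deriv: "smooth f \<Longrightarrow> smooth (partial_deriv i f)"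
  unfolding smooth_def using Ck.simps(2) by blast

lemma smooth_differentiable: "smooth f \<Longrightarrow> f differentiable_on UNIV"
  unfolding smooth_def using Ck.simps(2) by blast

lemma smooth_differentiable_at: "smooth f \<Longrightarrow> f differentiable at x"
  using smooth_differentiable by (simp add: differentiable_on_UNIV_iff)

lemma smooth_continuous: "smooth f \<Longrightarrow> continuous_on S f"
  using continuous_on_subset[of UNIV f S] by (auto simp: smooth_def dest: spec[of _ 0])

lemma smooth_borel: "smooth f \<Longrightarrow> f \<in> borel_measurable borel"
  by (simp add: borel_measurable_continuous_onI smooth_continuous)

lemma smooth_has_derivative:
  "smooth f \<Longrightarrow> (f has_derivative (\<lambda>h. \<Sum>i\<in>UNIV. h $ i * partial_deriv i f x)) (at x)"
  by (simp add: has_derivative_partial_deriv smooth_differentiable_at)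

section \<open>Test functions\<close>

text \<open>Trades the closure in \<open>test_fun\<close> for any compact set containing the nonzero
  points, the form in which supports are controlled later.\<close>

lemma test_funI:
  assumes "smooth f" "compact K" "K \<subseteq> \<Omega>" "\<And>x. f x \<noteq> 0 \<Longrightarrow> x \<in> K"
  shows "f \<in> test_fun \<Omega>"
proof -
  have "closure {x. f x \<noteq> 0} \<subseteq> K"
    using assms compact_imp_closed by (intro closure_minimal) auto
  moreover from this have "compact (closure {x. f x \<noteq> 0})"
    using assms(2) by (metis closed_closure closed_Int_compact inf.absorb1)
  ultimately show ?thesis using assms by (auto simp: test_fun_def)
qed

lemma test_funE:
  assumes "f \<in> test_fun \<Omega>"
  obtains K where "smooth f" "compact K" "K \<subseteq> \<Omega>" "\<And>x. f x \<noteq> 0 \<Longrightarrow> x \<in> K" "\<And>x. x \<notin> \<Omega> \<Longrightarrow> f x = 0"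
proof
  show "smooth f" "compact (closure {x. f x \<noteq> 0})" "closure {x. f x \<noteq> 0} \<subseteq> \<Omega>"
    using assms by (auto simp: test_fun_def)
  show "x \<in> closure {x. f x \<noteq> 0}" if "f x \<noteq> 0" for x
    using that closure_subset by fastforce
  then show "f x = 0" if "x \<notin> \<Omega>" for x
    using that \<open>closure {x. f x \<noteq> 0} \<subseteq> \<Omega>\<close> by blast
qed

lemma test_fun_smooth: "f \<in> test_fun \<Omega> \<Longrightarrow> smooth f"
  by (simp add: test_fun_def)

lemma test_fun_mono: "f \<in> test_fun \<Omega> \<Longrightarrow> \<Omega> \<subseteq> \<Omega>' \<Longrightarrow> f \<in> test_fun \<Omega>'"
  by (auto simp: test_fun_def)

lemma test_fun_outside: "f \<in> test_fun \<Omega> \<Longrightarrow> x \<notin> \<Omega> \<Longrightarrow> f x = 0"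
  by (erule test_funE) blast

lemma test_fun_mult:
  assumes "smooth f" "g \<in> test_fun \<Omega>"
  shows "(\<lambda>x. f x * g x) \<in> test_fun \<Omega>"
  using assms(2)
proof (rule test_funE)
  fix K assume "smooth g" "compact K" "K \<subseteq> \<Omega>" "\<And>x. g x \<noteq> 0 \<Longrightarrow> x \<in> K"
  then show ?thesis
    using assms(1) by (intro test_funI[of _ K]) (auto intro: smooth_mult)
qed

lemma test_fun_cmult: "g \<in> test_fun \<Omega> \<Longrightarrow> (\<lambda>x. r * g x) \<in> test_fun \<Omega>"
  by (rule test_fun_mult[OF smooth_const])

lemma test_fun_add:
  assumes "f \<in> test_fun \<Omega>" "g \<in> test_fun \<Omega>"
  shows "(\<lambda>x. f x + g x) \<in> test_fun \<Omega>"
proof -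
  obtain K where K: "smooth f" "compact K" "K \<subseteq> \<Omega>" "\<And>x. f x \<noteq> 0 \<Longrightarrow> x \<in> K"
    by (rule test_funE[OF assms(1)]) (rule that)
  obtain K' where K': "smooth g" "compact K'" "K' \<subseteq> \<Omega>" "\<And>x. g x \<noteq> 0 \<Longrightarrow> x \<in> K'"
    by (rule test_funE[OF assms(2)]) (rule that)
  show ?thesis
    using K K' by (intro test_funI[of _ "K \<union> K'"]) (force intro: smooth_add)+
qed

lemma test_fun_zero: "(\<lambda>x. 0) \<in> test_fun \<Omega>"
  by (rule test_funI[of _ "{}"]) (auto intro: smooth_const)

lemma test_fun_partial_deriv:
  assumes "f \<in> test_fun \<Omega>"
  shows "partial_deriv i f \<in> test_fun \<Omega>"
  using assms
proof (rule test_funE)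
  fix K assume K: "smooth f" "compact K" "K \<subseteq> \<Omega>" "\<And>x. f x \<noteq> 0 \<Longrightarrow> x \<in> K"
  have "x \<in> K" if "partial_deriv i f x \<noteq> 0" for x
  proof (rule ccontr)
    assume "x \<notin> K"
    have "((\<lambda>x. 0) has_derivative (\<lambda>h. 0)) (at x)" by simp
    then have "(f has_derivative (\<lambda>h. 0)) (at x)"
      by (rule has_derivative_transform_within_open[of _ _ _ _ "- K"])
        (use \<open>x \<notin> K\<close> K(4) compact_imp_closed[OF K(2)] in auto)
    from partial_deriv_eq[OF this] that show False by simp
  qed
  with K show ?thesis by (intro test_funI[of _ K]) (auto intro: smooth_partial_deriv)
qed

lemma test_fun_affine:
  assumes "f \<in> test_fun UNIV" "s \<noteq> 0"
  shows "(\<lambda>x. f (a + s *\<^sub>R x)) \<in> test_fun UNIV"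
  using assms(1)
proof (rule test_funE)
  fix K assume K: "smooth f" "compact K" "\<And>x. f x \<noteq> 0 \<Longrightarrow> x \<in> K"
  show ?thesis
  proof (rule test_funI[of _ "(\<lambda>y. (1/s) *\<^sub>R (y - a)) ` K"])
    show "compact ((\<lambda>y. (1/s) *\<^sub>R (y - a)) ` K)"
      by (intro compact_continuous_image K continuous_intros)
    show "x \<in> (\<lambda>y. (1/s) *\<^sub>R (y - a)) ` K" if "f (a + s *\<^sub>R x) \<noteq> 0" for x
      using K(3)[OF that] assms(2) by (intro image_eqI[of _ _ "a + s *\<^sub>R x"]) auto
  qed (auto intro: smooth_affine K)
qed

lemma test_fun_bounded:
  assumes "f \<in> test_fun \<Omega>"
  obtains M where "M > 0" "\<And>x. \<bar>f x\<bar> \<le> M"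
  using assms
proof (rule test_funE)
  fix K assume K: "smooth f" "compact K" "\<And>x. f x \<noteq> 0 \<Longrightarrow> x \<in> K"
  have "compact (f ` K)"
    by (intro compact_continuous_image K smooth_continuous)
  then have "bounded (f ` K)" by (rule compact_imp_bounded)
  then obtain M where "M > 0" "\<And>y. y \<in> f ` K \<Longrightarrow> norm y \<le> M"
    unfolding bounded_pos by blast
  with K(3) have "\<bar>f x\<bar> \<le> M" for x by (cases "f x = 0") auto
  with \<open>M > 0\<close> show ?thesis by (rule that)
qed

subsection \<open>A smooth bump function\<close>

text \<open>The derivatives of \<open>exp (- 1 / t)\<close> are polynomials in \<open>1 / t\<close> times \<open>exp (- 1 / t)\<close>.\<close>

definition flat_fun :: "real poly \<Rightarrow> real \<Rightarrow> real" where
  "flat_fun p t = (if t > 0 then poly p (1 / t) * exp (- (1 / t)) else 0)"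

lemma poly_mult_exp_tendsto: "((\<lambda>t. poly p t * exp (- t)) \<longlongrightarrow> (0::real)) at_top"
proof -
  \<comment> \<open>The free power k carries the induction: \<open>pCons b p\<close> splits into the
    monomial b t^k and the polynomial p with k raised by one.\<close>
  have "((\<lambda>t. t ^ k * (poly p t * exp (- t))) \<longlongrightarrow> (0::real)) at_top" for k
  proof (induction p arbitrary: k)
    case (pCons b p)
    have "((\<lambda>t::real. t ^ k * exp (- t)) \<longlongrightarrow> 0) at_top"
      using tendsto_power_div_exp_0[of k] by (simp add: exp_minus divide_inverse)
    from tendsto_add[OF tendsto_mult_right_zero[OF this, of b] pCons.IH[of "Suc k"]]
    show ?case by (simp add: algebra_simps)
  qed simp
  from this[of 0] show ?thesis by simp
qed

text \<open>With r = 1 / t one has dr/dt = - r^2, so differentiating p(r) exp(- r) gives r^2 (p -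
  p')(r) exp(- r), again a member of the family. At 0 the difference quotient from the right is r
  p(r) exp(- r), which tends to 0.\<close>

lemma flat_fun_has_derivative:
  "(flat_fun p has_real_derivative flat_fun ([:0, 0, 1:] * (p - pderiv p)) t) (at t)"
proof -
  consider "t > 0" | "t < 0" | "t = 0" by linarith
  then show ?thesis
  proof cases
    case 1
    have "((\<lambda>t. poly p (1 / t) * exp (- (1 / t))) has_real_derivative
        flat_fun ([:0, 0, 1:] * (p - pderiv p)) t) (at t)"
    proof -
      have "((\<lambda>t. 1 / t) has_real_derivative - (1 / t * (1 / t))) (at t)"
        using DERIV_inverse[of t UNIV] 1 by (simp add: divide_inverse power2_eq_square)
      note D = this DERIV_chain2[OF poly_DERIV this] DERIV_chain2[OF DERIV_exp DERIV_minus[OF this]]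
      have "exp (- r) * - (- (r * r)) * poly p r + poly (pderiv p) r * - (r * r) * exp (- r)
          = poly ([:0, 0, 1:] * (p - pderiv p)) r * exp (- r)" for r :: real
        by (simp only: poly_mult poly_diff poly_pCons poly_0) algebra
      from this[of "1 / t"] 1 show ?thesis
        by (intro DERIV_cong[OF DERIV_mult[OF D(2) D(3)]]) (simp add: flat_fun_def)
    qed
    then show ?thesis
      by (rule has_field_derivative_transform_within_open[where S = "{0<..}"])
        (use 1 in \<open>auto simp: flat_fun_def\<close>)
  next
    case 2
    have "((\<lambda>t. 0) has_real_derivative flat_fun ([:0, 0, 1:] * (p - pderiv p)) t) (at t)"
      using 2 by (simp add: flat_fun_def)
    then show ?thesis
      by (rule has_field_derivative_transform_within_open[where S = "{..<0}"])
        (use 2 in \<open>auto simp: flat_fun_def\<close>)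
  next
    case 3
    have "((\<lambda>h. (flat_fun p h) / h) \<longlongrightarrow> 0) (at 0)"
    proof (rule filterlim_split_at)
      show "((\<lambda>h. flat_fun p h / h) \<longlongrightarrow> 0) (at_left 0)"
        by (rule tendsto_eventually, rule eventually_mono[OF eventually_at_left_real[of "-1"]])
          (auto simp: flat_fun_def)
      have eq: "poly (pCons 0 p) (inverse h) * exp (- inverse h) = flat_fun p h / h" if "h > 0" for h
        using that by (simp only: flat_fun_def poly_pCons if_True inverse_eq_divide) simp
      show "((\<lambda>h. flat_fun p h / h) \<longlongrightarrow> 0) (at_right 0)"
      proof (rule Lim_transform_eventually)
        show "((\<lambda>h::real. poly (pCons 0 p) (inverse h) * exp (- inverse h)) \<longlongrightarrow> 0) (at_right 0)"
          by (rule filterlim_compose[OF poly_mult_exp_tendsto filterlim_inverse_at_top_right])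
        show "\<forall>\<^sub>F h in at_right 0. poly (pCons 0 p) (inverse h) * exp (- inverse h) = flat_fun p h / h"
          using eventually_at_right_less[of "0::real"] by (rule eventually_mono) (rule eq)
      qed
    qed
    then show ?thesis
      using 3 by (simp add: has_field_derivative_iff flat_fun_def)
  qed
qed

text \<open>The induction has to range over all p: a partial derivative changes the polynomial and
  contributes a constant factor.\<close>

lemma flat_fun_linear_smooth: "smooth (\<lambda>x::plane. flat_fun p (b + a \<bullet> x))"
proof -
  have "Ck k (\<lambda>x::plane. flat_fun p (b + a \<bullet> x))" for k
  proof (induction k arbitrary: p)
    case 0
    have "continuous_on UNIV (flat_fun p)"
      by (meson DERIV_continuous continuous_at_imp_continuous_on flat_fun_has_derivative)
    then have "continuous_on UNIV (\<lambda>x::plane. flat_fun p (b + a \<bullet> x))"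
      by (rule continuous_on_compose2) (auto intro!: continuous_intros)
    then show ?case by simp
  next
    case (Suc k)
    define q where "q = [:0, 0, 1:] * (p - pderiv p)"
    have D: "((\<lambda>x::plane. flat_fun p (b + a \<bullet> x)) has_derivative
        (\<lambda>h. (a \<bullet> h) * flat_fun q (b + a \<bullet> x))) (at x)" for x
    proof -
      have "((\<lambda>x. b + a \<bullet> x) has_derivative (\<lambda>h. a \<bullet> h)) (at x)"
        by (auto intro!: derivative_eq_intros)
      from has_derivative_compose[OF this has_field_derivative_imp_has_derivative[OF
            flat_fun_has_derivative[of p "b + a \<bullet> x"]]]
      show ?thesis by (simp add: q_def mult.commute)
    qed
    have "partial_deriv i (\<lambda>x::plane. flat_fun p (b + a \<bullet> x))
        = (\<lambda>x. (a \<bullet> axis i 1) * flat_fun q (b + a \<bullet> x))" for i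
      by (rule ext) (rule partial_deriv_eq[OF D])
    then show ?case
      using Suc D by (auto simp: differentiable_on_UNIV_iff differentiable_def intro!: Ck_mult Ck_const)
  qed
  then show ?thesis by (simp add: smooth_def)
qed

lemma bump_exists:
  assumes "\<delta> > 0"
  obtains \<rho> where "\<rho> \<in> test_fun UNIV" "\<And>x. \<rho> x \<ge> 0" "\<rho> a > 0" "\<And>x. \<rho> x \<noteq> 0 \<Longrightarrow> x \<in> ball a \<delta>"
proof -
  define h where "h s x = flat_fun 1 (1 + s \<bullet> x)" for s x :: plane
  \<comment> \<open>One-sided factors in 1 + x_1, 1 - x_1, 1 + x_2 and 1 - x_2; the product is
    positive exactly on the open square where both coordinates are below 1 in modulus.\<close>
  define \<beta> where "\<beta> x = h (axis 1 1) x * h (axis 1 (-1)) x * (h (axis 2 1) x * h (axis 2 (-1)) x)" for x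
  have h: "smooth (h s)" for s
    unfolding h_def by (rule flat_fun_linear_smooth)
  have "smooth \<beta>" unfolding \<beta>_def by (intro smooth_mult h)
  have supp: "norm x \<le> 2" if "\<beta> x \<noteq> 0" for x
  proof -
    have "-1 < x $ 1" "x $ 1 < 1" "-1 < x $ 2" "x $ 2 < 1"
      using that by (auto simp: \<beta>_def h_def flat_fun_def inner_axis' split: if_splits)
    then have "(\<Sum>i\<in>UNIV. \<bar>x $ i\<bar>) \<le> 2" by (simp add: sum_2)
    then show ?thesis using norm_le_l1_cart[of x] by linarith
  qed
  have "\<beta> \<in> test_fun UNIV"
    by (rule test_funI[of _ "cball 0 2"]) (use supp \<open>smooth \<beta>\<close> in auto)
  have pos: "\<beta> x \<ge> 0" for x by (simp add: \<beta>_def h_def flat_fun_def)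
  \<comment> \<open>The support of \<beta> has norm at most 2, so scaling by 3 / \<delta> shrinks it
    to radius 2 \<delta> / 3, strictly inside the ball.\<close>
  define s where "s = 3 / \<delta>"
  have "s > 0" using assms by (simp add: s_def)
  show ?thesis
  proof (rule that[of "\<lambda>x. \<beta> (- s *\<^sub>R a + s *\<^sub>R x)"])
    show "(\<lambda>x. \<beta> (- s *\<^sub>R a + s *\<^sub>R x)) \<in> test_fun UNIV"
      using \<open>s > 0\<close> by (intro test_fun_affine \<open>\<beta> \<in> test_fun UNIV\<close>) auto
    show "\<beta> (- s *\<^sub>R a + s *\<^sub>R a) > 0"
      by (simp add: \<beta>_def h_def flat_fun_def)
    show "x \<in> ball a \<delta>" if "\<beta> (- s *\<^sub>R a + s *\<^sub>R x) \<noteq> 0" for x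
    proof -
      have "- s *\<^sub>R a + s *\<^sub>R x = s *\<^sub>R (x - a)"
        by (simp add: scaleR_right_diff_distrib)
      then have "norm (- s *\<^sub>R a + s *\<^sub>R x) = s * norm (a - x)"
        using \<open>s > 0\<close> by (metis abs_of_pos norm_minus_commute norm_scaleR)
      then have "s * norm (a - x) \<le> 2" using supp[OF that] by simp
      then have "norm (a - x) \<le> 2 * \<delta> / 3"
        using assms by (simp add: s_def field_simps)
      then show ?thesis using assms by (simp add: dist_norm)
    qed
  qed (rule pos)
qed

section \<open>Square-integrable functions\<close>

lemma two_abs_mult_le: "2 * \<bar>a * b\<bar> \<le> a\<^sup>2 + (b\<^sup>2 :: real)"
  using sum_squares_bound[of a b] sum_squares_bound[of a "- b"] by (auto simp: abs_if)

lemma integrable_mult_square: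
  fixes f g :: "'a \<Rightarrow> real"
  assumes [measurable]: "f \<in> borel_measurable M" "g \<in> borel_measurable M"
    and "integrable M (\<lambda>x. (f x)\<^sup>2)" "integrable M (\<lambda>x. (g x)\<^sup>2)"
  shows "integrable M (\<lambda>x. f x * g x)"
proof (rule Bochner_Integration.integrable_bound)
  show "integrable M (\<lambda>x. (f x)\<^sup>2 + (g x)\<^sup>2)" using assms by simp
  have "\<bar>a * b\<bar> \<le> a\<^sup>2 + b\<^sup>2" for a b :: real
    using two_abs_mult_le[of a b] by (smt (verit))
  then show "AE x in M. norm (f x * g x) \<le> norm ((f x)\<^sup>2 + (g x)\<^sup>2)" by simp
qed measurable

lemma integral_Cauchy_Schwarz:
  fixes f g :: "'a \<Rightarrow> real"
  assumes [measurable]: "f \<in> borel_measurable M" "g \<in> borel_measurable M"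
    and f: "integrable M (\<lambda>x. (f x)\<^sup>2)" and g: "integrable M (\<lambda>x. (g x)\<^sup>2)"
  shows "(\<integral>x. f x * g x \<partial>M)\<^sup>2 \<le> (\<integral>x. (f x)\<^sup>2 \<partial>M) * (\<integral>x. (g x)\<^sup>2 \<partial>M)"
proof -
  define A B C where "A = (\<integral>x. (f x)\<^sup>2 \<partial>M)" and "B = (\<integral>x. f x * g x \<partial>M)" and "C = (\<integral>x. (g x)\<^sup>2 \<partial>M)"
  have fg: "integrable M (\<lambda>x. f x * g x)" using assms by (rule integrable_mult_square)
  have quad: "t\<^sup>2 * A - 2 * t * B + C \<ge> 0" for t
  proof -
    have "0 \<le> (\<integral>x. (t * f x - g x)\<^sup>2 \<partial>M)" by simp
    also have "\<dots> = (\<integral>x. t\<^sup>2 * (f x)\<^sup>2 - 2 * t * (f x * g x) + (g x)\<^sup>2 \<partial>M)"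
      by (intro Bochner_Integration.integral_cong) (auto simp: power2_eq_square algebra_simps)
    also have "\<dots> = t\<^sup>2 * A - 2 * t * B + C"
      using f g fg by (simp add: A_def B_def C_def)
    finally show ?thesis .
  qed
  have "A \<ge> 0" by (simp add: A_def)
  have "B\<^sup>2 \<le> A * C"
  proof (cases "A = 0")
    case True
    then have "AE x in M. (f x)\<^sup>2 = 0"
      using integral_nonneg_eq_0_iff_AE[OF f] by (simp add: A_def)
    then have "AE x in M. f x * g x = 0" by auto
    then have "B = 0" unfolding B_def by (rule integral_eq_zero_AE)
    then show ?thesis using True by simp
  next
    case False
    then have "A > 0" using \<open>A \<ge> 0\<close> by simp
    \<comment> \<open>B / A is the minimiser of the quadratic in t.\<close>
    with quad[of "B / A"] show ?thesis
      by (simp add: power2_eq_square field_simps)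
  qed
  then show ?thesis by (simp add: A_def B_def C_def)
qed

lemma integral_square_add_le:
  fixes f g :: "'a \<Rightarrow> real"
  assumes [measurable]: "f \<in> borel_measurable M" "g \<in> borel_measurable M"
    and f: "integrable M (\<lambda>x. (f x)\<^sup>2)" and g: "integrable M (\<lambda>x. (g x)\<^sup>2)"
  shows "integrable M (\<lambda>x. (f x + g x)\<^sup>2)"
    and "(\<integral>x. (f x + g x)\<^sup>2 \<partial>M) \<le> 2 * (\<integral>x. (f x)\<^sup>2 \<partial>M) + 2 * (\<integral>x. (g x)\<^sup>2 \<partial>M)"
proof -
  have fg: "integrable M (\<lambda>x. f x * g x)" using assms by (rule integrable_mult_square)
  then have *: "integrable M (\<lambda>x. 2 * f x * g x)" by (simp add: mult.assoc)
  show 1: "integrable M (\<lambda>x. (f x + g x)\<^sup>2)"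
    unfolding power2_sum using f g * by (intro Bochner_Integration.integrable_add)
  have "(a + b)\<^sup>2 \<le> 2 * a\<^sup>2 + 2 * b\<^sup>2" for a b :: real
    using sum_squares_bound[of a b] by (simp add: power2_sum)
  then have "(\<integral>x. (f x + g x)\<^sup>2 \<partial>M) \<le> (\<integral>x. 2 * (f x)\<^sup>2 + 2 * (g x)\<^sup>2 \<partial>M)"
    using 1 f g by (intro integral_mono) auto
  then show "(\<integral>x. (f x + g x)\<^sup>2 \<partial>M) \<le> 2 * (\<integral>x. (f x)\<^sup>2 \<partial>M) + 2 * (\<integral>x. (g x)\<^sup>2 \<partial>M)"
    using f g by simp
qed

subsection \<open>Translations\<close>

lemma nn_integral_translate:
  fixes f :: "'a::euclidean_space \<Rightarrow> ennreal"
  assumes [measurable]: "f \<in> borel_measurable borel"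
  shows "(\<integral>\<^sup>+x. f (x + h) \<partial>lborel) = (\<integral>\<^sup>+x. f x \<partial>lborel)"
  by (subst lborel_distr_plus[of h, symmetric]) (simp add: nn_integral_distr add.commute)

lemma integrable_translate_iff:
  fixes f :: "'a::euclidean_space \<Rightarrow> real"
  assumes [measurable]: "f \<in> borel_measurable borel"
  shows "integrable lborel (\<lambda>x. f (x + h)) \<longleftrightarrow> integrable lborel f"
proof -
  have "integrable lborel f \<longleftrightarrow> integrable (distr lborel borel ((+) h)) f"
    by (simp add: lborel_distr_plus)
  also have "\<dots> \<longleftrightarrow> integrable lborel (\<lambda>x. f (x + h))"
    by (subst integrable_distr_eq) (simp_all add: add.commute)
  finally show ?thesis by simp
qed

lemma integral_translate:
  fixes f :: "'a::euclidean_space \<Rightarrow> real"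
  assumes [measurable]: "f \<in> borel_measurable borel"
  shows "(\<integral>x. f (x + h) \<partial>lborel) = (\<integral>x. f x \<partial>lborel)"
proof -
  have "(\<integral>x. f x \<partial>lborel) = (\<integral>x. f x \<partial>distr lborel borel ((+) h))"
    by (simp add: lborel_distr_plus)
  also have "\<dots> = (\<integral>x. f (x + h) \<partial>lborel)"
    by (subst integral_distr) (simp_all add: add.commute)
  finally show ?thesis by simp
qed

lemma lborel_distr_reflect:
  fixes a :: "'a::euclidean_space"
  shows "distr lborel borel (\<lambda>x. a - x) = lborel"
  using lborel_affine[of "-1" a] by (simp add: density_1)

lemma integral_reflect:
  fixes f :: "'a::euclidean_space \<Rightarrow> real"
  assumes [measurable]: "f \<in> borel_measurable borel"
  shows "(\<integral>x. f (a - x) \<partial>lborel) = (\<integral>x. f x \<partial>lborel)"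
proof -
  have "(\<integral>x. f x \<partial>lborel) = (\<integral>x. f x \<partial>distr lborel borel (\<lambda>x. a - x))"
    by (simp add: lborel_distr_reflect)
  also have "\<dots> = (\<integral>x. f (a - x) \<partial>lborel)"
    by (subst integral_distr) simp_all
  finally show ?thesis by simp
qed

lemma nn_integral_reflect:
  fixes f :: "'a::euclidean_space \<Rightarrow> ennreal"
  assumes [measurable]: "f \<in> borel_measurable borel"
  shows "(\<integral>\<^sup>+x. f (a - x) \<partial>lborel) = (\<integral>\<^sup>+x. f x \<partial>lborel)"
  by (subst lborel_distr_reflect[of a, symmetric]) (simp add: nn_integral_distr)

text \<open>The whole-plane, Borel counterpart of \<open>L2\<close>: translations, reflections and
  Fubini are applied to such functions, and results are carried back to \<open>lebesgue_on\<close>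
  at the end.\<close>

definition sq_int :: "(plane \<Rightarrow> real) \<Rightarrow> bool" where
  "sq_int v \<longleftrightarrow> v \<in> borel_measurable borel \<and> integrable lborel (\<lambda>x. (v x)\<^sup>2)"

text \<open>The squared modulus of continuity in L2 under translation. Keeping the square avoids
  roots, at the price of the factor 2 in the triangle inequality.\<close>

definition shift_dist :: "(plane \<Rightarrow> real) \<Rightarrow> plane \<Rightarrow> real" where
  "shift_dist v h = (\<integral>y. (v (y + h) - v y)\<^sup>2 \<partial>lborel)"

lemma sq_int_add: "sq_int f \<Longrightarrow> sq_int g \<Longrightarrow> sq_int (\<lambda>x. f x + g x)"
  unfolding sq_int_def using integral_square_add_le(1)[of f lborel g] by auto

lemma sq_int_translate: "sq_int f \<Longrightarrow> sq_int (\<lambda>x. f (x + h))"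
  unfolding sq_int_def using integrable_translate_iff[of "\<lambda>x. (f x)\<^sup>2" h] by auto

lemma sq_int_bound:
  assumes "sq_int g" "f \<in> borel_measurable borel" "\<And>x. \<bar>f x\<bar> \<le> M * \<bar>g x\<bar>"
  shows "sq_int f"
  unfolding sq_int_def
proof
  have [measurable]: "f \<in> borel_measurable borel" by fact
  show "integrable lborel (\<lambda>x. (f x)\<^sup>2)"
  proof (rule Bochner_Integration.integrable_bound)
    show "integrable lborel (\<lambda>x. M\<^sup>2 * (g x)\<^sup>2)" using assms(1) by (simp add: sq_int_def)
    have "(f x)\<^sup>2 \<le> M\<^sup>2 * (g x)\<^sup>2" for x
      using power_mono[OF assms(3)[of x], of 2] by (simp add: power_mult_distrib)
    then show "AE x in lborel. norm ((f x)\<^sup>2) \<le> norm (M\<^sup>2 * (g x)\<^sup>2)" by simp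
  qed measurable
qed fact

lemma sq_int_cmult:
  assumes "sq_int f"
  shows "sq_int (\<lambda>x. c * f x)"
proof (rule sq_int_bound[OF assms])
  show "(\<lambda>x. c * f x) \<in> borel_measurable borel"
    using assms by (intro borel_measurable_times) (auto simp: sq_int_def)
  show "\<bar>c * f x\<bar> \<le> \<bar>c\<bar> * \<bar>f x\<bar>" for x
    by (simp add: abs_mult)
qed

lemma sq_int_diff:
  assumes "sq_int f" "sq_int g"
  shows "sq_int (\<lambda>x. f x - g x)"
proof -
  have "sq_int (\<lambda>x. f x + - 1 * g x)"
    by (intro sq_int_add sq_int_cmult assms)
  moreover have "(\<lambda>x. f x + - 1 * g x) = (\<lambda>x. f x - g x)" by auto
  ultimately show ?thesis by metis
qed

lemma sq_int_integrable:
  assumes "sq_int v" "\<And>x. x \<notin> ball 0 R \<Longrightarrow> v x = 0"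
  shows "integrable lborel v"
proof -
  have "integrable lborel (\<lambda>x. v x * indicator (ball 0 R) x)"
  proof (rule integrable_mult_square)
    have "integrable lborel (indicator (ball 0 R) :: plane \<Rightarrow> real)"
      using emeasure_bounded_finite[OF bounded_ball[of "0 :: plane" R]]
      by (simp add: integrable_indicator_iff)
    moreover have "(\<lambda>x. (indicator (ball 0 R) x)\<^sup>2) = (indicator (ball 0 R) :: plane \<Rightarrow> real)"
      by (auto simp: indicator_def)
    ultimately show "integrable lborel (\<lambda>x::plane. (indicator (ball 0 R) x :: real)\<^sup>2)"
      by simp
    show "(indicator (ball 0 R) :: plane \<Rightarrow> real) \<in> borel_measurable lborel"
      by (intro borel_measurable_indicator) simp
  qed (use assms(1) in \<open>auto simp: sq_int_def\<close>)
  moreover have "v x * indicator (ball 0 R) x = v x" for x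
    using assms(2)[of x] by (auto simp: indicator_def)
  ultimately show ?thesis by simp
qed

lemma shift_dist_add_le:
  assumes "sq_int f" "sq_int g"
  shows "shift_dist (\<lambda>x. f x + g x) h \<le> 2 * shift_dist f h + 2 * shift_dist g h"
proof -
  have "sq_int (\<lambda>y. f (y + h) - f y)" "sq_int (\<lambda>y. g (y + h) - g y)"
    using assms by (auto intro: sq_int_diff sq_int_translate)
  then show ?thesis
    using integral_square_add_le(2)[of "\<lambda>y. f (y + h) - f y" lborel "\<lambda>y. g (y + h) - g y"]
    by (auto simp: shift_dist_def sq_int_def algebra_simps)
qed

lemma shift_dist_nonneg: "shift_dist f h \<ge> 0"
  by (simp add: shift_dist_def)

text \<open>A is squeezed between a compact K and an open U whose difference W is small. If h is
  shorter than the distance from K to the complement of U, then exactly one of y and y + h can lie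
  in A only when y or y + h lies in W.\<close>

lemma shift_dist_indicator_tendsto:
  assumes "A \<in> sets borel" "bounded A"
  shows "(shift_dist (indicator A) \<longlongrightarrow> 0) (at 0)"
proof (rule tendstoI)
  fix e :: real assume "e > 0"
  have lA: "A \<in> sets lebesgue" using assms(1) by simp
  have "e / 4 > 0" using \<open>e > 0\<close> by simp
  obtain U where U: "open U" "A \<subseteq> U" "U - A \<in> lmeasurable" "emeasure lebesgue (U - A) < ennreal (e / 4)"
    using sets_lebesgue_outer_open[OF lA \<open>e / 4 > 0\<close>] by blast
  obtain K where K: "closed K" "K \<subseteq> A" "A - K \<in> lmeasurable" "emeasure lebesgue (A - K) < ennreal (e / 4)"
    using sets_lebesgue_inner_closed[OF lA \<open>e / 4 > 0\<close>] by blast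
  have "compact K" using K(1,2) assms(2) bounded_subset compact_eq_bounded_closed by blast
  have KU: "K \<inter> - U = {}" using K U by blast
  obtain d where d: "d > 0" "\<And>x y. x \<in> K \<Longrightarrow> y \<in> - U \<Longrightarrow> d \<le> dist x y"
    using separate_compact_closed[OF \<open>compact K\<close> closed_Compl[OF U(1)]  KU] by blast
  define W where "W = U - K"
  have [measurable]: "W \<in> sets borel" "A \<in> sets borel"
    using U(1) K(1) assms(1) by (auto simp: W_def)
  have "W = (U - A) \<union> (A - K)" using U(2) K(2) by (auto simp: W_def)
  then have "emeasure lborel W \<le> emeasure lebesgue (U - A) + emeasure lebesgue (A - K)"
    using emeasure_subadditive[of "U - A" lborel "A - K"] U(1) K(1) by simp
  also have "\<dots> < ennreal (e / 4) + ennreal (e / 4)"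
    using U(4) K(4) by (rule add_strict_mono)
  finally have W: "emeasure lborel W < ennreal (e / 2)"
    using \<open>e > 0\<close> by (simp flip: ennreal_plus)
  then have finW: "emeasure lborel W < \<infinity>"
    using ennreal_less_top less_trans by (metis infinity_ennreal_def)
  have mW: "measure lborel W < e / 2"
    using W finW \<open>e > 0\<close> by (simp add: emeasure_eq_ennreal_measure ennreal_less_iff)
  have iW: "integrable lborel (indicator W :: plane \<Rightarrow> real)" using finW by simp
  have iWh: "integrable lborel (\<lambda>y. indicator W (y + h) :: real)" for h :: plane
    using iW by (subst integrable_translate_iff) auto
  have "shift_dist (indicator A) h < e" if h: "norm h < d" for h
  proof -
    have pt: "(indicator A (y + h) - indicator A y)\<^sup>2 \<le> (indicator W y + indicator W (y + h) :: real)" for y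
    proof -
      have "y + h \<in> U" if "y \<in> K"
        using d(2)[OF that, of "y + h"] h by (auto simp: dist_norm)
      moreover have "y \<in> U" if "y + h \<in> K"
        using d(2)[OF that, of y] h by (auto simp: dist_norm)
      ultimately show ?thesis
        using U(2) K(2) by (auto simp: W_def indicator_def)
    qed
    have "shift_dist (indicator A) h \<le> (\<integral>y. indicator W y + indicator W (y + h) \<partial>lborel)"
      unfolding shift_dist_def
    proof (rule integral_mono)
      show "integrable lborel (\<lambda>y. indicator W y + indicator W (y + h) :: real)"
        using iW iWh by simp
      then show "integrable lborel (\<lambda>y. (indicator A (y + h) - indicator A y :: real)\<^sup>2)"
        by (rule Bochner_Integration.integrable_bound) (use pt in auto)
    qed (rule pt)
    also have "\<dots> = 2 * measure lborel W"
      using iW iWh[of h] integral_translate[of "indicator W :: plane \<Rightarrow> real" h] by simp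
    finally show ?thesis using mW by simp
  qed
  then show "\<forall>\<^sub>F h in at 0. dist (shift_dist (indicator A) h) 0 < e"
    using d(1) by (auto simp: eventually_at dist_norm shift_dist_nonneg intro!: exI[of _ d])
qed

text \<open>Continuity of translations in L2: it holds for indicators of bounded sets, hence for
  simple functions, and these approximate v in L2 by dominated convergence.\<close>

lemma shift_dist_tendsto:
  assumes v: "sq_int v" and supp: "\<And>x. x \<notin> ball 0 R \<Longrightarrow> v x = 0"
  shows "(shift_dist v \<longlongrightarrow> 0) (at 0)"
proof -
  have [measurable]: "v \<in> borel_measurable borel" using v by (simp add: sq_int_def)
  have sums: "sq_int (\<lambda>x. \<Sum>a\<in>F. f a x) \<and> (shift_dist (\<lambda>x. \<Sum>a\<in>F. f a x) \<longlongrightarrow> 0) (at 0)"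
    if "finite F" "\<And>a. a \<in> F \<Longrightarrow> sq_int (f a) \<and> (shift_dist (f a) \<longlongrightarrow> 0) (at 0)"
    for F :: "real set" and f
    using that
  proof (induction F rule: finite_induct)
    case empty
    show ?case by (simp add: sq_int_def shift_dist_def[abs_def])
  next
    case (insert a F)
    then have *: "sq_int (f a)" "sq_int (\<lambda>x. \<Sum>a\<in>F. f a x)"
      "(shift_dist (f a) \<longlongrightarrow> 0) (at 0)" "(shift_dist (\<lambda>x. \<Sum>a\<in>F. f a x) \<longlongrightarrow> 0) (at 0)"
      by auto
    have "(shift_dist (\<lambda>x. f a x + (\<Sum>a\<in>F. f a x)) \<longlongrightarrow> 0) (at 0)"
    proof (rule tendsto_sandwich[OF _ _ tendsto_const])
      show "((\<lambda>h. 2 * shift_dist (f a) h + 2 * shift_dist (\<lambda>x. \<Sum>a\<in>F. f a x) h) \<longlongrightarrow> 0) (at 0)"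
        using tendsto_add[OF tendsto_mult_right_zero[OF *(3), of 2] tendsto_mult_right_zero[OF *(4), of 2]]
        by simp
    qed (use shift_dist_add_le[OF *(1,2)] shift_dist_nonneg in auto)
    then show ?case using insert.hyps sq_int_add[OF *(1,2)] by simp
  qed
  obtain F where F: "\<And>i. simple_function lborel (F i)" "\<And>x. (\<lambda>i. F i x) \<longlonglongrightarrow> v x"
     "\<And>i x. \<bar>F i x\<bar> \<le> 2 * \<bar>v x\<bar>"
    using borel_measurable_implies_sequence_metric[of v lborel 0] by auto
  have Fb[measurable]: "F i \<in> borel_measurable borel" for i
    using borel_measurable_simple_function[OF F(1)[of i]] by simp
  have Fsq: "sq_int (F i)" for i
    using sq_int_bound[OF v Fb F(3)] .
  have Fshift: "(shift_dist (F i) \<longlongrightarrow> 0) (at 0)" for i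
  proof -
    define A where "A a = F i -` {a}" for a
    have fin: "finite (range (F i))" using F(1)[of i] by (simp add: simple_function_def)
    \<comment> \<open>Nonzero level sets lie in the ball because F i is dominated by 2 |v|. The
      level set of 0 is unbounded, but its term in the sum vanishes.\<close>
    have A: "A a \<in> sets borel" "bounded (A a)" if "a \<noteq> 0" for a
    proof -
      show "A a \<in> sets borel" unfolding A_def using measurable_sets[OF Fb, of "{a}" i] by simp
      have "A a \<subseteq> ball 0 R"
      proof
        fix x assume "x \<in> A a"
        then have "v x \<noteq> 0" using F(3)[of i x] that by (auto simp: A_def)
        then show "x \<in> ball 0 R" using supp by blast
      qed
      then show "bounded (A a)" using bounded_ball bounded_subset by blast
    qed
    have eq: "F i = (\<lambda>x. \<Sum>a\<in>range (F i). a * indicator (A a) x)"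
    proof
      fix x
      have "(\<Sum>a\<in>range (F i). a * indicator (A a) x) = (\<Sum>a\<in>range (F i). if a = F i x then a else 0)"
        by (intro sum.cong) (auto simp: A_def indicator_def)
      then show "F i x = (\<Sum>a\<in>range (F i). a * indicator (A a) x)"
        using fin by simp
    qed
    have "sq_int (\<lambda>x. a * indicator (A a) x) \<and> (shift_dist (\<lambda>x. a * indicator (A a) x) \<longlongrightarrow> 0) (at 0)" for a
    proof (cases "a = 0")
      case True
      then show ?thesis by (simp add: sq_int_def shift_dist_def[abs_def])
    next
      case False
      have "integrable lborel (indicator (A a) :: plane \<Rightarrow> real)"
        using A[OF False] emeasure_bounded_finite by (auto simp: integrable_indicator_iff)
      then have "sq_int (indicator (A a))"
        using A[OF False] by (auto simp: sq_int_def power2_eq_square indicator_inter_arith[symmetric])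
      moreover have "shift_dist (\<lambda>x. a * indicator (A a) x) = (\<lambda>h. a\<^sup>2 * shift_dist (indicator (A a)) h)"
        by (simp add: shift_dist_def fun_eq_iff power_mult_distrib flip: right_diff_distrib)
      ultimately show ?thesis
        using tendsto_mult_right_zero[OF shift_dist_indicator_tendsto[OF A[OF False]], of "a\<^sup>2"]
        by (auto intro: sq_int_cmult)
    qed
    then have "(shift_dist (\<lambda>x. \<Sum>a\<in>range (F i). a * indicator (A a) x) \<longlongrightarrow> 0) (at 0)"
      using sums[OF fin, of "\<lambda>a x. a * indicator (A a) x"] by blast
    then show ?thesis by (subst eq)
  qed
  have approx: "(\<lambda>i. \<integral>x. (v x - F i x)\<^sup>2 \<partial>lborel) \<longlonglongrightarrow> (\<integral>x. 0 \<partial>(lborel :: plane measure))"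
  proof (rule integral_dominated_convergence)
    show "integrable lborel (\<lambda>x. 9 * (v x)\<^sup>2)" using v by (simp add: sq_int_def)
    show "AE x in lborel. norm ((v x - F i x)\<^sup>2) \<le> 9 * (v x)\<^sup>2" for i
    proof (rule AE_I2)
      fix x
      have "\<bar>v x - F i x\<bar> \<le> 3 * \<bar>v x\<bar>" using F(3)[of i x] by linarith
      from power_mono[OF this, of 2] show "norm ((v x - F i x)\<^sup>2) \<le> 9 * (v x)\<^sup>2"
        by (simp add: power_mult_distrib)
    qed
    have "(\<lambda>i. (v x - F i x)\<^sup>2) \<longlonglongrightarrow> 0" for x
      using tendsto_power[OF tendsto_diff[OF tendsto_const F(2)[of x]], of "v x" 2] by simp
    then show "AE x in lborel. (\<lambda>i. (v x - F i x)\<^sup>2) \<longlonglongrightarrow> 0" by simp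
  qed auto
  show ?thesis
  proof (rule tendstoI)
    fix e :: real assume "e > 0"
    \<comment> \<open>The triangle inequality is applied twice, each time with factor 2: the error e
      / 16 makes the shift distance of v - F i less than e / 4, and two terms below e / 4, doubled,
      stay below e.\<close>
    then have "e / 16 > 0" by simp
    from order_tendstoD(2)[OF approx, of "e / 16"] this
    obtain i where i: "(\<integral>x. (v x - F i x)\<^sup>2 \<partial>lborel) < e / 16"
      by (auto simp: eventually_sequentially)
    have sq: "sq_int (\<lambda>x. v x - F i x)" using v Fsq by (rule sq_int_diff)
    have D: "shift_dist (\<lambda>x. v x - F i x) h < e / 4" for h
    proof -
      have "shift_dist (\<lambda>x. v x - F i x) h \<le> 2 * (\<integral>y. (v (y + h) - F i (y + h))\<^sup>2 \<partial>lborel)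
        + 2 * (\<integral>y. (- (v y - F i y))\<^sup>2 \<partial>lborel)"
        using integral_square_add_le(2)[of "\<lambda>y. v (y + h) - F i (y + h)" lborel "\<lambda>y. - (v y - F i y)"]
          sq sq_int_translate[OF sq, of h]
        unfolding shift_dist_def sq_int_def power2_minus diff_conv_add_uminus[symmetric] by simp
      also have "(\<integral>y. (v (y + h) - F i (y + h))\<^sup>2 \<partial>lborel) = (\<integral>y. (v y - F i y)\<^sup>2 \<partial>lborel)"
        by (rule integral_translate[of "\<lambda>y. (v y - F i y)\<^sup>2"]) measurable
      finally show ?thesis using i by (simp add: power2_commute)
    qed
    have "\<forall>\<^sub>F h in at 0. shift_dist (F i) h < e / 4"
      using order_tendstoD(2)[OF Fshift, of "e / 4"] \<open>e > 0\<close> by simp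
    then show "\<forall>\<^sub>F h in at 0. dist (shift_dist v h) 0 < e"
    proof eventually_elim
      case (elim h)
      have "shift_dist v h \<le> 2 * shift_dist (F i) h + 2 * shift_dist (\<lambda>x. v x - F i x) h"
        using shift_dist_add_le[OF Fsq[of i] sq, of h] by simp
      with elim D[of h] shift_dist_nonneg[of v h] show ?case by simp
    qed
  qed
qed

section \<open>Convolution with test functions\<close>

lemma test_fun_lipschitz:
  assumes "f \<in> test_fun \<Omega>"
  obtains B where "B > 0" "\<And>x y. \<bar>f y - f x\<bar> \<le> B * norm (y - x)"
proof -
  have "\<forall>i. \<exists>M. M > 0 \<and> (\<forall>x. \<bar>partial_deriv i f x\<bar> \<le> M)"
    using test_fun_bounded[OF test_fun_partial_deriv[OF assms]] by metis
  then obtain M where M: "\<And>i. M i > 0" "\<And>i x. \<bar>partial_deriv i f x\<bar> \<le> M i"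
    by metis
  define B where "B = (\<Sum>i\<in>UNIV. M i)"
  have "norm (f y - f x) \<le> B * norm (y - x)" for x y
  proof (rule differentiable_bound[OF convex_UNIV])
    show "(f has_derivative (\<lambda>h. \<Sum>i\<in>UNIV. h $ i * partial_deriv i f x)) (at x within UNIV)" for x
      using smooth_has_derivative[OF test_fun_smooth[OF assms]] by simp
    show "onorm (\<lambda>h. \<Sum>i\<in>UNIV. h $ i * partial_deriv i f x) \<le> B" for x
    proof (rule onorm_bound)
      show "0 \<le> B" unfolding B_def using M(1) less_imp_le by (intro sum_nonneg) blast
      fix h :: plane
      have "norm (\<Sum>i\<in>UNIV. h $ i * partial_deriv i f x) \<le> (\<Sum>i\<in>UNIV. norm h * M i)"
        by (rule sum_norm_le) (auto simp: abs_mult component_le_norm_cart M(2) intro!: mult_mono)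
      then show "norm (\<Sum>i\<in>UNIV. h $ i * partial_deriv i f x) \<le> B * norm h"
        by (simp add: B_def sum_distrib_left mult.commute)
    qed
  qed auto
  moreover have "B > 0" unfolding B_def using M(1) by (intro sum_pos) auto
  ultimately show ?thesis using that by auto
qed

text \<open>The quadratic remainder is uniform in the base point z. Integrated against v it yields
  the derivative of a convolution directly, without a limit under the integral sign.\<close>

lemma test_fun_linearization:
  assumes "f \<in> test_fun \<Omega>"
  obtains C where "\<And>z h. \<bar>f (z + h) - f z - (\<Sum>i\<in>UNIV. h $ i * partial_deriv i f z)\<bar> \<le> C * (norm h)\<^sup>2"
proof -
  have "\<forall>i. \<exists>B. B > 0 \<and> (\<forall>x y. \<bar>partial_deriv i f y - partial_deriv i f x\<bar> \<le> B * norm (y - x))"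
    using test_fun_lipschitz[OF test_fun_partial_deriv[OF assms]] by metis
  then obtain B where B: "\<And>i. B i > 0" "\<And>i x y. \<bar>partial_deriv i f y - partial_deriv i f x\<bar> \<le> B i * norm (y - x)"
    by metis
  define C where "C = (\<Sum>i\<in>UNIV. B i)"
  have "C \<ge> 0" unfolding C_def using B(1) less_imp_le by (intro sum_nonneg) blast
  have "norm (f (z + h) - f z - (\<Sum>i\<in>UNIV. ((z + h) - z) $ i * partial_deriv i f z))
      \<le> norm ((z + h) - z) * (C * norm h)" for z h
  proof (rule differentiable_bound_linearization[where S = "cball z (norm h)"
        and f' = "\<lambda>x h. \<Sum>i\<in>UNIV. h $ i * partial_deriv i f x"])
    show "z + t *\<^sub>R (z + h - z) \<in> cball z (norm h)" if "t \<in> {0..1}" for t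
      using that by (auto simp: dist_norm mult_left_le_one_le)
    show "(f has_derivative (\<lambda>h. \<Sum>i\<in>UNIV. h $ i * partial_deriv i f x)) (at x within cball z (norm h))" for x
      using smooth_has_derivative[OF test_fun_smooth[OF assms]] has_derivative_at_withinI by blast
    show "onorm ((\<lambda>h. \<Sum>i\<in>UNIV. h $ i * partial_deriv i f x) - (\<lambda>h. \<Sum>i\<in>UNIV. h $ i * partial_deriv i f z))
        \<le> C * norm h" if "x \<in> cball z (norm h)" for x
    proof (rule onorm_bound)
      show "0 \<le> C * norm h" using \<open>C \<ge> 0\<close> by simp
      fix k :: plane
      have xz: "norm (x - z) \<le> norm h" using that by (simp add: dist_norm norm_minus_commute)
      have "((\<lambda>h. \<Sum>i\<in>UNIV. h $ i * partial_deriv i f x) - (\<lambda>h. \<Sum>i\<in>UNIV. h $ i * partial_deriv i f z)) k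
        = (\<Sum>i\<in>UNIV. k $ i * (partial_deriv i f x - partial_deriv i f z))"
        by (simp add: sum_subtractf right_diff_distrib)
      moreover have "norm (\<Sum>i\<in>UNIV. k $ i * (partial_deriv i f x - partial_deriv i f z))
          \<le> (\<Sum>i\<in>UNIV. norm k * (B i * norm h))"
      proof (rule sum_norm_le)
        fix i
        have "\<bar>partial_deriv i f x - partial_deriv i f z\<bar> \<le> B i * norm h"
          using B(2)[of i x z] mult_left_mono[OF xz, of "B i"] B(1)[of i] by linarith
        then show "norm (k $ i * (partial_deriv i f x - partial_deriv i f z)) \<le> norm k * (B i * norm h)"
          by (auto simp: abs_mult component_le_norm_cart intro!: mult_mono)
      qed
      ultimately show "norm (((\<lambda>h. \<Sum>i\<in>UNIV. h $ i * partial_deriv i f x)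
          - (\<lambda>h. \<Sum>i\<in>UNIV. h $ i * partial_deriv i f z)) k) \<le> C * norm h * norm k"
        by (simp add: C_def sum_distrib_left sum_distrib_right mult_ac)
    qed
  qed auto
  then show ?thesis
    by (intro that[of C]) (simp add: power2_eq_square mult_ac)
qed

lemma test_fun_borel: "f \<in> test_fun \<Omega> \<Longrightarrow> f \<in> borel_measurable borel"
  by (simp add: smooth_borel test_fun_smooth)

lemma integrable_test_fun_mult:
  assumes "\<rho> \<in> test_fun UNIV" "integrable lborel v"
  shows "integrable lborel (\<lambda>y. \<rho> (x - y) * v y)"
proof -
  have [measurable]: "\<rho> \<in> borel_measurable borel" "v \<in> borel_measurable borel"
    using test_fun_borel[OF assms(1)] assms(2) by auto
  obtain M where M: "M > 0" "\<And>x. \<bar>\<rho> x\<bar> \<le> M" using test_fun_bounded[OF assms(1)] by metis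
  show ?thesis
  proof (rule Bochner_Integration.integrable_bound)
    show "integrable lborel (\<lambda>y. M * v y)" using assms(2) by simp
    show "AE y in lborel. norm (\<rho> (x - y) * v y) \<le> norm (M * v y)"
      using M by (auto simp: abs_mult intro!: mult_right_mono)
  qed measurable
qed

definition conv :: "(plane \<Rightarrow> real) \<Rightarrow> (plane \<Rightarrow> real) \<Rightarrow> plane \<Rightarrow> real" where
  "conv \<rho> v x = (\<integral>y. \<rho> (x - y) * v y \<partial>lborel)"

lemma conv_has_derivative:
  assumes \<rho>: "\<rho> \<in> test_fun UNIV" and v: "integrable lborel v"
  shows "(conv \<rho> v has_derivative (\<lambda>h. \<Sum>i\<in>UNIV. h $ i * conv (partial_deriv i \<rho>) v x)) (at x)"
  unfolding has_derivative_at_alt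
proof (intro conjI allI impI)
  show "bounded_linear (\<lambda>h. \<Sum>i\<in>UNIV. h $ i * conv (partial_deriv i \<rho>) v x)"
    by (intro bounded_linear_sum bounded_linear_mult_const bounded_linear_vec_nth)
  fix e :: real assume "e > 0"
  obtain C where C: "\<And>z h. \<bar>\<rho> (z + h) - \<rho> z - (\<Sum>i\<in>UNIV. h $ i * partial_deriv i \<rho> z)\<bar> \<le> C * (norm h)\<^sup>2"
    using test_fun_linearization[OF \<rho>] by metis
  define N where "N = C * (\<integral>y. \<bar>v y\<bar> \<partial>lborel)"
  have bound: "norm (conv \<rho> v y - conv \<rho> v x - (\<Sum>i\<in>UNIV. (y - x) $ i * conv (partial_deriv i \<rho>) v x))
      \<le> N * (norm (y - x))\<^sup>2" for y
  proof -
    define h where "h = y - x"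
    have int: "integrable lborel (\<lambda>z. \<rho> (y - z) * v z)" "integrable lborel (\<lambda>z. \<rho> (x - z) * v z)"
      "\<And>i. integrable lborel (\<lambda>z. partial_deriv i \<rho> (x - z) * v z)"
      using \<rho> v test_fun_partial_deriv integrable_test_fun_mult by blast+
    define E where "E z = \<rho> (y - z) * v z - \<rho> (x - z) * v z
      - (\<Sum>i\<in>UNIV. h $ i * (partial_deriv i \<rho> (x - z) * v z))" for z
    have intE: "integrable lborel E" unfolding E_def using int by simp
    have "conv \<rho> v y - conv \<rho> v x - (\<Sum>i\<in>UNIV. h $ i * conv (partial_deriv i \<rho>) v x) = (\<integral>z. E z \<partial>lborel)"
      unfolding E_def conv_def using int by simp
    also have "norm \<dots> \<le> (\<integral>z. norm (E z) \<partial>lborel)"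
      by (rule integral_norm_bound)
    also have "\<dots> \<le> (\<integral>z. C * (norm h)\<^sup>2 * \<bar>v z\<bar> \<partial>lborel)"
    proof (rule integral_mono)
      fix z
      have "E z = (\<rho> ((x - z) + h) - \<rho> (x - z) - (\<Sum>i\<in>UNIV. h $ i * partial_deriv i \<rho> (x - z))) * v z"
        by (simp add: E_def h_def sum_distrib_right left_diff_distrib mult.assoc)
      then show "norm (E z) \<le> C * (norm h)\<^sup>2 * \<bar>v z\<bar>"
        using C[of "x - z" h] by (simp add: abs_mult mult_right_mono)
    qed (use intE v in auto)
    finally show ?thesis by (simp add: h_def N_def mult_ac)
  qed
  show "\<exists>d>0. \<forall>y. norm (y - x) < d \<longrightarrow>
      norm (conv \<rho> v y - conv \<rho> v x - (\<Sum>i\<in>UNIV. (y - x) $ i * conv (partial_deriv i \<rho>) v x))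
      \<le> e * norm (y - x)"
  proof (intro exI conjI allI impI)
    show "e / (\<bar>N\<bar> + 1) > 0" using \<open>e > 0\<close> by simp
    fix y assume "norm (y - x) < e / (\<bar>N\<bar> + 1)"
    then have "(\<bar>N\<bar> + 1) * norm (y - x) < e" by (simp add: field_simps)
    moreover have "N * norm (y - x) \<le> (\<bar>N\<bar> + 1) * norm (y - x)" by (intro mult_right_mono) auto
    ultimately have "N * norm (y - x) \<le> e" by linarith
    then have "N * norm (y - x) * norm (y - x) \<le> e * norm (y - x)" by (rule mult_right_mono) simp
    with bound[of y] show "norm (conv \<rho> v y - conv \<rho> v x
        - (\<Sum>i\<in>UNIV. (y - x) $ i * conv (partial_deriv i \<rho>) v x)) \<le> e * norm (y - x)"
      by (simp add: power2_eq_square mult.assoc)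
  qed
qed

lemma partial_deriv_conv:
  assumes "\<rho> \<in> test_fun UNIV" "integrable lborel v"
  shows "partial_deriv i (conv \<rho> v) = conv (partial_deriv i \<rho>) v"
proof
  fix x
  show "partial_deriv i (conv \<rho> v) x = conv (partial_deriv i \<rho>) v x"
    using partial_deriv_eq[OF conv_has_derivative[OF assms, of x], of i]
    by (simp add: axis_def if_distrib[of "\<lambda>a. a * _"] cong: if_cong)
qed

lemma smooth_conv:
  assumes "\<rho> \<in> test_fun UNIV" and v: "integrable lborel v"
  shows "smooth (conv \<rho> v)"
proof -
  have "Ck k (conv \<rho> v)" if "\<rho> \<in> test_fun UNIV" for k
    using that
  proof (induction k arbitrary: \<rho>)
    case 0
    show ?case
      using has_derivative_continuous[OF conv_has_derivative[OF 0 v]]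
      by (simp add: continuous_on_eq_continuous_at)
  next
    case (Suc k)
    have "conv \<rho> v differentiable_on UNIV"
      using conv_has_derivative[OF Suc.prems v] by (auto simp: differentiable_on_UNIV_iff differentiable_def)
    then show ?case
      using Suc by (simp add: partial_deriv_conv[OF _ v] test_fun_partial_deriv)
  qed
  then show ?thesis using assms(1) by (simp add: smooth_def)
qed

text \<open>The nonzero set of a convolution lies in K + S. The condition on v is only almost
  everywhere because the stream function is known outside the domain only up to null sets.\<close>

lemma conv_eq_0:
  assumes "\<And>x. \<rho> x \<noteq> 0 \<Longrightarrow> x \<in> S" "AE y in lborel. y \<notin> K \<longrightarrow> v y = 0"
    and "\<And>y. y \<in> K \<Longrightarrow> x - y \<notin> S"
  shows "conv \<rho> v x = 0"
  unfolding conv_def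
proof (rule integral_eq_zero_AE)
  show "AE y in lborel. \<rho> (x - y) * v y = 0"
    using assms(2) by eventually_elim (use assms(1,3) in auto)
qed

subsection \<open>Mollification\<close>

text \<open>The centre a need not be 0: an off-centre kernel smooths and translates by about a at
  once, which is how supports get moved into \<Omega>.\<close>

definition mollifier :: "plane \<Rightarrow> real \<Rightarrow> (plane \<Rightarrow> real) \<Rightarrow> bool" where
  "mollifier a \<delta> \<rho> \<longleftrightarrow> \<rho> \<in> test_fun UNIV \<and> (\<forall>x. \<rho> x \<ge> 0) \<and> (\<integral>x. \<rho> x \<partial>lborel) = 1 \<and>
     (\<forall>x. \<rho> x \<noteq> 0 \<longrightarrow> x \<in> ball a \<delta>)"

lemma integrable_test_fun:
  assumes "f \<in> test_fun \<Omega>"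
  shows "integrable lborel f"
  using assms
proof (rule test_funE)
  fix K assume K: "smooth f" "compact K" "\<And>x. f x \<noteq> 0 \<Longrightarrow> x \<in> K"
  have "integrable lborel (\<lambda>x. indicator K x *\<^sub>R f x)"
    using borel_integrable_compact[OF K(2) smooth_continuous[OF K(1)]] by (simp add: set_integrable_def)
  moreover have "(\<lambda>x. indicator K x *\<^sub>R f x) = f"
    using K(3) by (auto simp: indicator_def fun_eq_iff)
  ultimately show ?thesis by simp
qed

lemma mollifier_exists:
  assumes "\<delta> > 0"
  obtains \<rho> where "mollifier a \<delta> \<rho>"
proof -
  obtain \<rho> where \<rho>: "\<rho> \<in> test_fun UNIV" "\<And>x. \<rho> x \<ge> 0" "\<rho> a > 0" "\<And>x. \<rho> x \<noteq> 0 \<Longrightarrow> x \<in> ball a \<delta>"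
    using bump_exists[OF assms] by metis
  define I where "I = (\<integral>x. \<rho> x \<partial>lborel)"
  have "I \<noteq> 0"
  proof
    assume "I = 0"
    then have "AE x in lborel. \<rho> x = 0"
      using integral_nonneg_eq_0_iff_AE[OF integrable_test_fun[OF \<rho>(1)]] \<rho>(2) by (simp add: I_def)
    \<comment> \<open>The set where the bump is nonzero is open and contains a, so it cannot be
      null.\<close>
    have op: "open {x. \<rho> x \<noteq> 0}"
      using smooth_continuous[OF test_fun_smooth[OF \<rho>(1)]] by (intro open_Collect_neq) auto
    have "{x. \<rho> x \<noteq> 0} \<in> null_sets lborel"
    proof (rule iffD2[OF AE_iff_null_sets])
      show "AE x in lborel. x \<notin> {x. \<rho> x \<noteq> 0}"
        using \<open>AE x in lborel. \<rho> x = 0\<close> by eventually_elim simp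
    qed (use borel_open[OF op] in \<open>metis sets_lborel\<close>)
    then have "negligible {x. \<rho> x \<noteq> 0}"
      by (simp add: negligible_iff_null_sets null_sets_completionI)
    with op show False using open_not_negligible[of "{x. \<rho> x \<noteq> 0}"] \<rho>(3) by force
  qed
  moreover have "I \<ge> 0" using \<rho>(2) by (simp add: I_def)
  ultimately have "mollifier a \<delta> (\<lambda>x. (1 / I) * \<rho> x)"
    using \<rho> test_fun_cmult[OF \<rho>(1), of "1 / I"] by (auto simp: mollifier_def I_def)
  then show ?thesis by (rule that)
qed

lemma conv_const:
  assumes "mollifier a \<delta> \<rho>"
  shows "conv \<rho> (\<lambda>y. c) x = c"
proof -
  have "\<rho> \<in> test_fun UNIV" "(\<integral>x. \<rho> x \<partial>lborel) = 1" using assms by (auto simp: mollifier_def)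
  then show ?thesis by (simp add: conv_def integral_reflect test_fun_borel)
qed

text \<open>Since \<rho> is a probability density, Cauchy-Schwarz with the splitting of \<rho> into
  two square roots bounds (\<rho> * v - v)^2 at x by the average of (v y - v x)^2. Fubini then turns
  the integral over x into the average of \<open>shift_dist\<close> v h against \<rho> h.\<close>

lemma conv_dist_le:
  assumes \<rho>: "mollifier a \<delta> \<rho>" and v: "sq_int v" "integrable lborel v"
    and N: "\<And>h. norm (h - a) < \<delta> \<Longrightarrow> shift_dist v h \<le> e"
  shows "integrable lborel (\<lambda>x. (conv \<rho> v x - v x)\<^sup>2)"
    and "(\<integral>x. (conv \<rho> v x - v x)\<^sup>2 \<partial>lborel) \<le> e"
proof -
  have test: "\<rho> \<in> test_fun UNIV" and pos: "\<rho> x \<ge> 0" and int1: "(\<integral>x. \<rho> x \<partial>lborel) = 1"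
    and supp: "\<rho> x \<noteq> 0 \<Longrightarrow> norm (x - a) < \<delta>" for x
    using \<rho> by (auto simp: mollifier_def dist_norm norm_minus_commute)
  have [measurable]: "\<rho> \<in> borel_measurable borel" "v \<in> borel_measurable borel"
    "conv \<rho> v \<in> borel_measurable borel"
    using test_fun_borel[OF test] v(1) smooth_borel[OF smooth_conv[OF test v(2)]] by (auto simp: sq_int_def)
  have "(\<integral>\<^sup>+x. ennreal (\<rho> x) \<partial>lborel) = 1"
    using nn_integral_eq_integral[OF integrable_test_fun[OF test]] pos int1 by simp
  then have nn1: "(\<integral>\<^sup>+y. ennreal (\<rho> (x - y)) \<partial>lborel) = 1" for x
    by (subst nn_integral_reflect[of "\<lambda>y. ennreal (\<rho> y)"]) auto
  have pt: "ennreal ((conv \<rho> v x - v x)\<^sup>2) \<le> (\<integral>\<^sup>+y. ennreal (\<rho> (x - y) * (v y - v x)\<^sup>2) \<partial>lborel)" for x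
  proof -
    have "integrable lborel (\<lambda>y. \<rho> (x - y))"
    proof (rule integrableI_bounded)
      show "(\<integral>\<^sup>+y. ennreal (norm (\<rho> (x - y))) \<partial>lborel) < \<infinity>" using nn1[of x] pos by simp
    qed measurable
    then have i: "integrable lborel (\<lambda>y. \<rho> (x - y) * v y)" "integrable lborel (\<lambda>y. \<rho> (x - y) * v x)"
      using integrable_test_fun_mult[OF test v(2)] by auto
    have "conv \<rho> v x - v x = conv \<rho> v x - conv \<rho> (\<lambda>y. v x) x"
      using conv_const[OF \<rho>] by simp
    also have "\<dots> = (\<integral>y. \<rho> (x - y) * (v y - v x) \<partial>lborel)"
      using i by (simp add: conv_def right_diff_distrib)
    finally have eq: "conv \<rho> v x - v x = (\<integral>y. \<rho> (x - y) * (v y - v x) \<partial>lborel)" .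
    have "ennreal \<bar>conv \<rho> v x - v x\<bar> \<le> (\<integral>\<^sup>+y. ennreal (norm (\<rho> (x - y) * (v y - v x))) \<partial>lborel)"
      using integral_norm_bound_ennreal[of lborel "\<lambda>y. \<rho> (x - y) * (v y - v x)"] i
      by (simp add: eq right_diff_distrib)
    also have "\<dots> = (\<integral>\<^sup>+y. ennreal (sqrt (\<rho> (x - y))) * ennreal (sqrt (\<rho> (x - y)) * \<bar>v y - v x\<bar>) \<partial>lborel)"
      using pos by (intro nn_integral_cong) (simp add: abs_mult mult.assoc[symmetric] flip: ennreal_mult)
    finally have "(ennreal \<bar>conv \<rho> v x - v x\<bar>)\<^sup>2 \<le>
      (\<integral>\<^sup>+y. ennreal (sqrt (\<rho> (x - y))) * ennreal (sqrt (\<rho> (x - y)) * \<bar>v y - v x\<bar>) \<partial>lborel)\<^sup>2"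
      by (intro power_mono) auto
    also have "\<dots> \<le> (\<integral>\<^sup>+y. (ennreal (sqrt (\<rho> (x - y))))\<^sup>2 \<partial>lborel)
        * (\<integral>\<^sup>+y. (ennreal (sqrt (\<rho> (x - y)) * \<bar>v y - v x\<bar>))\<^sup>2 \<partial>lborel)"
      by (rule Cauchy_Schwarz_nn_integral) measurable
    also have "\<dots> = (\<integral>\<^sup>+y. ennreal (\<rho> (x - y) * (v y - v x)\<^sup>2) \<partial>lborel)"
      using nn1 pos by (simp add: ennreal_power power_mult_distrib)
    finally show ?thesis by (simp add: ennreal_power)
  qed
  have "(\<integral>\<^sup>+x. ennreal ((conv \<rho> v x - v x)\<^sup>2) \<partial>lborel)
      \<le> (\<integral>\<^sup>+x. \<integral>\<^sup>+y. ennreal (\<rho> (x - y) * (v y - v x)\<^sup>2) \<partial>lborel \<partial>lborel)"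
    by (rule nn_integral_mono) (rule pt)
  also have "\<dots> = (\<integral>\<^sup>+y. \<integral>\<^sup>+x. ennreal (\<rho> (x - y) * (v y - v x)\<^sup>2) \<partial>lborel \<partial>lborel)"
    by (rule lborel_pair.Fubini') measurable
  also have "\<dots> = (\<integral>\<^sup>+y. \<integral>\<^sup>+h. ennreal (\<rho> h * (v (y + h) - v y)\<^sup>2) \<partial>lborel \<partial>lborel)"
  proof (rule nn_integral_cong)
    fix y
    have "(\<integral>\<^sup>+x. ennreal (\<rho> (x - y) * (v y - v x)\<^sup>2) \<partial>lborel)
        = (\<integral>\<^sup>+h. ennreal (\<rho> ((h + y) - y) * (v y - v (h + y))\<^sup>2) \<partial>lborel)"
      by (rule nn_integral_translate[symmetric]) measurable
    then show "(\<integral>\<^sup>+x. ennreal (\<rho> (x - y) * (v y - v x)\<^sup>2) \<partial>lborel)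
        = (\<integral>\<^sup>+h. ennreal (\<rho> h * (v (y + h) - v y)\<^sup>2) \<partial>lborel)"
      by (simp add: add.commute power2_commute)
  qed
  also have "\<dots> = (\<integral>\<^sup>+h. \<integral>\<^sup>+y. ennreal (\<rho> h * (v (y + h) - v y)\<^sup>2) \<partial>lborel \<partial>lborel)"
    by (rule lborel_pair.Fubini'[symmetric]) measurable
  also have "\<dots> \<le> (\<integral>\<^sup>+h. ennreal (\<rho> h) * ennreal e \<partial>lborel)"
  proof (rule nn_integral_mono)
    fix h
    have "(\<integral>\<^sup>+y. ennreal (\<rho> h * (v (y + h) - v y)\<^sup>2) \<partial>lborel)
        = ennreal (\<rho> h) * (\<integral>\<^sup>+y. ennreal ((v (y + h) - v y)\<^sup>2) \<partial>lborel)"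
      using pos by (subst nn_integral_cmult[symmetric]) (auto simp: ennreal_mult)
    also have "(\<integral>\<^sup>+y. ennreal ((v (y + h) - v y)\<^sup>2) \<partial>lborel) = ennreal (shift_dist v h)"
      unfolding shift_dist_def
      using sq_int_diff[OF sq_int_translate[OF v(1)] v(1)] by (intro nn_integral_eq_integral) (auto simp: sq_int_def)
    also have "ennreal (\<rho> h) * ennreal (shift_dist v h) \<le> ennreal (\<rho> h) * ennreal e"
      using N[of h] supp[of h] by (cases "\<rho> h = 0") (auto intro!: mult_left_mono ennreal_leI)
    finally show "(\<integral>\<^sup>+y. ennreal (\<rho> h * (v (y + h) - v y)\<^sup>2) \<partial>lborel) \<le> ennreal (\<rho> h) * ennreal e" .
  qed
  also have "\<dots> = ennreal e"
    using nn1[of 0] \<open>(\<integral>\<^sup>+x. ennreal (\<rho> x) \<partial>lborel) = 1\<close> by (simp add: nn_integral_multc)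
  finally have le: "(\<integral>\<^sup>+x. ennreal ((conv \<rho> v x - v x)\<^sup>2) \<partial>lborel) \<le> ennreal e" .
  show 1: "integrable lborel (\<lambda>x. (conv \<rho> v x - v x)\<^sup>2)"
  proof (rule integrableI_bounded)
    show "(\<integral>\<^sup>+x. ennreal (norm ((conv \<rho> v x - v x)\<^sup>2)) \<partial>lborel) < \<infinity>"
      using le by (simp add: le_less_trans[OF _ ennreal_less_top])
  qed measurable
  \<comment> \<open>\<open>ennreal e\<close> hides the sign of e; that e is nonnegative follows from
    the hypothesis at one point where \<rho> does not vanish.\<close>
  have "\<exists>x. \<rho> x \<noteq> 0"
  proof (rule ccontr)
    assume "\<nexists>x. \<rho> x \<noteq> 0"
    then have "\<rho> = (\<lambda>x. 0)" by auto
    then show False using int1 by simp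
  qed
  then obtain h where "\<rho> h \<noteq> 0" by blast
  then have "e \<ge> 0" using N[OF supp, of h] shift_dist_nonneg[of v h] by linarith
  then show "(\<integral>x. (conv \<rho> v x - v x)\<^sup>2 \<partial>lborel) \<le> e"
    using le nn_integral_eq_integral[OF 1] by simp
qed

lemma sq_int_conv_diff:
  assumes \<rho>: "mollifier a \<delta> \<rho>" and v: "sq_int v" "integrable lborel v"
  shows "sq_int (\<lambda>x. conv \<rho> v x - v x)"
  unfolding sq_int_def
proof
  have "\<rho> \<in> test_fun UNIV" using \<rho> by (simp add: mollifier_def)
  then show "(\<lambda>x. conv \<rho> v x - v x) \<in> borel_measurable borel"
    using v smooth_borel[OF smooth_conv[OF _ v(2)]] by (auto simp: sq_int_def)
  show "integrable lborel (\<lambda>x. (conv \<rho> v x - v x)\<^sup>2)"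
    \<comment> \<open>Any uniform bound on \<open>shift_dist\<close> gives integrability; four times
      the squared norm of v is valid for every h.\<close>
    by (rule conv_dist_le(1)[OF \<rho> v, where e = "4 * (\<integral>y. (v y)\<^sup>2 \<partial>lborel)"])
      (use v integral_square_add_le(2)[of "\<lambda>y. v (y + h)" lborel "\<lambda>y. - v y" for h]
         sq_int_translate[OF v(1)] integral_translate[of "\<lambda>y. (v y)\<^sup>2"]
       in \<open>auto simp: shift_dist_def sq_int_def\<close>)
qed

lemma mollify_tendsto:
  assumes v: "sq_int v" "\<And>x. x \<notin> ball 0 R \<Longrightarrow> v x = 0"
    and \<rho>: "\<And>n. mollifier (a n) (\<delta> n) (\<rho> n)" "\<And>n. \<delta> n > 0" "(\<lambda>n. norm (a n) + \<delta> n) \<longlonglongrightarrow> 0"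
  shows "(\<lambda>n. \<integral>x. (conv (\<rho> n) v x - v x)\<^sup>2 \<partial>lborel) \<longlonglongrightarrow> 0"
proof (rule tendstoI)
  fix e :: real assume "e > 0"
  have int: "integrable lborel v" using v by (rule sq_int_integrable)
  have "(shift_dist v \<longlongrightarrow> 0) (at 0)" using v by (rule shift_dist_tendsto)
  then have "\<forall>\<^sub>F h in at 0. shift_dist v h < e / 2"
    using \<open>e > 0\<close> by (auto dest: order_tendstoD(2)[of _ _ _ "e / 2"])
  then obtain d where d: "d > 0" "\<And>h. h \<noteq> 0 \<Longrightarrow> norm h < d \<Longrightarrow> shift_dist v h < e / 2"
    by (auto simp: eventually_at dist_norm)
  \<comment> \<open>The filter \<open>at 0\<close> leaves out h = 0, where the shift distance is
    0.\<close>
  have d': "shift_dist v h \<le> e / 2" if "norm h < d" for h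
    using d(2)[of h] that \<open>e > 0\<close> by (cases "h = 0") (auto simp: shift_dist_def)
  have "\<forall>\<^sub>F n in sequentially. norm (a n) + \<delta> n < d"
    using order_tendstoD(2)[OF \<rho>(3) d(1)] .
  then show "\<forall>\<^sub>F n in sequentially. dist (\<integral>x. (conv (\<rho> n) v x - v x)\<^sup>2 \<partial>lborel) 0 < e"
  proof eventually_elim
    case (elim n)
    have "(\<integral>x. (conv (\<rho> n) v x - v x)\<^sup>2 \<partial>lborel) \<le> e / 2"
    proof (rule conv_dist_le(2)[OF \<rho>(1) v(1) int])
      fix h assume "norm (h - a n) < \<delta> n"
      then show "shift_dist v h \<le> e / 2"
        using norm_triangle_sub[of h "a n"] elim by (intro d') linarith
    qed
    then show ?case using \<open>e > 0\<close> by simp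
  qed
qed

lemma mollifier_sequence:
  obtains \<rho> where "\<And>n. mollifier 0 (1 / real (Suc n)) (\<rho> n)"
proof -
  have "\<exists>\<rho>. mollifier 0 (1 / real (Suc n)) \<rho>" for n
    using mollifier_exists[of "1 / real (Suc n)" 0] by (metis of_nat_0_less_iff zero_less_Suc zero_less_divide_1_iff)
  then show ?thesis using that by metis
qed

section \<open>Integration on a Borel subset of the plane\<close>

lemma integrable_lebesgue_on_iff:
  fixes f :: "plane \<Rightarrow> real"
  assumes "\<Omega> \<in> sets borel" "f \<in> borel_measurable borel"
  shows "integrable (lebesgue_on \<Omega>) f \<longleftrightarrow> integrable lborel (\<lambda>x. indicator \<Omega> x * f x)"
proof -
  have [measurable]: "f \<in> borel_measurable borel" "\<Omega> \<in> sets borel" using assms by auto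
  have "integrable (lebesgue_on \<Omega>) f \<longleftrightarrow> integrable lebesgue (\<lambda>x. indicator \<Omega> x *\<^sub>R f x)"
    using assms(1) by (intro integrable_restrict_space) simp
  also have "\<dots> \<longleftrightarrow> integrable lborel (\<lambda>x. indicator \<Omega> x *\<^sub>R f x)"
    by (rule integrable_completion) measurable
  finally show ?thesis by simp
qed

lemma integral_lebesgue_on:
  fixes f :: "plane \<Rightarrow> real"
  assumes "\<Omega> \<in> sets borel" "f \<in> borel_measurable borel"
  shows "(\<integral>x. f x \<partial>lebesgue_on \<Omega>) = (\<integral>x. indicator \<Omega> x * f x \<partial>lborel)"
proof -
  have [measurable]: "f \<in> borel_measurable borel" "\<Omega> \<in> sets borel" using assms by auto
  have "(\<integral>x. f x \<partial>lebesgue_on \<Omega>) = (\<integral>x. indicator \<Omega> x *\<^sub>R f x \<partial>lebesgue)"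
    using assms(1) by (intro integral_restrict_space) simp
  also have "\<dots> = (\<integral>x. indicator \<Omega> x *\<^sub>R f x \<partial>lborel)"
    by (rule integral_completion) measurable
  finally show ?thesis by simp
qed

lemma AE_lebesgue_on_iff:
  assumes "\<Omega> \<in> sets borel"
  shows "(AE x in lebesgue_on \<Omega>. P x) \<longleftrightarrow> (AE x in lborel. x \<in> \<Omega> \<longrightarrow> P x)"
proof -
  have "(AE x in lebesgue_on \<Omega>. P x) \<longleftrightarrow> (AE x in lebesgue. x \<in> \<Omega> \<longrightarrow> P x)"
    using assms by (intro AE_restrict_space_iff) simp
  then show ?thesis by (simp add: AE_completion_iff)
qed

lemma borel_measurable_lebesgue_on:
  "f \<in> borel_measurable borel \<Longrightarrow> f \<in> borel_measurable (lebesgue_on \<Omega>)"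
  by (intro measurable_restrict_space1 measurable_completion) simp

text \<open>Changes a Lebesgue measurable function on \<Omega> on a null set and extends it by zero,
  so that it becomes a Borel function on the plane to which translation and Fubini apply.\<close>

lemma borel_representative:
  fixes g :: "plane \<Rightarrow> real"
  assumes "\<Omega> \<in> sets borel" "g \<in> borel_measurable (lebesgue_on \<Omega>)"
  obtains g' where "g' \<in> borel_measurable borel" "\<And>x. x \<notin> \<Omega> \<Longrightarrow> g' x = 0"
    "AE x in lebesgue_on \<Omega>. g x = g' x"
proof -
  have [measurable]: "\<Omega> \<in> sets borel" by fact
  have "(\<lambda>x. g x * indicator \<Omega> x) \<in> borel_measurable lebesgue"
    using assms by (subst (asm) borel_measurable_restrict_space_iff) (auto simp: mult.commute)
  then obtain h where h: "h \<in> borel_measurable lborel" "AE x in lborel. g x * indicator \<Omega> x = h x"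
    using completion_ex_borel_measurable_real by blast
  then have [measurable]: "h \<in> borel_measurable borel" by simp
  show ?thesis
  proof (rule that[of "\<lambda>x. h x * indicator \<Omega> x"])
    show "(\<lambda>x. h x * indicator \<Omega> x) \<in> borel_measurable borel" by measurable
    show "AE x in lebesgue_on \<Omega>. g x = h x * indicator \<Omega> x"
      unfolding AE_lebesgue_on_iff[OF assms(1)] using h(2) by eventually_elim (auto simp: indicator_def)
  qed simp
qed

text \<open>By Lindelof countably many of the balls cover \<Omega>, so the exceptional set is a
  countable union of null sets.\<close>

lemma AE_of_locally_AE:
  fixes \<Omega> :: "plane set"
  assumes "\<And>x. x \<in> \<Omega> \<Longrightarrow> \<exists>r>0. AE y in lborel. y \<in> ball x r \<longrightarrow> P y"
  shows "AE y in lborel. y \<in> \<Omega> \<longrightarrow> P y"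
proof -
  obtain r where r: "\<And>x. x \<in> \<Omega> \<Longrightarrow> r x > 0" "\<And>x. x \<in> \<Omega> \<Longrightarrow> AE y in lborel. y \<in> ball x (r x) \<longrightarrow> P y"
    using assms by metis
  obtain F where F: "F \<subseteq> (\<lambda>x. ball x (r x)) ` \<Omega>" "countable F" "\<Union>F = (\<Union>x\<in>\<Omega>. ball x (r x))"
    using Lindelof[of "(\<lambda>x. ball x (r x)) ` \<Omega>"] by auto
  have "\<forall>B\<in>F. AE y in lborel. y \<in> B \<longrightarrow> P y" using F(1) r(2) by auto
  then have "AE y in lborel. \<forall>B\<in>F. y \<in> B \<longrightarrow> P y"
    by (subst AE_ball_countable[OF F(2)])
  then show ?thesis
  proof eventually_elim
    case (elim y)
    show ?case
    proof
      assume "y \<in> \<Omega>"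
      then have "y \<in> \<Union>F" unfolding F(3) using r(1)[of y] by (intro UN_I[of y]) auto
      with elim show "P y" by blast
    qed
  qed
qed

section \<open>Integration by parts\<close>

text \<open>Every difference quotient has integral 0 by translation invariance. The Lipschitz
  constant dominates the quotients, and since the steps have length at most 1 they all vanish
  outside the ball of radius R + 1.\<close>

lemma integral_partial_deriv_eq_0:
  assumes "f \<in> test_fun UNIV"
  shows "(\<integral>x. partial_deriv i f x \<partial>lborel) = 0"
proof -
  obtain K where K: "smooth f" "compact K" "\<And>x. f x \<noteq> 0 \<Longrightarrow> x \<in> K"
    using assms by (rule test_funE) (rule that)
  obtain B where B: "B > 0" "\<And>x y. \<bar>f y - f x\<bar> \<le> B * norm (y - x)"
    using test_fun_lipschitz[OF assms] by metis
  obtain R where R: "\<And>x. x \<in> K \<Longrightarrow> norm x \<le> R"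
    using compact_imp_bounded[OF K(2)] by (auto simp: bounded_iff)
  define e :: plane where "e = axis i 1"
  have [simp]: "norm e = 1" by (simp add: e_def)
  have [measurable]: "f \<in> borel_measurable borel" "partial_deriv i f \<in> borel_measurable borel"
    using K(1) smooth_borel smooth_partial_deriv by auto
  define q where "q n x = real (Suc n) * (f (x + (1 / real (Suc n)) *\<^sub>R e) - f x)" for n x
  have lim: "(\<lambda>n. \<integral>x. q n x \<partial>lborel) \<longlonglongrightarrow> (\<integral>x. partial_deriv i f x \<partial>lborel)"
  proof (rule integral_dominated_convergence)
    show "integrable lborel (\<lambda>x::plane. B * indicator (cball 0 (R + 1)) x :: real)"
      using emeasure_bounded_finite[OF bounded_cball[of "0 :: plane" "R + 1"]]
      by (simp add: integrable_indicator_iff)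
    show "AE x in lborel. norm (q n x) \<le> B * indicator (cball 0 (R + 1)) x" for n
    proof (rule AE_I2)
      fix x
      define t where "t = 1 / real (Suc n)"
      have t: "t > 0" "t \<le> 1" "real (Suc n) = 1 / t" by (auto simp: t_def)
      show "norm (q n x) \<le> B * indicator (cball 0 (R + 1)) x"
      proof (cases "q n x = 0")
        case False
        then have "f (x + t *\<^sub>R e) \<noteq> 0 \<or> f x \<noteq> 0" by (auto simp: q_def t_def)
        then have "norm (x + t *\<^sub>R e) \<le> R \<or> norm x \<le> R" using K(3) R by blast
        moreover have "norm x \<le> norm (x + t *\<^sub>R e) + 1"
          using norm_triangle_ineq4[of "x + t *\<^sub>R e" "t *\<^sub>R e"] t by simp
        ultimately have "norm x \<le> R + 1" by linarith
        moreover have "norm (q n x) \<le> (1 / t) * (B * norm (t *\<^sub>R e))"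
          unfolding q_def t(3) t_def[symmetric] using B(2)[of "x + t *\<^sub>R e" x] t
          by (simp add: abs_mult pos_divide_le_eq)
        ultimately show ?thesis using t by (simp add: indicator_def)
      qed (use B in simp)
    qed
    have "(\<lambda>n. q n x) \<longlonglongrightarrow> partial_deriv i f x" for x
    proof -
      have "(f has_derivative (\<lambda>h. \<Sum>i\<in>UNIV. h $ i * partial_deriv i f x)) (at x)"
        by (rule smooth_has_derivative[OF K(1)])
      then have "((\<lambda>t. f (x + t *\<^sub>R e)) has_derivative (\<lambda>t. \<Sum>i\<in>UNIV. (t *\<^sub>R e) $ i * partial_deriv i f x)) (at 0)"
        by (intro has_derivative_compose[where f = "\<lambda>t. x + t *\<^sub>R e" and g = f]) (auto intro!: derivative_eq_intros)
      moreover have "(\<lambda>t. \<Sum>i\<in>UNIV. (t *\<^sub>R e) $ i * partial_deriv i f x) = (*) (partial_deriv i f x)"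
      proof
        fix t
        have "(\<Sum>j\<in>UNIV. (t *\<^sub>R e) $ j * partial_deriv j f x) = (\<Sum>j\<in>UNIV. if j = i then t * partial_deriv j f x else 0)"
          by (intro sum.cong) (auto simp: e_def axis_def)
        then show "(\<Sum>j\<in>UNIV. (t *\<^sub>R e) $ j * partial_deriv j f x) = partial_deriv i f x * t" by simp
      qed
      ultimately have "((\<lambda>t. f (x + t *\<^sub>R e)) has_field_derivative partial_deriv i f x) (at 0)"
        by (simp add: has_field_derivative_def)
      then have "((\<lambda>t. (f (x + t *\<^sub>R e) - f x) / t) \<longlongrightarrow> partial_deriv i f x) (at 0)"
        by (simp add: has_field_derivative_iff)
      moreover have "filterlim (\<lambda>n. 1 / real (Suc n)) (at 0) sequentially"
        using LIMSEQ_inverse_real_of_nat by (auto simp: filterlim_at inverse_eq_divide simp del: of_nat_Suc)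
      ultimately have "(\<lambda>n. (f (x + (1 / real (Suc n)) *\<^sub>R e) - f x) / (1 / real (Suc n))) \<longlonglongrightarrow> partial_deriv i f x"
        by (rule filterlim_compose)
      then show ?thesis by (simp add: q_def mult.commute del: of_nat_Suc)
    qed
    then show "AE x in lborel. (\<lambda>n. q n x) \<longlonglongrightarrow> partial_deriv i f x" by simp
  qed (auto simp: q_def)
  have q0: "(\<integral>x. q n x \<partial>lborel) = 0" for n
  proof -
    have "integrable lborel f" by (rule integrable_test_fun[OF assms])
    then have "integrable lborel (\<lambda>x. f (x + (1 / real (Suc n)) *\<^sub>R e))"
      by (subst integrable_translate_iff) auto
    with \<open>integrable lborel f\<close> show ?thesis
      by (simp add: q_def integral_translate[of f] del: of_nat_Suc)
  qed
  show ?thesis using LIMSEQ_unique[OF lim[unfolded q0] tendsto_const] .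
qed

lemma integration_by_parts:
  assumes "smooth f" "\<phi> \<in> test_fun UNIV"
  shows "(\<integral>x. f x * partial_deriv i \<phi> x \<partial>lborel) = - (\<integral>x. partial_deriv i f x * \<phi> x \<partial>lborel)"
proof -
  have "(\<lambda>x. f x * \<phi> x) \<in> test_fun UNIV" using assms by (rule test_fun_mult)
  from integral_partial_deriv_eq_0[OF this, of i]
  have "(\<integral>x. f x * partial_deriv i \<phi> x + partial_deriv i f x * \<phi> x \<partial>lborel) = 0"
    using assms by (simp add: partial_deriv_mult smooth_differentiable test_fun_smooth)
  moreover have "integrable lborel (\<lambda>x. f x * partial_deriv i \<phi> x)" "integrable lborel (\<lambda>x. partial_deriv i f x * \<phi> x)"
    using assms by (auto intro!: integrable_test_fun test_fun_mult test_fun_partial_deriv smooth_partial_deriv)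
  ultimately show ?thesis by simp
qed

definition classical_grad :: "(plane \<Rightarrow> real) \<Rightarrow> plane \<Rightarrow> plane" where
  "classical_grad f x = (\<chi> i. partial_deriv i f x)"

text \<open>Test functions on \<Omega> are test functions on the plane that vanish off \<Omega>,
  together with their derivatives, so a weak identity on the plane restricts to \<Omega>.\<close>

lemma weak_gradient_of_plane:
  assumes borel: "\<Omega> \<in> sets borel" and [measurable]: "v \<in> borel_measurable borel" "\<And>i. G i \<in> borel_measurable borel"
    and weak: "\<And>\<phi> i. \<phi> \<in> test_fun UNIV \<Longrightarrow> (\<integral>x. v x * partial_deriv i \<phi> x \<partial>lborel) = - (\<integral>x. G i x * \<phi> x \<partial>lborel)"
  shows "weak_gradient \<Omega> v (\<lambda>x. \<chi> i. G i x)"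
  unfolding weak_gradient_def
proof (intro ballI allI)
  fix \<phi> i assume \<phi>: "\<phi> \<in> test_fun \<Omega>"
  have \<phi>U: "\<phi> \<in> test_fun UNIV" using \<phi> test_fun_mono by blast
  have z: "\<phi> x = 0" "partial_deriv i \<phi> x = 0" if "x \<notin> \<Omega>" for x
    using that test_fun_outside[OF \<phi>] test_fun_outside[OF test_fun_partial_deriv[OF \<phi>]] by auto
  have [measurable]: "\<phi> \<in> borel_measurable borel" "partial_deriv i \<phi> \<in> borel_measurable borel"
    using test_fun_borel[OF \<phi>U] test_fun_borel[OF test_fun_partial_deriv[OF \<phi>U]] by auto
  have "(\<integral>x. v x * partial_deriv i \<phi> x \<partial>lebesgue_on \<Omega>) = (\<integral>x. indicator \<Omega> x * (v x * partial_deriv i \<phi> x) \<partial>lborel)"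
    by (rule integral_lebesgue_on[OF borel]) measurable
  also have "\<dots> = (\<integral>x. v x * partial_deriv i \<phi> x \<partial>lborel)"
    using z by (intro Bochner_Integration.integral_cong) (auto simp: indicator_def)
  also have "\<dots> = - (\<integral>x. G i x * \<phi> x \<partial>lborel)" by (rule weak[OF \<phi>U])
  also have "(\<integral>x. G i x * \<phi> x \<partial>lborel) = (\<integral>x. indicator \<Omega> x * (G i x * \<phi> x) \<partial>lborel)"
    using z by (intro Bochner_Integration.integral_cong) (auto simp: indicator_def)
  also have "\<dots> = (\<integral>x. G i x * \<phi> x \<partial>lebesgue_on \<Omega>)"
    by (rule integral_lebesgue_on[OF borel, symmetric]) measurable
  finally show "(\<integral>x. v x * partial_deriv i \<phi> x \<partial>lebesgue_on \<Omega>) = - (\<integral>x. (\<chi> i. G i x) $ i * \<phi> x \<partial>lebesgue_on \<Omega>)"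
    by simp
qed

lemma weak_gradient_classical:
  assumes "\<Omega> \<in> sets borel" "smooth f"
  shows "weak_gradient \<Omega> f (classical_grad f)"
  unfolding classical_grad_def[abs_def]
  using assms by (intro weak_gradient_of_plane integration_by_parts smooth_borel smooth_partial_deriv)

section \<open>The fundamental lemma of the calculus of variations\<close>

text \<open>Near x the mollifications of g, cut off to a ball inside \<Omega>, vanish identically,
  because the reflected and translated kernel is a test function on \<Omega>. Their L2 limit
  therefore vanishes almost everywhere near x.\<close>

lemma fundamental_lemma:
  assumes "open \<Omega>" and g: "g \<in> borel_measurable (lebesgue_on \<Omega>)" "integrable (lebesgue_on \<Omega>) (\<lambda>x. (g x)\<^sup>2)"
    and zero: "\<And>\<phi>. \<phi> \<in> test_fun \<Omega> \<Longrightarrow> (\<integral>x. g x * \<phi> x \<partial>lebesgue_on \<Omega>) = 0"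
  shows "AE x in lebesgue_on \<Omega>. g x = 0"
proof -
  have \<Omega>[measurable]: "\<Omega> \<in> sets borel" using \<open>open \<Omega>\<close> by simp
  obtain g' where g': "g' \<in> borel_measurable borel" "\<And>x. x \<notin> \<Omega> \<Longrightarrow> g' x = 0"
    "AE x in lebesgue_on \<Omega>. g x = g' x"
    using borel_representative[OF \<Omega> g(1)] by metis
  have [measurable]: "g' \<in> borel_measurable borel" by fact
  have g'm: "g' \<in> borel_measurable (lebesgue_on \<Omega>)" by (rule borel_measurable_lebesgue_on) fact
  have "integrable (lebesgue_on \<Omega>) (\<lambda>x. (g' x)\<^sup>2)"
    using g(2) by (rule integrable_cong_AE_imp) (use g'(3) g'm in auto)
  then have "integrable lborel (\<lambda>x. indicator \<Omega> x * (g' x)\<^sup>2)"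
    using integrable_lebesgue_on_iff[OF \<Omega>, of "\<lambda>x. (g' x)\<^sup>2"] by simp
  moreover have "(\<lambda>x. indicator \<Omega> x * (g' x)\<^sup>2) = (\<lambda>x. (g' x)\<^sup>2)"
    using g'(2) by (auto simp: indicator_def fun_eq_iff)
  ultimately have g'sq: "sq_int g'" by (simp add: sq_int_def)
  have zero': "(\<integral>x. g' x * \<phi> x \<partial>lborel) = 0" if \<phi>: "\<phi> \<in> test_fun \<Omega>" for \<phi>
  proof -
    have [measurable]: "\<phi> \<in> borel_measurable borel" using test_fun_borel[OF \<phi>] .
    have \<phi>m: "\<phi> \<in> borel_measurable (lebesgue_on \<Omega>)" by (rule borel_measurable_lebesgue_on) measurable
    have "(\<integral>x. g' x * \<phi> x \<partial>lborel) = (\<integral>x. indicator \<Omega> x * (g' x * \<phi> x) \<partial>lborel)"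
      using g'(2) by (intro Bochner_Integration.integral_cong) (auto simp: indicator_def)
    also have "\<dots> = (\<integral>x. g' x * \<phi> x \<partial>lebesgue_on \<Omega>)"
      by (rule integral_lebesgue_on[OF \<Omega>, symmetric]) measurable
    also have "\<dots> = (\<integral>x. g x * \<phi> x \<partial>lebesgue_on \<Omega>)"
      using g'(3) g'm g(1) \<phi>m by (intro integral_cong_AE) auto
    finally show ?thesis using zero[OF \<phi>] by simp
  qed
  obtain \<rho> where \<rho>: "\<And>n. mollifier 0 (1 / real (Suc n)) (\<rho> n)"
    using mollifier_sequence by blast
  have "\<exists>r>0. AE y in lborel. y \<in> ball x r \<longrightarrow> g' y = 0" if "x \<in> \<Omega>" for x
  proof -
    obtain r0 where r0: "r0 > 0" "cball x r0 \<subseteq> \<Omega>"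
      using \<open>open \<Omega>\<close> \<open>x \<in> \<Omega>\<close> open_contains_cball by blast
    \<comment> \<open>Halving the radius leaves room for kernels of width less than r around every
      point of the smaller ball.\<close>
    define r where "r = r0 / 2"
    have r: "r > 0" using r0 by (simp add: r_def)
    define v where "v y = indicator (ball x r0) y * g' y" for y
    have vsq: "sq_int v"
      by (rule sq_int_bound[OF g'sq, where M = 1]) (auto simp: v_def[abs_def] indicator_def)
    have vsupp: "v y = 0" if "y \<notin> ball 0 (norm x + r0)" for y
    proof -
      have "y \<notin> ball x r0" using that norm_triangle_sub[of y x] by (auto simp: dist_norm norm_minus_commute)
      then show ?thesis by (simp add: v_def)
    qed
    have [measurable]: "v \<in> borel_measurable borel" using vsq by (simp add: sq_int_def)
    have lim: "(\<lambda>n. \<integral>y. (conv (\<rho> n) v y - v y)\<^sup>2 \<partial>lborel) \<longlonglongrightarrow> 0"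
      by (rule mollify_tendsto[OF vsq vsupp \<rho>])
         (use LIMSEQ_inverse_real_of_nat in \<open>simp_all add: inverse_eq_divide\<close>)
    have le: "(\<integral>y. indicator (ball x r) y * (v y)\<^sup>2 \<partial>lborel) \<le> (\<integral>y. (conv (\<rho> n) v y - v y)\<^sup>2 \<partial>lborel)"
      if n: "1 / real (Suc n) < r" for n
    proof (rule integral_mono)
      have test: "\<rho> n \<in> test_fun UNIV" and supp: "\<rho> n y \<noteq> 0 \<Longrightarrow> norm y < 1 / real (Suc n)" for y
        using \<rho>[of n] by (auto simp: mollifier_def)
      show "integrable lborel (\<lambda>y. (conv (\<rho> n) v y - v y)\<^sup>2)"
        using sq_int_conv_diff[OF \<rho> vsq sq_int_integrable[OF vsq vsupp]] by (simp add: sq_int_def)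
      show "integrable lborel (\<lambda>y. indicator (ball x r) y * (v y)\<^sup>2)"
        using vsq by (intro integrable_mult_indicator[where 'b = real, unfolded real_scaleR_def]) (auto simp: sq_int_def)
      fix y
      show "indicator (ball x r) y * (v y)\<^sup>2 \<le> (conv (\<rho> n) v y - v y)\<^sup>2"
      proof (cases "y \<in> ball x r")
        case True
        have near: "z \<in> cball x r0 \<and> z \<in> ball x r0" if "\<rho> n (y - z) \<noteq> 0" for z
          using supp[OF that] n True dist_triangle[of x z y] by (auto simp: r_def dist_norm)
        have "conv (\<rho> n) v y = (\<integral>z. g' z * \<rho> n (y - z) \<partial>lborel)"
          unfolding conv_def v_def using near
          by (intro Bochner_Integration.integral_cong) (auto simp: indicator_def)
        also have "\<dots> = 0"
        proof (rule zero')
          have "(\<lambda>z. \<rho> n (y + (- 1) *\<^sub>R z)) \<in> test_fun UNIV" by (rule test_fun_affine[OF test]) simp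
          then show "(\<lambda>z. \<rho> n (y - z)) \<in> test_fun \<Omega>"
            using near r0(2) by (intro test_funI[of _ "cball x r0"]) (auto dest: test_fun_smooth)
        qed
        finally show ?thesis by (simp add: indicator_def)
      qed simp
    qed
    have "(\<integral>y. indicator (ball x r) y * (v y)\<^sup>2 \<partial>lborel) \<le> 0"
    proof (rule LIMSEQ_le_const[OF lim])
      obtain N where "1 / real (Suc N) < r" using nat_approx_posE[OF r] by blast
      moreover have "1 / real (Suc n) \<le> 1 / real (Suc N)" if "n \<ge> N" for n
        using that by (intro divide_left_mono) auto
      ultimately have "1 / real (Suc n) < r" if "n \<ge> N" for n
        using that by (meson order_le_less_trans)
      then show "\<exists>N. \<forall>n\<ge>N. (\<integral>y. indicator (ball x r) y * (v y)\<^sup>2 \<partial>lborel) \<le> (\<integral>y. (conv (\<rho> n) v y - v y)\<^sup>2 \<partial>lborel)"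
        using le by blast
    qed
    moreover have "(\<integral>y. indicator (ball x r) y * (v y)\<^sup>2 \<partial>lborel) \<ge> 0" by simp
    ultimately have z: "(\<integral>y. indicator (ball x r) y * (v y)\<^sup>2 \<partial>lborel) = 0" by linarith
    have "integrable lborel (\<lambda>y. indicator (ball x r) y * (v y)\<^sup>2)"
      using vsq by (intro integrable_mult_indicator[where 'b = real, unfolded real_scaleR_def]) (auto simp: sq_int_def)
    then have "AE y in lborel. indicator (ball x r) y * (v y)\<^sup>2 = 0"
      using z by (subst (asm) integral_nonneg_eq_0_iff_AE) auto
    then have "AE y in lborel. y \<in> ball x r \<longrightarrow> g' y = 0"
      by eventually_elim (use r0 in \<open>auto simp: v_def indicator_def r_def split: if_splits\<close>)
    with r show ?thesis by blast
  qed
  then have "AE y in lborel. y \<in> \<Omega> \<longrightarrow> g' y = 0" by (rule AE_of_locally_AE)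
  then have "AE y in lebesgue_on \<Omega>. g' y = 0" by (simp add: AE_lebesgue_on_iff)
  with g'(3) show ?thesis by eventually_elim simp
qed

section \<open>Square-integrable functions and Sobolev spaces on a bounded open set\<close>

lemma L2_measurable: "L2 \<Omega> u \<Longrightarrow> u \<in> borel_measurable (lebesgue_on \<Omega>)"
  by (simp add: L2_def)

lemma L2_norm_square: "L2 \<Omega> u \<Longrightarrow> integrable (lebesgue_on \<Omega>) (\<lambda>x. (norm (u x))\<^sup>2)"
  by (simp add: L2_def)

lemma L2_norm_measurable: "L2 \<Omega> u \<Longrightarrow> (\<lambda>x. norm (u x)) \<in> borel_measurable (lebesgue_on \<Omega>)"
  using measurable_compose[OF L2_measurable borel_measurable_norm] .

lemma L2_bound:
  assumes "L2 \<Omega> u" "w \<in> borel_measurable (lebesgue_on \<Omega>)" "AE x in lebesgue_on \<Omega>. norm (w x) \<le> K * norm (u x)"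
  shows "L2 \<Omega> w"
  unfolding L2_def
proof
  show "integrable (lebesgue_on \<Omega>) (\<lambda>x. (norm (w x))\<^sup>2)"
  proof (rule Bochner_Integration.integrable_bound)
    show "integrable (lebesgue_on \<Omega>) (\<lambda>x. K\<^sup>2 * (norm (u x))\<^sup>2)"
      using L2_norm_square[OF assms(1)] by simp
    show "(\<lambda>x. (norm (w x))\<^sup>2) \<in> borel_measurable (lebesgue_on \<Omega>)"
      using assms(2) by simp
    show "AE x in lebesgue_on \<Omega>. norm ((norm (w x))\<^sup>2) \<le> norm (K\<^sup>2 * (norm (u x))\<^sup>2)"
      using assms(3)
    proof eventually_elim
      case (elim x)
      then show ?case using power_mono[OF elim, of 2] by (simp add: power_mult_distrib)
    qed
  qed
qed fact

lemma L2_scaleR: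
  assumes "L2 \<Omega> u"
  shows "L2 \<Omega> (\<lambda>x. c *\<^sub>R u x)"
proof (rule L2_bound[OF assms, where K = "\<bar>c\<bar>"])
  show "(\<lambda>x. c *\<^sub>R u x) \<in> borel_measurable (lebesgue_on \<Omega>)"
    by (rule borel_measurable_scaleR[OF borel_measurable_const L2_measurable[OF assms]])
qed simp

lemma L2_cmult: "L2 \<Omega> u \<Longrightarrow> L2 \<Omega> (\<lambda>x. c * u x)" for u :: "plane \<Rightarrow> real"
  using L2_scaleR[of \<Omega> u c] by simp

lemma L2_add:
  assumes "L2 \<Omega> u" "L2 \<Omega> w"
  shows "L2 \<Omega> (\<lambda>x. u x + w x)"
proof (rule L2_bound[where K = 1 and u = "\<lambda>x. norm (u x) + norm (w x)"])
  have "(\<lambda>x. norm (u x) + norm (w x)) \<in> borel_measurable (lebesgue_on \<Omega>)"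
    by (rule borel_measurable_add[OF L2_norm_measurable[OF assms(1)] L2_norm_measurable[OF assms(2)]])
  moreover have "integrable (lebesgue_on \<Omega>) (\<lambda>x. (norm (u x) + norm (w x))\<^sup>2)"
    using assms by (intro integral_square_add_le(1) L2_norm_measurable L2_norm_square)
  ultimately show "L2 \<Omega> (\<lambda>x. norm (u x) + norm (w x))"
    by (simp add: L2_def)
  show "(\<lambda>x. u x + w x) \<in> borel_measurable (lebesgue_on \<Omega>)"
    by (rule borel_measurable_add[OF L2_measurable[OF assms(1)] L2_measurable[OF assms(2)]])
qed (simp add: norm_triangle_ineq)

lemma L2_diff: "L2 \<Omega> u \<Longrightarrow> L2 \<Omega> w \<Longrightarrow> L2 \<Omega> (\<lambda>x. u x - w x)"
  using L2_add[of \<Omega> u "\<lambda>x. (- 1) *\<^sub>R w x"] L2_scaleR[of \<Omega> w "- 1"] by simp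

lemma L2_zero: "L2 \<Omega> (\<lambda>x. 0)"
  by (simp add: L2_def)

lemma L2_nth:
  fixes g :: "plane \<Rightarrow> plane"
  assumes "L2 \<Omega> g"
  shows "L2 \<Omega> (\<lambda>x. g x $ i)"
proof (rule L2_bound[where K = 1 and u = g])
  have "(\<lambda>y :: plane. y $ i) \<in> borel_measurable borel"
    by (intro borel_measurable_continuous_onI continuous_intros)
  from measurable_compose[OF L2_measurable[OF assms] this]
  show "(\<lambda>x. g x $ i) \<in> borel_measurable (lebesgue_on \<Omega>)" .
qed (use assms in \<open>auto simp: component_le_norm_cart\<close>)

lemma L2norm_nonneg: "L2norm \<Omega> u \<ge> 0"
  by (simp add: L2norm_def)

lemma L2norm_square: "(L2norm \<Omega> u)\<^sup>2 = (\<integral>x. (norm (u x))\<^sup>2 \<partial>lebesgue_on \<Omega>)"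
  by (simp add: L2norm_def)

lemma L2_integrable_inner:
  assumes "L2 \<Omega> u" "L2 \<Omega> w"
  shows "integrable (lebesgue_on \<Omega>) (\<lambda>x. u x \<bullet> w x)"
proof (rule Bochner_Integration.integrable_bound)
  show "integrable (lebesgue_on \<Omega>) (\<lambda>x. norm (u x) * norm (w x))"
    using assms by (intro integrable_mult_square L2_norm_square L2_norm_measurable)
  show "(\<lambda>x. u x \<bullet> w x) \<in> borel_measurable (lebesgue_on \<Omega>)"
    using assms by (intro borel_measurable_inner L2_measurable)
  show "AE x in lebesgue_on \<Omega>. norm (u x \<bullet> w x) \<le> norm (norm (u x) * norm (w x))"
    by (simp add: Cauchy_Schwarz_ineq2)
qed

lemma L2_Cauchy_Schwarz_norm:
  assumes "L2 \<Omega> u" "L2 \<Omega> w"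
  shows "(\<integral>x. norm (u x) * norm (w x) \<partial>lebesgue_on \<Omega>) \<le> L2norm \<Omega> u * L2norm \<Omega> w"
proof (rule power2_le_imp_le)
  show "(\<integral>x. norm (u x) * norm (w x) \<partial>lebesgue_on \<Omega>)\<^sup>2 \<le> (L2norm \<Omega> u * L2norm \<Omega> w)\<^sup>2"
    unfolding power_mult_distrib L2norm_square
    using assms by (intro integral_Cauchy_Schwarz L2_norm_square L2_norm_measurable)
qed (simp add: L2norm_nonneg)

lemma L2norm_cong:
  assumes "AE x in lebesgue_on \<Omega>. u x = w x" "L2 \<Omega> u" "L2 \<Omega> w"
  shows "L2norm \<Omega> u = L2norm \<Omega> w"
proof -
  have "(\<integral>x. (norm (u x))\<^sup>2 \<partial>lebesgue_on \<Omega>) = (\<integral>x. (norm (w x))\<^sup>2 \<partial>lebesgue_on \<Omega>)"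
    using assms(1) L2_measurable[OF assms(2)] L2_measurable[OF assms(3)]
    by (intro integral_cong_AE) auto
  then show ?thesis by (simp add: L2norm_def)
qed

lemma L2norm_add_le:
  assumes "L2 \<Omega> u" "L2 \<Omega> w"
  shows "L2norm \<Omega> (\<lambda>x. u x + w x) \<le> L2norm \<Omega> u + L2norm \<Omega> w"
proof (rule power2_le_imp_le)
  have i: "integrable (lebesgue_on \<Omega>) (\<lambda>x. norm (u x) * norm (w x))"
    using assms by (intro integrable_mult_square L2_norm_square L2_norm_measurable)
  have "(L2norm \<Omega> (\<lambda>x. u x + w x))\<^sup>2 \<le> (\<integral>x. (norm (u x))\<^sup>2 + (norm (w x))\<^sup>2 + 2 * (norm (u x) * norm (w x)) \<partial>lebesgue_on \<Omega>)"
    unfolding L2norm_square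
  proof (rule integral_mono)
    show "(norm (u x + w x))\<^sup>2 \<le> (norm (u x))\<^sup>2 + (norm (w x))\<^sup>2 + 2 * (norm (u x) * norm (w x))" for x
      using power_mono[OF norm_triangle_ineq[of "u x" "w x"], of 2] by (simp add: power2_sum)
  qed (use L2_norm_square[OF L2_add[OF assms]] L2_norm_square[OF assms(1)] L2_norm_square[OF assms(2)] i in auto)
  also have "\<dots> = (L2norm \<Omega> u)\<^sup>2 + (L2norm \<Omega> w)\<^sup>2 + 2 * (\<integral>x. norm (u x) * norm (w x) \<partial>lebesgue_on \<Omega>)"
    unfolding L2norm_square using L2_norm_square[OF assms(1)] L2_norm_square[OF assms(2)] i by simp
  also have "\<dots> \<le> (L2norm \<Omega> u + L2norm \<Omega> w)\<^sup>2"
    using L2_Cauchy_Schwarz_norm[OF assms] by (simp add: power2_sum)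
  finally show "(L2norm \<Omega> (\<lambda>x. u x + w x))\<^sup>2 \<le> (L2norm \<Omega> u + L2norm \<Omega> w)\<^sup>2" .
qed (simp add: L2norm_nonneg)

lemma L2norm_scaleR: "L2norm \<Omega> (\<lambda>x. c *\<^sub>R u x) = \<bar>c\<bar> * L2norm \<Omega> u"
  by (simp add: L2norm_def power_mult_distrib real_sqrt_mult)

lemma LIMSEQ_0_le:
  fixes f g :: "nat \<Rightarrow> real"
  assumes "g \<longlonglongrightarrow> 0" "\<And>n. 0 \<le> f n" "\<And>n. f n \<le> g n"
  shows "f \<longlonglongrightarrow> 0"
  using tendsto_sandwich[OF _ _ tendsto_const assms(1)] assms(2,3) by simp

text \<open>The Lipschitz condition is an explicit hypothesis of the results on stream functions and
  weak duality; the lower bound on the dual value is proved from openness and boundedness.\<close>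

locale bounded_open_set =
  fixes \<Omega> :: "plane set"
  assumes op: "open \<Omega>" and bd: "bounded \<Omega>"
begin

lemma borel: "\<Omega> \<in> sets borel"
  using op by simp

lemma L2_bounded_borel:
  assumes "f \<in> borel_measurable borel" "\<And>x. x \<in> \<Omega> \<Longrightarrow> norm (f x) \<le> M"
  shows "L2 \<Omega> f"
proof (rule L2_bound[where u = "\<lambda>x. 1 :: real" and K = M])
  have "emeasure lborel \<Omega> < \<infinity>" using bd by (rule emeasure_bounded_finite)
  then have "integrable (lebesgue_on \<Omega>) (\<lambda>x. 1 :: real)"
    using borel by (subst integrable_lebesgue_on_iff) auto
  then show "L2 \<Omega> (\<lambda>x. 1 :: real)" by (simp add: L2_def)
  show "f \<in> borel_measurable (lebesgue_on \<Omega>)" using assms(1) by (rule borel_measurable_lebesgue_on)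
  show "AE x in lebesgue_on \<Omega>. norm (f x) \<le> M * norm (1 :: real)"
    using assms(2) by (auto simp: AE_lebesgue_on_iff[OF borel])
qed

lemma L2_continuous:
  fixes f :: "plane \<Rightarrow> 'b::euclidean_space"
  assumes "continuous_on UNIV f"
  shows "L2 \<Omega> f"
proof -
  have "compact (f ` closure \<Omega>)"
    using bd assms by (intro compact_continuous_image) (auto intro: continuous_on_subset)
  then have "bounded (f ` closure \<Omega>)" by (rule compact_imp_bounded)
  then obtain M where M: "\<And>y. y \<in> f ` closure \<Omega> \<Longrightarrow> norm y \<le> M" by (auto simp: bounded_iff)
  show ?thesis
  proof (rule L2_bounded_borel)
    show "f \<in> borel_measurable borel" using assms by (rule borel_measurable_continuous_onI)
    show "norm (f x) \<le> M" if "x \<in> \<Omega>" for x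
      using that closure_subset by (intro M) blast
  qed
qed

lemma L2_smooth: "smooth f \<Longrightarrow> L2 \<Omega> f"
  by (intro L2_continuous smooth_continuous)

lemma L2_classical_grad: "smooth f \<Longrightarrow> L2 \<Omega> (classical_grad f)"
  unfolding classical_grad_def
  by (intro L2_continuous continuous_on_vec_lambda smooth_continuous smooth_partial_deriv)

lemma L2_test: "\<phi> \<in> test_fun \<Omega> \<Longrightarrow> L2 \<Omega> \<phi>"
  by (intro L2_smooth test_fun_smooth)

lemma integrable_mult_test:
  "L2 \<Omega> u \<Longrightarrow> \<phi> \<in> test_fun \<Omega> \<Longrightarrow> integrable (lebesgue_on \<Omega>) (\<lambda>x. u x * \<phi> x)"
  using L2_integrable_inner[OF _ L2_test, of u \<phi>] by simp

text \<open>\<open>grad\<close> is a choice, so every computation with it passes through this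
  uniqueness, in the form \<open>grad_eq\<close>. The fundamental lemma is applied to each component
  of the difference.\<close>

lemma weak_gradient_unique:
  assumes "L2 \<Omega> g" "L2 \<Omega> h" "weak_gradient \<Omega> u g" "weak_gradient \<Omega> u h"
  shows "AE x in lebesgue_on \<Omega>. g x = h x"
proof -
  have "AE x in lebesgue_on \<Omega>. g x $ i - h x $ i = 0" for i
  proof (rule fundamental_lemma[OF op])
    have L: "L2 \<Omega> (\<lambda>x. g x $ i - h x $ i)" using assms by (intro L2_diff L2_nth)
    then show "(\<lambda>x. g x $ i - h x $ i) \<in> borel_measurable (lebesgue_on \<Omega>)"
      "integrable (lebesgue_on \<Omega>) (\<lambda>x. (g x $ i - h x $ i)\<^sup>2)"
      by (simp_all add: L2_def)
    fix \<phi> assume \<phi>: "\<phi> \<in> test_fun \<Omega>"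
    show "(\<integral>x. (g x $ i - h x $ i) * \<phi> x \<partial>lebesgue_on \<Omega>) = 0"
      using assms(3,4) \<phi> integrable_mult_test[OF L2_nth[OF assms(1)] \<phi>, of i]
        integrable_mult_test[OF L2_nth[OF assms(2)] \<phi>, of i]
      unfolding weak_gradient_def by (auto simp: left_diff_distrib)
  qed
  then have "AE x in lebesgue_on \<Omega>. \<forall>i. g x $ i - h x $ i = 0"
    by (simp add: AE_all_countable)
  then show ?thesis by eventually_elim (simp add: vec_eq_iff)
qed

section \<open>The space H1 and the calculus of the chosen gradient\<close>

lemma H1I: "L2 \<Omega> u \<Longrightarrow> L2 \<Omega> g \<Longrightarrow> weak_gradient \<Omega> u g \<Longrightarrow> u \<in> H1 \<Omega>"
  by (auto simp: H1_def)

lemma H1_L2: "u \<in> H1 \<Omega> \<Longrightarrow> L2 \<Omega> u"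
  by (simp add: H1_def)

lemma grad_L2: "u \<in> H1 \<Omega> \<Longrightarrow> L2 \<Omega> (grad \<Omega> u)"
  and weak_gradient_grad: "u \<in> H1 \<Omega> \<Longrightarrow> weak_gradient \<Omega> u (grad \<Omega> u)"
proof -
  assume "u \<in> H1 \<Omega>"
  then have "\<exists>g. L2 \<Omega> g \<and> weak_gradient \<Omega> u g" by (simp add: H1_def)
  from someI_ex[OF this] show "L2 \<Omega> (grad \<Omega> u)" "weak_gradient \<Omega> u (grad \<Omega> u)"
    by (simp_all add: grad_def)
qed

lemma grad_eq:
  assumes "L2 \<Omega> u" "L2 \<Omega> g" "weak_gradient \<Omega> u g"
  shows "AE x in lebesgue_on \<Omega>. grad \<Omega> u x = g x"
  using H1I[OF assms]
  by (intro weak_gradient_unique[OF _ assms(2) _ assms(3)] grad_L2 weak_gradient_grad)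

lemma weak_gradient_add:
  assumes "L2 \<Omega> u" "L2 \<Omega> g" "L2 \<Omega> w" "L2 \<Omega> h" "weak_gradient \<Omega> u g" "weak_gradient \<Omega> w h"
  shows "weak_gradient \<Omega> (\<lambda>x. u x + w x) (\<lambda>x. g x + h x)"
  unfolding weak_gradient_def
proof (intro ballI allI)
  fix \<phi> i assume \<phi>: "\<phi> \<in> test_fun \<Omega>"
  then show "(\<integral>x. (u x + w x) * partial_deriv i \<phi> x \<partial>lebesgue_on \<Omega>)
      = - (\<integral>x. (g x + h x) $ i * \<phi> x \<partial>lebesgue_on \<Omega>)"
    using assms(5,6) integrable_mult_test[OF assms(1) test_fun_partial_deriv[OF \<phi>], of i]
      integrable_mult_test[OF assms(3) test_fun_partial_deriv[OF \<phi>], of i]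
      integrable_mult_test[OF L2_nth[OF assms(2)] \<phi>, of i]
      integrable_mult_test[OF L2_nth[OF assms(4)] \<phi>, of i]
    by (simp add: weak_gradient_def distrib_right)
qed

lemma weak_gradient_cmult:
  assumes "weak_gradient \<Omega> u g"
  shows "weak_gradient \<Omega> (\<lambda>x. c * u x) (\<lambda>x. c *\<^sub>R g x)"
  using assms by (simp add: weak_gradient_def mult.assoc)

lemma H1_add:
  assumes "u \<in> H1 \<Omega>" "w \<in> H1 \<Omega>"
  shows "(\<lambda>x. u x + w x) \<in> H1 \<Omega>"
  using assms by (intro H1I[OF L2_add L2_add weak_gradient_add[OF H1_L2 grad_L2 H1_L2 grad_L2
        weak_gradient_grad weak_gradient_grad]] H1_L2 grad_L2)

lemma grad_add:
  assumes "u \<in> H1 \<Omega>" "w \<in> H1 \<Omega>"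
  shows "AE x in lebesgue_on \<Omega>. grad \<Omega> (\<lambda>x. u x + w x) x = grad \<Omega> u x + grad \<Omega> w x"
  using assms by (intro grad_eq L2_add H1_L2 grad_L2
      weak_gradient_add[OF H1_L2 grad_L2 H1_L2 grad_L2 weak_gradient_grad weak_gradient_grad])

lemma H1_cmult: "u \<in> H1 \<Omega> \<Longrightarrow> (\<lambda>x. c * u x) \<in> H1 \<Omega>"
  by (rule H1I[OF L2_cmult L2_scaleR weak_gradient_cmult]) (auto intro: H1_L2 grad_L2 weak_gradient_grad)

lemma grad_cmult:
  assumes "u \<in> H1 \<Omega>"
  shows "AE x in lebesgue_on \<Omega>. grad \<Omega> (\<lambda>x. c * u x) x = c *\<^sub>R grad \<Omega> u x"
  using assms by (intro grad_eq L2_cmult L2_scaleR H1_L2 grad_L2 weak_gradient_cmult[OF weak_gradient_grad])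

lemma H1_diff: "u \<in> H1 \<Omega> \<Longrightarrow> w \<in> H1 \<Omega> \<Longrightarrow> (\<lambda>x. u x - w x) \<in> H1 \<Omega>"
  using H1_add[of u "\<lambda>x. (- 1) * w x"] H1_cmult[of w "- 1"] by simp

lemma grad_diff:
  assumes "u \<in> H1 \<Omega>" "w \<in> H1 \<Omega>"
  shows "AE x in lebesgue_on \<Omega>. grad \<Omega> (\<lambda>x. u x - w x) x = grad \<Omega> u x - grad \<Omega> w x"
  using grad_add[OF assms(1) H1_cmult[OF assms(2), of "- 1"]] grad_cmult[OF assms(2), of "- 1"]
  by eventually_elim simp

lemma smooth_H1: "smooth f \<Longrightarrow> f \<in> H1 \<Omega>"
  by (rule H1I[OF L2_smooth L2_classical_grad weak_gradient_classical[OF borel]])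

lemma grad_smooth: "smooth f \<Longrightarrow> AE x in lebesgue_on \<Omega>. grad \<Omega> f x = classical_grad f x"
  by (rule grad_eq[OF L2_smooth L2_classical_grad weak_gradient_classical[OF borel]])

abbreviation grad_norm :: "(plane \<Rightarrow> real) \<Rightarrow> real" where
  "grad_norm u \<equiv> L2norm \<Omega> (grad \<Omega> u)"

lemma grad_norm_add_le:
  assumes "u \<in> H1 \<Omega>" "w \<in> H1 \<Omega>"
  shows "grad_norm (\<lambda>x. u x + w x) \<le> grad_norm u + grad_norm w"
  using L2norm_cong[OF grad_add[OF assms] grad_L2[OF H1_add[OF assms]] L2_add[OF grad_L2 grad_L2]]
    L2norm_add_le[OF grad_L2 grad_L2] assms by fastforce

lemma grad_norm_cmult:
  assumes "u \<in> H1 \<Omega>"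
  shows "grad_norm (\<lambda>x. c * u x) = \<bar>c\<bar> * grad_norm u"
  using L2norm_cong[OF grad_cmult[OF assms] grad_L2[OF H1_cmult[OF assms]] L2_scaleR[OF grad_L2[OF assms]]]
  by (simp add: L2norm_scaleR)

lemma grad_norm_diff_commute:
  assumes "u \<in> H1 \<Omega>" "w \<in> H1 \<Omega>"
  shows "grad_norm (\<lambda>x. u x - w x) = grad_norm (\<lambda>x. w x - u x)"
  using grad_norm_cmult[OF H1_diff[OF assms], of "- 1"] by simp

lemma H1_conv_iff:
  "H1_conv \<Omega> v u \<longleftrightarrow> (\<lambda>n. L2norm \<Omega> (\<lambda>x. v n x - u x)) \<longlonglongrightarrow> 0 \<and> (\<lambda>n. grad_norm (\<lambda>x. v n x - u x)) \<longlonglongrightarrow> 0"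
proof
  assume "H1_conv \<Omega> v u"
  then have lim: "(\<lambda>n. H1norm \<Omega> (\<lambda>x. v n x - u x)) \<longlonglongrightarrow> 0" by (simp add: H1_conv_def)
  have "L2norm \<Omega> w \<le> H1norm \<Omega> w" "grad_norm w \<le> H1norm \<Omega> w" for w
    by (auto simp: H1norm_def intro: real_le_rsqrt)
  then show "(\<lambda>n. L2norm \<Omega> (\<lambda>x. v n x - u x)) \<longlonglongrightarrow> 0 \<and> (\<lambda>n. grad_norm (\<lambda>x. v n x - u x)) \<longlonglongrightarrow> 0"
    by (auto intro!: LIMSEQ_0_le[OF lim] L2norm_nonneg)
next
  assume "(\<lambda>n. L2norm \<Omega> (\<lambda>x. v n x - u x)) \<longlonglongrightarrow> 0 \<and> (\<lambda>n. grad_norm (\<lambda>x. v n x - u x)) \<longlonglongrightarrow> 0"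
  then have "(\<lambda>n. sqrt ((L2norm \<Omega> (\<lambda>x. v n x - u x))\<^sup>2 + (grad_norm (\<lambda>x. v n x - u x))\<^sup>2)) \<longlonglongrightarrow> sqrt (0\<^sup>2 + 0\<^sup>2)"
    by (intro tendsto_intros) auto
  then show "H1_conv \<Omega> v u" by (simp add: H1_conv_def H1norm_def)
qed

lemma H1_conv_add:
  assumes "H1_conv \<Omega> v u" "H1_conv \<Omega> v' u'" "\<And>n. v n \<in> H1 \<Omega>" "\<And>n. v' n \<in> H1 \<Omega>" "u \<in> H1 \<Omega>" "u' \<in> H1 \<Omega>"
  shows "H1_conv \<Omega> (\<lambda>n x. v n x + v' n x) (\<lambda>x. u x + u' x)"
proof -
  have eq: "(v n x + v' n x) - (u x + u' x) = (v n x - u x) + (v' n x - u' x)" for n x by simp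
  have H: "(\<lambda>x. v n x - u x) \<in> H1 \<Omega>" "(\<lambda>x. v' n x - u' x) \<in> H1 \<Omega>" for n using assms by (auto intro: H1_diff)
  show ?thesis
    unfolding H1_conv_iff eq
  proof
    have "(\<lambda>n. L2norm \<Omega> (\<lambda>x. v n x - u x) + L2norm \<Omega> (\<lambda>x. v' n x - u' x)) \<longlonglongrightarrow> 0"
      using assms(1,2) by (intro tendsto_add_zero) (auto simp: H1_conv_iff)
    then show "(\<lambda>n. L2norm \<Omega> (\<lambda>x. (v n x - u x) + (v' n x - u' x))) \<longlonglongrightarrow> 0"
      by (rule LIMSEQ_0_le) (auto simp only: add_0 intro: L2norm_nonneg L2norm_add_le[OF H1_L2[OF H(1)] H1_L2[OF H(2)]])
    have "(\<lambda>n. grad_norm (\<lambda>x. v n x - u x) + grad_norm (\<lambda>x. v' n x - u' x)) \<longlonglongrightarrow> 0"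
      using assms(1,2) by (intro tendsto_add_zero) (auto simp: H1_conv_iff)
    then show "(\<lambda>n. grad_norm (\<lambda>x. (v n x - u x) + (v' n x - u' x))) \<longlonglongrightarrow> 0"
      by (rule LIMSEQ_0_le) (auto simp only: add_0 intro: L2norm_nonneg grad_norm_add_le[OF H])
  qed
qed

text \<open>The gradient chosen for the zero function is unspecified on null sets; homogeneity with
  factor 0 gives its norm at once.\<close>

lemma grad_norm_zero: "grad_norm (\<lambda>x. 0) = 0"
  using grad_norm_cmult[OF smooth_H1[OF smooth_const], of 0] by simp

lemma H1_conv_const: "H1_conv \<Omega> (\<lambda>n. u) u"
  by (simp add: H1_conv_iff grad_norm_zero) (simp add: L2norm_def)

section \<open>The closure of the test functions in H1\<close>

lemma H10_H1: "u \<in> H10 \<Omega> \<Longrightarrow> u \<in> H1 \<Omega>"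
  by (simp add: H10_def)

lemma H10_approx:
  assumes "u \<in> H10 \<Omega>"
  obtains \<phi> where "\<And>n. \<phi> n \<in> test_fun \<Omega>" "H1_conv \<Omega> \<phi> u"
  using assms unfolding H10_def by blast

lemma test_fun_H1: "\<phi> \<in> test_fun \<Omega> \<Longrightarrow> \<phi> \<in> H1 \<Omega>"
  by (intro smooth_H1 test_fun_smooth)

lemma H10I: "u \<in> H1 \<Omega> \<Longrightarrow> \<forall>n. \<phi> n \<in> test_fun \<Omega> \<Longrightarrow> H1_conv \<Omega> \<phi> u \<Longrightarrow> u \<in> H10 \<Omega>"
  unfolding H10_def by blast

lemma test_fun_H10: "\<phi> \<in> test_fun \<Omega> \<Longrightarrow> \<phi> \<in> H10 \<Omega>"
  using H10I[OF test_fun_H1 _ H1_conv_const] by blast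

lemma H10_add:
  assumes "u \<in> H10 \<Omega>" "w \<in> H10 \<Omega>"
  shows "(\<lambda>x. u x + w x) \<in> H10 \<Omega>"
proof -
  obtain \<phi> where \<phi>: "\<And>n. \<phi> n \<in> test_fun \<Omega>" "H1_conv \<Omega> \<phi> u" using H10_approx[OF assms(1)] by metis
  obtain \<eta> where \<eta>: "\<And>n. \<eta> n \<in> test_fun \<Omega>" "H1_conv \<Omega> \<eta> w" using H10_approx[OF assms(2)] by metis
  have "H1_conv \<Omega> (\<lambda>n x. \<phi> n x + \<eta> n x) (\<lambda>x. u x + w x)"
    using \<phi> \<eta> assms by (intro H1_conv_add test_fun_H1 H10_H1)
  moreover have "(\<lambda>x. \<phi> n x + \<eta> n x) \<in> test_fun \<Omega>" for n
    using \<phi> \<eta> by (intro test_fun_add)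
  ultimately show ?thesis
    using H10I[OF H1_add[OF assms[THEN H10_H1]], of "\<lambda>n x. \<phi> n x + \<eta> n x"] by blast
qed

lemma H10_cmult:
  assumes "u \<in> H10 \<Omega>"
  shows "(\<lambda>x. c * u x) \<in> H10 \<Omega>"
proof -
  obtain \<phi> where \<phi>: "\<And>n. \<phi> n \<in> test_fun \<Omega>" "H1_conv \<Omega> \<phi> u" using H10_approx[OF assms(1)] by metis
  have H: "(\<lambda>x. \<phi> n x - u x) \<in> H1 \<Omega>" for n using \<phi>(1) assms by (intro H1_diff test_fun_H1 H10_H1)
  have "c * \<phi> n x - c * u x = c *\<^sub>R (\<phi> n x - u x)" for n x by (simp add: right_diff_distrib)
  then have "H1_conv \<Omega> (\<lambda>n x. c * \<phi> n x) (\<lambda>x. c * u x)"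
    using \<phi>(2) unfolding H1_conv_iff
    by (simp only: L2norm_scaleR) (auto simp: grad_norm_cmult[OF H] intro!: tendsto_mult_right_zero)
  moreover have "(\<lambda>x. c * \<phi> n x) \<in> test_fun \<Omega>" for n using \<phi> by (intro test_fun_cmult)
  ultimately show ?thesis
    using H10I[OF H1_cmult[OF assms[THEN H10_H1], of c], of "\<lambda>n x. c * \<phi> n x"] by blast
qed

lemma H10_diff: "u \<in> H10 \<Omega> \<Longrightarrow> w \<in> H10 \<Omega> \<Longrightarrow> (\<lambda>x. u x - w x) \<in> H10 \<Omega>"
  using H10_add[of u "\<lambda>x. (- 1) * w x"] H10_cmult[of w "- 1"] by simp

lemma H10_sum: "(\<And>k. k \<in> A \<Longrightarrow> u k \<in> H10 \<Omega>) \<Longrightarrow> (\<lambda>x. \<Sum>k\<in>A. u k x) \<in> H10 \<Omega>"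
  by (induction A rule: infinite_finite_induct) (auto intro: H10_add test_fun_H10 test_fun_zero)

end

section \<open>The trilinear term\<close>

lemma ess_bounded_diff:
  assumes "ess_bounded \<Omega> f" "ess_bounded \<Omega> g"
  shows "ess_bounded \<Omega> (\<lambda>x. f x - g x)"
proof -
  obtain M M' where M: "AE x in lebesgue_on \<Omega>. \<bar>f x\<bar> \<le> M" "AE x in lebesgue_on \<Omega>. \<bar>g x\<bar> \<le> M'"
    using assms by (auto simp: ess_bounded_def)
  from M(1,2) have "AE x in lebesgue_on \<Omega>. \<bar>f x - g x\<bar> \<le> M + M'"
    by eventually_elim linarith
  then show ?thesis by (auto simp: ess_bounded_def)
qed

lemma ess_bounded_cmult:
  assumes "ess_bounded \<Omega> f"
  shows "ess_bounded \<Omega> (\<lambda>x. c * f x)"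
proof -
  obtain M where M: "AE x in lebesgue_on \<Omega>. \<bar>f x\<bar> \<le> M"
    using assms by (auto simp: ess_bounded_def)
  then have "AE x in lebesgue_on \<Omega>. \<bar>c * f x\<bar> \<le> \<bar>c\<bar> * M"
    by eventually_elim (simp add: abs_mult mult_left_mono)
  then show ?thesis by (auto simp: ess_bounded_def)
qed

lemma ess_bounded_test_fun:
  assumes "\<phi> \<in> test_fun \<Omega>'"
  shows "ess_bounded \<Omega> \<phi>"
  using test_fun_bounded[OF assms] unfolding ess_bounded_def by (metis AE_I2)

context bounded_open_set
begin

text \<open>The plain integral in \<open>advection\<close>. The two agree for essentially bounded
  \<eta>; otherwise \<open>advection\<close> is a limit of these integrals.\<close>

definition adv_int :: "(plane \<Rightarrow> plane) \<Rightarrow> (plane \<Rightarrow> real) \<Rightarrow> (plane \<Rightarrow> real) \<Rightarrow> real" where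
  "adv_int w T \<eta> = (\<integral>x. \<eta> x * (w x \<bullet> grad \<Omega> T x) \<partial>lebesgue_on \<Omega>)"

text \<open>Continuity for a fixed field w. It is demanded only for bounded \<eta>, where the
  integral is absolutely convergent. C may have any sign, so \<open>trilinear_bound_abs\<close> is
  used where monotonicity matters.\<close>

definition trilinear_bound :: "(plane \<Rightarrow> plane) \<Rightarrow> real \<Rightarrow> bool" where
  "trilinear_bound w C \<longleftrightarrow> L2 \<Omega> w \<and> (\<forall>\<eta>\<in>H10 \<Omega>. ess_bounded \<Omega> \<eta> \<longrightarrow> (\<forall>T\<in>H10 \<Omega>.
     \<bar>adv_int w T \<eta>\<bar> \<le> C * grad_norm \<eta> * grad_norm T))"

lemma adv_integrable:
  assumes "L2 \<Omega> w" "T \<in> H1 \<Omega>" "\<eta> \<in> H1 \<Omega>" "ess_bounded \<Omega> \<eta>"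
  shows "integrable (lebesgue_on \<Omega>) (\<lambda>x. \<eta> x * (w x \<bullet> grad \<Omega> T x))"
proof -
  obtain M where M: "AE x in lebesgue_on \<Omega>. \<bar>\<eta> x\<bar> \<le> M"
    using assms(4) by (auto simp: ess_bounded_def)
  have wT: "integrable (lebesgue_on \<Omega>) (\<lambda>x. w x \<bullet> grad \<Omega> T x)"
    by (rule L2_integrable_inner[OF assms(1) grad_L2[OF assms(2)]])
  show ?thesis
  proof (rule Bochner_Integration.integrable_bound)
    show "integrable (lebesgue_on \<Omega>) (\<lambda>x. M * (w x \<bullet> grad \<Omega> T x))"
      using wT by simp
    show "(\<lambda>x. \<eta> x * (w x \<bullet> grad \<Omega> T x)) \<in> borel_measurable (lebesgue_on \<Omega>)"
      by (rule borel_measurable_times[OF L2_measurable[OF H1_L2[OF assms(3)]] borel_measurable_integrable[OF wT]])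
    show "AE x in lebesgue_on \<Omega>. norm (\<eta> x * (w x \<bullet> grad \<Omega> T x)) \<le> norm (M * (w x \<bullet> grad \<Omega> T x))"
      using M by eventually_elim (auto simp: abs_mult intro!: mult_right_mono)
  qed
qed

lemma adv_int_diff:
  assumes "L2 \<Omega> w" "T \<in> H1 \<Omega>" "\<eta> \<in> H1 \<Omega>" "\<zeta> \<in> H1 \<Omega>" "ess_bounded \<Omega> \<eta>" "ess_bounded \<Omega> \<zeta>"
  shows "adv_int w T (\<lambda>x. \<eta> x - \<zeta> x) = adv_int w T \<eta> - adv_int w T \<zeta>"
  using adv_integrable[OF assms(1,2,3,5)] adv_integrable[OF assms(1,2,4,6)]
  by (simp add: adv_int_def left_diff_distrib)

lemma adv_int_diff_cmult:
  assumes "L2 \<Omega> w" "T \<in> H1 \<Omega>" "S \<in> H1 \<Omega>" "\<eta> \<in> H1 \<Omega>" "ess_bounded \<Omega> \<eta>"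
  shows "adv_int w (\<lambda>x. T x - c * S x) \<eta> = adv_int w T \<eta> - c * adv_int w S \<eta>"
proof -
  have i: "integrable (lebesgue_on \<Omega>) (\<lambda>x. \<eta> x * (w x \<bullet> grad \<Omega> T x))"
    "integrable (lebesgue_on \<Omega>) (\<lambda>x. \<eta> x * (w x \<bullet> grad \<Omega> S x))"
    using assms by (auto intro: adv_integrable)
  have cS: "(\<lambda>x. c * S x) \<in> H1 \<Omega>" using assms(3) by (rule H1_cmult)
  have "AE x in lebesgue_on \<Omega>. grad \<Omega> (\<lambda>x. T x - c * S x) x = grad \<Omega> T x - c *\<^sub>R grad \<Omega> S x"
    using grad_diff[OF assms(2) cS] grad_cmult[OF assms(3), of c] by eventually_elim simp
  then have "AE x in lebesgue_on \<Omega>. \<eta> x * (w x \<bullet> grad \<Omega> (\<lambda>x. T x - c * S x) x)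
      = \<eta> x * (w x \<bullet> grad \<Omega> T x) - c * (\<eta> x * (w x \<bullet> grad \<Omega> S x))"
    by eventually_elim (simp add: inner_diff_right right_diff_distrib mult.left_commute)
  then have "adv_int w (\<lambda>x. T x - c * S x) \<eta>
      = (\<integral>x. \<eta> x * (w x \<bullet> grad \<Omega> T x) - c * (\<eta> x * (w x \<bullet> grad \<Omega> S x)) \<partial>lebesgue_on \<Omega>)"
    unfolding adv_int_def
    by (rule integral_cong_AE[rotated 2])
      (use i borel_measurable_integrable[OF adv_integrable[OF assms(1) H1_diff[OF assms(2) cS] assms(4,5)]] in auto)
  then show ?thesis using i by (simp add: adv_int_def)
qed

lemma adv_int_dist:
  assumes "trilinear_bound w C" "T \<in> H10 \<Omega>" "\<eta> \<in> H10 \<Omega>" "\<zeta> \<in> H10 \<Omega>" "ess_bounded \<Omega> \<eta>" "ess_bounded \<Omega> \<zeta>"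
  shows "\<bar>adv_int w T \<eta> - adv_int w T \<zeta>\<bar> \<le> C * grad_norm (\<lambda>x. \<eta> x - \<zeta> x) * grad_norm T"
proof -
  have "\<bar>adv_int w T (\<lambda>x. \<eta> x - \<zeta> x)\<bar> \<le> C * grad_norm (\<lambda>x. \<eta> x - \<zeta> x) * grad_norm T"
    using assms H10_diff[OF assms(3,4)] ess_bounded_diff[OF assms(5,6)] by (simp add: trilinear_bound_def)
  then show ?thesis
    using assms by (simp add: adv_int_diff H10_H1 trilinear_bound_def)
qed

lemma grad_norm_diff_triangle:
  assumes "u \<in> H1 \<Omega>" "v \<in> H1 \<Omega>" "w \<in> H1 \<Omega>"
  shows "grad_norm (\<lambda>x. u x - w x) \<le> grad_norm (\<lambda>x. u x - v x) + grad_norm (\<lambda>x. w x - v x)"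
proof -
  have "grad_norm (\<lambda>x. (u x - v x) + (v x - w x)) \<le> grad_norm (\<lambda>x. u x - v x) + grad_norm (\<lambda>x. v x - w x)"
    using assms by (intro grad_norm_add_le H1_diff)
  then show ?thesis using grad_norm_diff_commute[OF assms(2,3)] by simp
qed

lemma trilinear_bound_abs:
  assumes "trilinear_bound w C"
  shows "trilinear_bound w \<bar>C\<bar>"
  unfolding trilinear_bound_def
proof (intro conjI ballI impI)
  fix \<eta> T assume "\<eta> \<in> H10 \<Omega>" "ess_bounded \<Omega> \<eta>" "T \<in> H10 \<Omega>"
  then have "\<bar>adv_int w T \<eta>\<bar> \<le> C * (grad_norm \<eta> * grad_norm T)"
    using assms by (simp add: trilinear_bound_def mult.assoc)
  also have "\<dots> \<le> \<bar>C\<bar> * (grad_norm \<eta> * grad_norm T)"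
    by (intro mult_right_mono) (auto simp: L2norm_nonneg)
  finally show "\<bar>adv_int w T \<eta>\<bar> \<le> \<bar>C\<bar> * grad_norm \<eta> * grad_norm T" by (simp add: mult.assoc)
qed (use assms in \<open>simp add: trilinear_bound_def\<close>)

text \<open>Comparison through the common limit \<xi>; the same estimate gives both the Cauchy
  property along one approximating sequence and the agreement of two such sequences.\<close>

lemma adv_int_Cauchy_pair:
  assumes w: "trilinear_bound w C" and T: "T \<in> H10 \<Omega>" and \<xi>: "\<xi> \<in> H10 \<Omega>"
    and "\<eta> \<in> H10 \<Omega>" "\<zeta> \<in> H10 \<Omega>" "ess_bounded \<Omega> \<eta>" "ess_bounded \<Omega> \<zeta>"
  shows "\<bar>adv_int w T \<eta> - adv_int w T \<zeta>\<bar>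
    \<le> \<bar>C\<bar> * grad_norm T * (grad_norm (\<lambda>x. \<eta> x - \<xi> x) + grad_norm (\<lambda>x. \<zeta> x - \<xi> x))"
proof -
  have "\<bar>adv_int w T \<eta> - adv_int w T \<zeta>\<bar> \<le> \<bar>C\<bar> * grad_norm (\<lambda>x. \<eta> x - \<zeta> x) * grad_norm T"
    using assms by (intro adv_int_dist trilinear_bound_abs)
  also have "\<dots> = \<bar>C\<bar> * grad_norm T * grad_norm (\<lambda>x. \<eta> x - \<zeta> x)" by simp
  also have "\<dots> \<le> \<bar>C\<bar> * grad_norm T * (grad_norm (\<lambda>x. \<eta> x - \<xi> x) + grad_norm (\<lambda>x. \<zeta> x - \<xi> x))"
    using assms by (intro mult_left_mono grad_norm_diff_triangle H10_H1) (auto simp: L2norm_nonneg)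
  finally show ?thesis .
qed

text \<open>Justifies the THE in \<open>advection\<close>: the bound makes the integrals converge
  along one sequence of test functions, and every other admissible sequence has the same limit. For
  bounded \<xi> the comparison is with the constant sequence \<xi>.\<close>

lemma advection_tendsto:
  assumes w: "trilinear_bound w C" and T: "T \<in> H10 \<Omega>" and \<xi>: "\<xi> \<in> H10 \<Omega>"
    and \<eta>: "\<And>n. \<eta> n \<in> H10 \<Omega>" "\<And>n. ess_bounded \<Omega> (\<eta> n)" "H1_conv \<Omega> \<eta> \<xi>"
  shows "(\<lambda>n. adv_int w T (\<eta> n)) \<longlonglongrightarrow> advection \<Omega> w T \<xi>"
proof -
  have close: "(\<lambda>n. \<bar>C\<bar> * grad_norm T * (grad_norm (\<lambda>x. \<zeta> n x - \<xi> x) + grad_norm (\<lambda>x. \<zeta>' n x - \<xi> x))) \<longlonglongrightarrow> 0"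
    if "H1_conv \<Omega> \<zeta> \<xi>" "H1_conv \<Omega> \<zeta>' \<xi>" for \<zeta> \<zeta>'
    using that by (intro tendsto_mult_right_zero tendsto_add_zero) (auto simp: H1_conv_iff)
  show ?thesis
  proof (cases "ess_bounded \<Omega> \<xi>")
    case True
    have "(\<lambda>n. adv_int w T (\<eta> n) - adv_int w T \<xi>) \<longlonglongrightarrow> 0"
    proof (rule Lim_null_comparison[OF _ close[OF \<eta>(3) H1_conv_const]])
      show "\<forall>\<^sub>F n in sequentially. norm (adv_int w T (\<eta> n) - adv_int w T \<xi>)
        \<le> \<bar>C\<bar> * grad_norm T * (grad_norm (\<lambda>x. \<eta> n x - \<xi> x) + grad_norm (\<lambda>x. \<xi> x - \<xi> x))"
        using adv_int_Cauchy_pair[OF w T \<xi> \<eta>(1) \<xi> \<eta>(2) True] by (simp only: real_norm_def eventually_True always_eventually)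
    qed
    moreover have "advection \<Omega> w T \<xi> = adv_int w T \<xi>"
      using True by (simp add: advection_def adv_int_def)
    ultimately show ?thesis by (simp add: LIM_zero_iff)
  next
    case False
    obtain \<phi> where \<phi>: "\<And>n. \<phi> n \<in> test_fun \<Omega>" "H1_conv \<Omega> \<phi> \<xi>" using H10_approx[OF \<xi>] by metis
    have \<phi>': "\<phi> n \<in> H10 \<Omega>" "ess_bounded \<Omega> (\<phi> n)" for n
      using test_fun_H10[OF \<phi>(1)] ess_bounded_test_fun[OF \<phi>(1)] by auto
    define D where "D n = \<bar>C\<bar> * grad_norm T * grad_norm (\<lambda>x. \<phi> n x - \<xi> x)" for n
    have "D \<longlonglongrightarrow> 0"
      using \<phi>(2) unfolding D_def by (intro tendsto_mult_right_zero) (auto simp: H1_conv_iff)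
    have "Cauchy (\<lambda>n. adv_int w T (\<phi> n))"
    proof (rule CauchyI)
      fix e :: real assume "e > 0"
      then have "\<forall>\<^sub>F n in sequentially. D n < e / 2"
        using order_tendstoD(2)[OF \<open>D \<longlonglongrightarrow> 0\<close>, of "e / 2"] by simp
      then obtain M where M: "\<And>n. n \<ge> M \<Longrightarrow> D n < e / 2"
        by (auto simp: eventually_sequentially)
      have "norm (adv_int w T (\<phi> m) - adv_int w T (\<phi> n)) < e" if "m \<ge> M" "n \<ge> M" for m n
        using adv_int_Cauchy_pair[OF w T \<xi> \<phi>'(1)[of m] \<phi>'(1)[of n] \<phi>'(2) \<phi>'(2)] M[OF that(1)] M[OF that(2)]
        by (simp add: D_def distrib_left)
      then show "\<exists>M. \<forall>m\<ge>M. \<forall>n\<ge>M. norm (adv_int w T (\<phi> m) - adv_int w T (\<phi> n)) < e" by blast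
    qed
    then obtain l where l: "(\<lambda>n. adv_int w T (\<phi> n)) \<longlonglongrightarrow> l"
      by (auto simp: Cauchy_convergent_iff convergent_def)
    have lim: "(\<lambda>n. adv_int w T (\<zeta> n)) \<longlonglongrightarrow> l"
      if \<zeta>: "\<And>n. \<zeta> n \<in> H10 \<Omega>" "\<And>n. ess_bounded \<Omega> (\<zeta> n)" "H1_conv \<Omega> \<zeta> \<xi>" for \<zeta>
    proof -
      have "(\<lambda>n. adv_int w T (\<zeta> n) - adv_int w T (\<phi> n)) \<longlonglongrightarrow> 0"
      proof (rule Lim_null_comparison[OF _ close[OF \<zeta>(3) \<phi>(2)]])
        show "\<forall>\<^sub>F n in sequentially. norm (adv_int w T (\<zeta> n) - adv_int w T (\<phi> n))
          \<le> \<bar>C\<bar> * grad_norm T * (grad_norm (\<lambda>x. \<zeta> n x - \<xi> x) + grad_norm (\<lambda>x. \<phi> n x - \<xi> x))"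
          using adv_int_Cauchy_pair[OF w T \<xi> \<zeta>(1) \<phi>'(1) \<zeta>(2) \<phi>'(2)] by (simp only: real_norm_def eventually_True always_eventually)
      qed
      from tendsto_add[OF this l] show ?thesis by simp
    qed
    have "advection \<Omega> w T \<xi> = l"
      unfolding advection_def using False
    proof (simp, intro the_equality)
      show "\<forall>\<eta>. (\<forall>n. \<eta> n \<in> H10 \<Omega> \<and> ess_bounded \<Omega> (\<eta> n)) \<and> H1_conv \<Omega> \<eta> \<xi> \<longrightarrow>
             (\<lambda>n. \<integral>x. \<eta> n x * (w x \<bullet> grad \<Omega> T x) \<partial>lebesgue_on \<Omega>) \<longlonglongrightarrow> l"
        using lim unfolding adv_int_def by blast
      fix l' assume "\<forall>\<eta>. (\<forall>n. \<eta> n \<in> H10 \<Omega> \<and> ess_bounded \<Omega> (\<eta> n)) \<and> H1_conv \<Omega> \<eta> \<xi> \<longrightarrow>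
             (\<lambda>n. \<integral>x. \<eta> n x * (w x \<bullet> grad \<Omega> T x) \<partial>lebesgue_on \<Omega>) \<longlonglongrightarrow> l'"
      then have "(\<lambda>n. adv_int w T (\<phi> n)) \<longlonglongrightarrow> l'"
        using \<phi>' \<phi>(2) unfolding adv_int_def by blast
      then show "l' = l" using l by (rule LIMSEQ_unique)
    qed
    then show ?thesis using lim[OF \<eta>] by simp
  qed
qed

lemma H10_bounded_approx:
  assumes "\<xi> \<in> H10 \<Omega>"
  obtains \<phi> where "\<And>n. \<phi> n \<in> test_fun \<Omega>" "H1_conv \<Omega> \<phi> \<xi>" "\<And>n. \<phi> n \<in> H10 \<Omega>" "\<And>n. ess_bounded \<Omega> (\<phi> n)"
  using H10_approx[OF assms] test_fun_H10 ess_bounded_test_fun by metis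

text \<open>The combination T - c S is the shape of the function \<theta> = T - \<xi> / 2 in the
  duality argument. Linearity holds for bounded approximants of \<xi> and passes to the
  limit.\<close>

lemma advection_diff_cmult:
  assumes w: "trilinear_bound w C" and "T \<in> H10 \<Omega>" "S \<in> H10 \<Omega>" "\<xi> \<in> H10 \<Omega>"
  shows "advection \<Omega> w (\<lambda>x. T x - c * S x) \<xi> = advection \<Omega> w T \<xi> - c * advection \<Omega> w S \<xi>"
proof -
  obtain \<phi> where \<phi>: "\<And>n. \<phi> n \<in> test_fun \<Omega>" "H1_conv \<Omega> \<phi> \<xi>" "\<And>n. \<phi> n \<in> H10 \<Omega>" "\<And>n. ess_bounded \<Omega> (\<phi> n)"
    using H10_bounded_approx[OF assms(4)] by metis
  have TS: "(\<lambda>x. T x - c * S x) \<in> H10 \<Omega>" using assms by (intro H10_diff H10_cmult)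
  have L: "L2 \<Omega> w" using w by (simp add: trilinear_bound_def)
  have "(\<lambda>n. adv_int w (\<lambda>x. T x - c * S x) (\<phi> n)) \<longlonglongrightarrow> advection \<Omega> w (\<lambda>x. T x - c * S x) \<xi>"
    by (rule advection_tendsto[OF w TS assms(4) \<phi>(3,4,2)])
  moreover have "(\<lambda>n. adv_int w T (\<phi> n) - c * adv_int w S (\<phi> n)) \<longlonglongrightarrow> advection \<Omega> w T \<xi> - c * advection \<Omega> w S \<xi>"
    using assms by (intro tendsto_diff tendsto_mult tendsto_const advection_tendsto[OF w _ assms(4) \<phi>(3,4,2)])
  moreover have "adv_int w (\<lambda>x. T x - c * S x) (\<phi> n) = adv_int w T (\<phi> n) - c * adv_int w S (\<phi> n)" for n
    by (rule adv_int_diff_cmult[OF L H10_H1[OF assms(2)] H10_H1[OF assms(3)] H10_H1[OF \<phi>(3)] \<phi>(4)])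
  ultimately show ?thesis using LIMSEQ_unique by simp
qed

text \<open>A velocity is tied to its stream function only almost everywhere. The first conclusion
  hands the trilinear bound on to the velocity, so that advection by it also becomes a genuine
  limit.\<close>

lemma advection_cmult_field:
  assumes w: "trilinear_bound w C" and w': "L2 \<Omega> w'" "AE x in lebesgue_on \<Omega>. w' x = c *\<^sub>R w x"
    and "T \<in> H10 \<Omega>" "\<xi> \<in> H10 \<Omega>"
  shows "trilinear_bound w' (\<bar>c\<bar> * C)" "advection \<Omega> w' T \<xi> = c * advection \<Omega> w T \<xi>"
proof -
  have L: "L2 \<Omega> w" using w by (simp add: trilinear_bound_def)
  have eq: "adv_int w' T \<eta> = c * adv_int w T \<eta>" if "\<eta> \<in> H10 \<Omega>" "ess_bounded \<Omega> \<eta>" "T \<in> H10 \<Omega>" for T \<eta>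
  proof -
    have i: "integrable (lebesgue_on \<Omega>) (\<lambda>x. \<eta> x * (w x \<bullet> grad \<Omega> T x))"
      "integrable (lebesgue_on \<Omega>) (\<lambda>x. \<eta> x * (w' x \<bullet> grad \<Omega> T x))"
      using that by (auto intro: adv_integrable H10_H1 w'(1) L)
    have "AE x in lebesgue_on \<Omega>. \<eta> x * (w' x \<bullet> grad \<Omega> T x) = c * (\<eta> x * (w x \<bullet> grad \<Omega> T x))"
      using w'(2) by eventually_elim simp
    then have "adv_int w' T \<eta> = (\<integral>x. c * (\<eta> x * (w x \<bullet> grad \<Omega> T x)) \<partial>lebesgue_on \<Omega>)"
      unfolding adv_int_def by (rule integral_cong_AE[rotated 2]) (use i in auto)
    then show ?thesis by (simp add: adv_int_def)
  qed
  show w'b: "trilinear_bound w' (\<bar>c\<bar> * C)"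
    unfolding trilinear_bound_def
  proof (intro conjI ballI impI)
    fix \<eta> T assume *: "\<eta> \<in> H10 \<Omega>" "ess_bounded \<Omega> \<eta>" "T \<in> H10 \<Omega>"
    then have "\<bar>adv_int w T \<eta>\<bar> \<le> C * grad_norm \<eta> * grad_norm T" using w by (simp add: trilinear_bound_def)
    then have "\<bar>c\<bar> * \<bar>adv_int w T \<eta>\<bar> \<le> \<bar>c\<bar> * (C * grad_norm \<eta> * grad_norm T)" by (rule mult_left_mono) simp
    then show "\<bar>adv_int w' T \<eta>\<bar> \<le> \<bar>c\<bar> * C * grad_norm \<eta> * grad_norm T"
      using eq[OF *] by (simp add: abs_mult mult.assoc)
  qed (rule w'(1))
  obtain \<phi> where \<phi>: "\<And>n. \<phi> n \<in> test_fun \<Omega>" "H1_conv \<Omega> \<phi> \<xi>" "\<And>n. \<phi> n \<in> H10 \<Omega>" "\<And>n. ess_bounded \<Omega> (\<phi> n)"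
    using H10_bounded_approx[OF assms(5)] by metis
  have "(\<lambda>n. adv_int w' T (\<phi> n)) \<longlonglongrightarrow> advection \<Omega> w' T \<xi>"
    by (rule advection_tendsto[OF w'b assms(4,5) \<phi>(3,4,2)])
  moreover have "(\<lambda>n. c * adv_int w T (\<phi> n)) \<longlonglongrightarrow> c * advection \<Omega> w T \<xi>"
    by (intro tendsto_mult tendsto_const advection_tendsto[OF w assms(4,5) \<phi>(3,4,2)])
  moreover have "adv_int w' T (\<phi> n) = c * adv_int w T (\<phi> n)" for n
    by (rule eq[OF \<phi>(3,4) assms(4)])
  ultimately show "advection \<Omega> w' T \<xi> = c * advection \<Omega> w T \<xi>" using LIMSEQ_unique by simp
qed

lemma advection_le:
  assumes w: "trilinear_bound w C" and "T \<in> H10 \<Omega>" "\<xi> \<in> H10 \<Omega>"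
  shows "\<bar>advection \<Omega> w T \<xi>\<bar> \<le> \<bar>C\<bar> * grad_norm \<xi> * grad_norm T"
proof -
  obtain \<phi> where \<phi>: "\<And>n. \<phi> n \<in> test_fun \<Omega>" "H1_conv \<Omega> \<phi> \<xi>" "\<And>n. \<phi> n \<in> H10 \<Omega>" "\<And>n. ess_bounded \<Omega> (\<phi> n)"
    using H10_bounded_approx[OF assms(3)] by metis
  have lim: "(\<lambda>n. \<bar>adv_int w T (\<phi> n)\<bar>) \<longlonglongrightarrow> \<bar>advection \<Omega> w T \<xi>\<bar>"
    by (intro tendsto_rabs advection_tendsto[OF w assms(2,3) \<phi>(3,4,2)])
  have "(\<lambda>n. \<bar>C\<bar> * (grad_norm \<xi> + grad_norm (\<lambda>x. \<phi> n x - \<xi> x)) * grad_norm T) \<longlonglongrightarrow> \<bar>C\<bar> * (grad_norm \<xi> + 0) * grad_norm T"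
    using \<phi>(2) by (intro tendsto_intros) (auto simp: H1_conv_iff)
  with lim have "\<bar>advection \<Omega> w T \<xi>\<bar> \<le> \<bar>C\<bar> * (grad_norm \<xi> + 0) * grad_norm T"
  proof (rule LIMSEQ_le)
    have "\<bar>adv_int w T (\<phi> n)\<bar> \<le> \<bar>C\<bar> * (grad_norm \<xi> + grad_norm (\<lambda>x. \<phi> n x - \<xi> x)) * grad_norm T" for n
    proof -
      have "\<bar>adv_int w T (\<phi> n)\<bar> \<le> \<bar>C\<bar> * grad_norm (\<phi> n) * grad_norm T"
        using trilinear_bound_abs[OF w] \<phi>(3,4) assms(2) by (simp add: trilinear_bound_def)
      moreover have "grad_norm (\<phi> n) \<le> grad_norm \<xi> + grad_norm (\<lambda>x. \<phi> n x - \<xi> x)"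
        using grad_norm_add_le[OF H10_H1[OF assms(3)] H1_diff[OF H10_H1[OF \<phi>(3)[of n]] H10_H1[OF assms(3)]]] by simp
      ultimately show ?thesis
        by (meson L2norm_nonneg abs_ge_zero mult_left_mono mult_right_mono order_trans)
    qed
    then show "\<exists>N. \<forall>n\<ge>N. \<bar>adv_int w T (\<phi> n)\<bar> \<le> \<bar>C\<bar> * (grad_norm \<xi> + grad_norm (\<lambda>x. \<phi> n x - \<xi> x)) * grad_norm T"
      by blast
  qed
  then show ?thesis by simp
qed

text \<open>Twice \<phi> grad \<phi> is the gradient of the smooth function \<phi>^2, to which w is
  orthogonal.\<close>

lemma adv_int_self_test:
  assumes "L2 \<Omega> w" "\<And>\<phi>. \<phi> \<in> H1 \<Omega> \<Longrightarrow> (\<integral>x. w x \<bullet> grad \<Omega> \<phi> x \<partial>lebesgue_on \<Omega>) = 0" "\<phi> \<in> test_fun \<Omega>"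
  shows "adv_int w \<phi> \<phi> = 0"
proof -
  have s: "smooth \<phi>" using assms(3) by (rule test_fun_smooth)
  have s2: "smooth (\<lambda>x. \<phi> x * \<phi> x)" by (intro smooth_mult s)
  have cg: "classical_grad (\<lambda>x. \<phi> x * \<phi> x) x = (2 * \<phi> x) *\<^sub>R classical_grad \<phi> x" for x
    by (simp add: classical_grad_def partial_deriv_mult[OF smooth_differentiable[OF s] smooth_differentiable[OF s]] vec_eq_iff)
  have "AE x in lebesgue_on \<Omega>. w x \<bullet> grad \<Omega> (\<lambda>x. \<phi> x * \<phi> x) x = 2 * (\<phi> x * (w x \<bullet> grad \<Omega> \<phi> x))"
    using grad_smooth[OF s] grad_smooth[OF s2] by eventually_elim (simp add: cg)
  moreover have "integrable (lebesgue_on \<Omega>) (\<lambda>x. \<phi> x * (w x \<bullet> grad \<Omega> \<phi> x))"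
    using assms by (intro adv_integrable test_fun_H1) (auto intro: ess_bounded_test_fun)
  moreover have "integrable (lebesgue_on \<Omega>) (\<lambda>x. w x \<bullet> grad \<Omega> (\<lambda>x. \<phi> x * \<phi> x) x)"
    using assms(1) s2 by (intro L2_integrable_inner grad_L2 smooth_H1)
  ultimately have "(\<integral>x. w x \<bullet> grad \<Omega> (\<lambda>x. \<phi> x * \<phi> x) x \<partial>lebesgue_on \<Omega>)
      = (\<integral>x. 2 * (\<phi> x * (w x \<bullet> grad \<Omega> \<phi> x)) \<partial>lebesgue_on \<Omega>)"
    by (intro integral_cong_AE) auto
  then show ?thesis using assms(2)[OF smooth_H1[OF s2]] by (simp add: adv_int_def)
qed

text \<open>With a test function \<phi> in the bounded slot, subtracting the vanishing self term
  replaces \<xi> by \<xi> - \<phi> in the other slot; the trilinear bound then contains the gradient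
  norm of \<xi> - \<phi>, which tends to 0.\<close>

lemma advection_self:
  assumes w: "trilinear_bound w C"
    and ortho: "\<And>\<phi>. \<phi> \<in> H1 \<Omega> \<Longrightarrow> (\<integral>x. w x \<bullet> grad \<Omega> \<phi> x \<partial>lebesgue_on \<Omega>) = 0"
    and \<xi>: "\<xi> \<in> H10 \<Omega>"
  shows "advection \<Omega> w \<xi> \<xi> = 0"
proof -
  obtain \<phi> where \<phi>: "\<And>n. \<phi> n \<in> test_fun \<Omega>" "H1_conv \<Omega> \<phi> \<xi>" "\<And>n. \<phi> n \<in> H10 \<Omega>" "\<And>n. ess_bounded \<Omega> (\<phi> n)"
    using H10_bounded_approx[OF \<xi>] by metis
  have L: "L2 \<Omega> w" using w by (simp add: trilinear_bound_def)
  have lim: "(\<lambda>n. adv_int w \<xi> (\<phi> n)) \<longlonglongrightarrow> advection \<Omega> w \<xi> \<xi>"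
    by (rule advection_tendsto[OF w \<xi> \<xi> \<phi>(3,4,2)])
  have g0: "(\<lambda>n. grad_norm (\<lambda>x. \<phi> n x - \<xi> x)) \<longlonglongrightarrow> 0" using \<phi>(2) by (simp add: H1_conv_iff)
  have "(\<lambda>n. \<bar>C\<bar> * (grad_norm \<xi> + grad_norm (\<lambda>x. \<phi> n x - \<xi> x)) * grad_norm (\<lambda>x. \<phi> n x - \<xi> x)) \<longlonglongrightarrow> \<bar>C\<bar> * (grad_norm \<xi> + 0) * 0"
    using g0 by (intro tendsto_intros)
  then have z: "(\<lambda>n. \<bar>C\<bar> * (grad_norm \<xi> + grad_norm (\<lambda>x. \<phi> n x - \<xi> x)) * grad_norm (\<lambda>x. \<phi> n x - \<xi> x)) \<longlonglongrightarrow> 0" by simp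
  have "norm (adv_int w \<xi> (\<phi> n)) \<le> \<bar>C\<bar> * (grad_norm \<xi> + grad_norm (\<lambda>x. \<phi> n x - \<xi> x)) * grad_norm (\<lambda>x. \<phi> n x - \<xi> x)" for n
  proof -
    have d: "(\<lambda>x. \<xi> x - 1 * \<phi> n x) \<in> H10 \<Omega>" using H10_diff[OF \<xi> \<phi>(3)] by simp
    have "adv_int w (\<lambda>x. \<xi> x - 1 * \<phi> n x) (\<phi> n) = adv_int w \<xi> (\<phi> n) - 1 * adv_int w (\<phi> n) (\<phi> n)"
      by (rule adv_int_diff_cmult[OF L H10_H1[OF \<xi>] H10_H1[OF \<phi>(3)] H10_H1[OF \<phi>(3)] \<phi>(4)])
    then have "adv_int w \<xi> (\<phi> n) = adv_int w (\<lambda>x. \<xi> x - 1 * \<phi> n x) (\<phi> n)"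
      using adv_int_self_test[OF L ortho \<phi>(1), of n] by simp
    also have "\<bar>\<dots>\<bar> \<le> \<bar>C\<bar> * grad_norm (\<phi> n) * grad_norm (\<lambda>x. \<xi> x - 1 * \<phi> n x)"
      using trilinear_bound_abs[OF w] \<phi>(3,4) d unfolding trilinear_bound_def by blast
    also have "grad_norm (\<lambda>x. \<xi> x - 1 * \<phi> n x) = grad_norm (\<lambda>x. \<phi> n x - \<xi> x)"
      using grad_norm_diff_commute[OF H10_H1[OF \<xi>] H10_H1[OF \<phi>(3)]] by simp
    also have "\<bar>C\<bar> * grad_norm (\<phi> n) * grad_norm (\<lambda>x. \<phi> n x - \<xi> x)
        \<le> \<bar>C\<bar> * (grad_norm \<xi> + grad_norm (\<lambda>x. \<phi> n x - \<xi> x)) * grad_norm (\<lambda>x. \<phi> n x - \<xi> x)"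
      using grad_norm_add_le[OF H10_H1[OF \<xi>] H1_diff[OF H10_H1[OF \<phi>(3)[of n]] H10_H1[OF \<xi>]]]
      by (intro mult_right_mono mult_left_mono) (auto simp: L2norm_nonneg)
    finally show ?thesis by simp
  qed
  then have "(\<lambda>n. adv_int w \<xi> (\<phi> n)) \<longlonglongrightarrow> 0"
    by (intro Lim_null_comparison[OF _ z]) simp
  with lim show ?thesis by (rule LIMSEQ_unique)
qed

section \<open>Rotated gradients\<close>

lemma perp_grad_norm: "norm (perp_grad \<Omega> \<psi> x) = norm (grad \<Omega> \<psi> x)"
  by (simp add: perp_grad_def norm_vec_def L2_set_def sum_2 vector_2 add.commute)

lemma perp_grad_L2:
  assumes "\<psi> \<in> H1 \<Omega>"
  shows "L2 \<Omega> (perp_grad \<Omega> \<psi>)"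
proof (rule L2_bound[OF grad_L2[OF assms], where K = 1])
  define J :: "plane \<Rightarrow> plane" where "J y = vector [y $ 2, - y $ 1]" for y
  have "linear J" unfolding J_def
    by (rule linearI) (auto simp: vec_eq_iff forall_2 vector_2)
  then have "J \<in> borel_measurable borel"
    by (intro borel_measurable_continuous_onI linear_continuous_on) (simp add: linear_conv_bounded_linear)
  from measurable_compose[OF L2_measurable[OF grad_L2[OF assms]] this]
  show "perp_grad \<Omega> \<psi> \<in> borel_measurable (lebesgue_on \<Omega>)"
    by (simp add: J_def perp_grad_def[abs_def])
qed (simp add: perp_grad_norm)

lemma perp_grad_L2norm: "L2norm \<Omega> (perp_grad \<Omega> \<psi>) = grad_norm \<psi>"
  by (simp add: L2norm_def perp_grad_norm)

end

section \<open>Stream functions\<close>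

lemma shift_Fubini:
  fixes a b :: "plane \<Rightarrow> real" and d :: plane
  assumes [measurable]: "a \<in> borel_measurable borel" "b \<in> borel_measurable borel"
    and bound: "\<And>s. (\<integral>\<^sup>+x. ennreal \<bar>a (x + s *\<^sub>R d) * b x\<bar> \<partial>lborel) \<le> ennreal K"
  shows "(\<integral>x. (\<integral>s. indicator {0..L} s * a (x + s *\<^sub>R d) \<partial>lborel) * b x \<partial>lborel)
    = (\<integral>s. indicator {0..L} s * (\<integral>x. a (x + s *\<^sub>R d) * b x \<partial>lborel) \<partial>lborel)"
proof -
  define f where "f s x = indicator {0..L} s * (a (x + s *\<^sub>R d) * b x)" for s :: real and x
  have [measurable]: "case_prod f \<in> borel_measurable (lborel \<Otimes>\<^sub>M lborel)"
    unfolding f_def by measurable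
  have "integrable (lborel \<Otimes>\<^sub>M lborel) (case_prod f)"
  proof (rule integrableI_bounded)
    have "(\<integral>\<^sup>+p. ennreal (norm (case_prod f p)) \<partial>(lborel \<Otimes>\<^sub>M lborel))
        = (\<integral>\<^sup>+s. \<integral>\<^sup>+x. ennreal (norm (f s x)) \<partial>lborel \<partial>lborel)"
      by (subst lborel.nn_integral_fst[symmetric]) simp_all
    also have "\<dots> \<le> (\<integral>\<^sup>+s. ennreal K * indicator {0..L} s \<partial>lborel)"
    proof (rule nn_integral_mono)
      fix s :: real
      show "(\<integral>\<^sup>+x. ennreal (norm (f s x)) \<partial>lborel) \<le> ennreal K * indicator {0..L} s"
        using bound[of s] by (auto simp: f_def indicator_def)
    qed
    also have "\<dots> < \<infinity>"
      by (simp add: nn_integral_cmult_indicator ennreal_mult_less_top emeasure_lborel_Icc_eq)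
    finally show "(\<integral>\<^sup>+p. ennreal (norm (case_prod f p)) \<partial>(lborel \<Otimes>\<^sub>M lborel)) < \<infinity>" .
  qed measurable
  from lborel_pair.Fubini_integral[OF this]
  have "(\<integral>x. \<integral>s. f s x \<partial>lborel \<partial>lborel) = (\<integral>s. \<integral>x. f s x \<partial>lborel \<partial>lborel)" .
  moreover have "(\<integral>s. f s x \<partial>lborel) = (\<integral>s. indicator {0..L} s * a (x + s *\<^sub>R d) \<partial>lborel) * b x" for x
    by (simp add: f_def flip: mult.assoc)
  moreover have "(\<integral>x. f s x \<partial>lborel) = indicator {0..L} s * (\<integral>x. a (x + s *\<^sub>R d) * b x \<partial>lborel)" for s
    by (simp add: f_def)
  ultimately show ?thesis by simp
qed

lemma shift_Fubini_bounded:
  fixes a b :: "plane \<Rightarrow> real" and d :: plane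
  assumes a[measurable]: "a \<in> borel_measurable borel" and b: "integrable lborel b" and B: "\<And>x. \<bar>a x\<bar> \<le> B"
  shows "(\<integral>x. (\<integral>s. indicator {0..L} s * a (x + s *\<^sub>R d) \<partial>lborel) * b x \<partial>lborel)
    = (\<integral>s. indicator {0..L} s * (\<integral>x. a (x + s *\<^sub>R d) * b x \<partial>lborel) \<partial>lborel)"
proof (rule shift_Fubini)
  show bm[measurable]: "b \<in> borel_measurable borel" using b by auto
  fix s :: real
  have "(\<integral>\<^sup>+x. ennreal \<bar>a (x + s *\<^sub>R d) * b x\<bar> \<partial>lborel) \<le> (\<integral>\<^sup>+x. ennreal (B * \<bar>b x\<bar>) \<partial>lborel)"
    using B by (intro nn_integral_mono ennreal_leI) (simp add: abs_mult mult_right_mono)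
  also have "\<dots> = ennreal (\<integral>x. B * \<bar>b x\<bar> \<partial>lborel)"
    using b order_trans[OF abs_ge_zero B[of 0]] by (intro nn_integral_eq_integral) auto
  finally show "(\<integral>\<^sup>+x. ennreal \<bar>a (x + s *\<^sub>R d) * b x\<bar> \<partial>lborel) \<le> ennreal (\<integral>x. B * \<bar>b x\<bar> \<partial>lborel)" .
qed fact

text \<open>The adjoint of integration along d is integration along - d. Here the translated factor
  is only integrable; translation by s d moves the shift onto the bounded factor, where the second
  interchange is legitimate.\<close>

lemma shift_Fubini_integrable:
  fixes a b :: "plane \<Rightarrow> real" and d :: plane
  assumes a: "integrable lborel a" and b[measurable]: "b \<in> borel_measurable borel" and B: "\<And>x. \<bar>b x\<bar> \<le> B"
  shows "(\<integral>x. (\<integral>s. indicator {0..L} s * a (x + s *\<^sub>R d) \<partial>lborel) * b x \<partial>lborel)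
    = (\<integral>x. a x * (\<integral>s. indicator {0..L} s * b (x - s *\<^sub>R d) \<partial>lborel) \<partial>lborel)"
proof -
  have [measurable]: "a \<in> borel_measurable borel" using a by auto
  have "(\<integral>x. (\<integral>s. indicator {0..L} s * a (x + s *\<^sub>R d) \<partial>lborel) * b x \<partial>lborel)
    = (\<integral>s. indicator {0..L} s * (\<integral>x. a (x + s *\<^sub>R d) * b x \<partial>lborel) \<partial>lborel)"
  proof (rule shift_Fubini)
    fix s :: real
    have "(\<integral>\<^sup>+x. ennreal \<bar>a (x + s *\<^sub>R d) * b x\<bar> \<partial>lborel) \<le> (\<integral>\<^sup>+x. ennreal (B * \<bar>a (x + s *\<^sub>R d)\<bar>) \<partial>lborel)"
      using B by (intro nn_integral_mono ennreal_leI) (simp add: abs_mult mult.commute mult_right_mono)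
    also have "\<dots> = (\<integral>\<^sup>+x. ennreal (B * \<bar>a x\<bar>) \<partial>lborel)"
      by (rule nn_integral_translate) measurable
    also have "\<dots> = ennreal (\<integral>x. B * \<bar>a x\<bar> \<partial>lborel)"
      using a order_trans[OF abs_ge_zero B[of 0]] by (intro nn_integral_eq_integral) auto
    finally show "(\<integral>\<^sup>+x. ennreal \<bar>a (x + s *\<^sub>R d) * b x\<bar> \<partial>lborel) \<le> ennreal (\<integral>x. B * \<bar>a x\<bar> \<partial>lborel)" .
  qed measurable
  also have "\<dots> = (\<integral>s. indicator {0..L} s * (\<integral>x. b (x + s *\<^sub>R (- d)) * a x \<partial>lborel) \<partial>lborel)"
  proof (rule Bochner_Integration.integral_cong[OF refl])
    fix s :: real
    have "(\<integral>x. a (x + s *\<^sub>R d) * b ((x + s *\<^sub>R d) - s *\<^sub>R d) \<partial>lborel) = (\<integral>x. a x * b (x - s *\<^sub>R d) \<partial>lborel)"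
      by (rule integral_translate) measurable
    then show "indicator {0..L} s * (\<integral>x. a (x + s *\<^sub>R d) * b x \<partial>lborel)
        = indicator {0..L} s * (\<integral>x. b (x + s *\<^sub>R (- d)) * a x \<partial>lborel)"
      by (simp add: mult.commute)
  qed
  also have "\<dots> = (\<integral>x. (\<integral>s. indicator {0..L} s * b (x + s *\<^sub>R (- d)) \<partial>lborel) * a x \<partial>lborel)"
    by (rule shift_Fubini_bounded[symmetric]) fact+
  finally show ?thesis by (simp add: mult.commute)
qed

lemma integral_partial_deriv_line:
  assumes "smooth f" "L \<ge> 0"
  shows "(\<integral>s. indicator {0..L} s * partial_deriv i f (x + s *\<^sub>R axis i 1) \<partial>lborel) = f (x + L *\<^sub>R axis i 1) - f x"
proof -
  have D: "((\<lambda>s. f (x + s *\<^sub>R axis i 1)) has_real_derivative partial_deriv i f (x + s *\<^sub>R axis i 1)) (at s)" for s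
  proof -
    have "((\<lambda>s. x + s *\<^sub>R axis i 1) has_derivative (\<lambda>h. h *\<^sub>R axis i 1)) (at s)"
      by (auto intro!: derivative_eq_intros)
    from has_derivative_compose[OF this smooth_has_derivative[OF assms(1)]]
    have "((\<lambda>s. f (x + s *\<^sub>R axis i 1)) has_derivative
      (\<lambda>h. \<Sum>j\<in>UNIV. (h *\<^sub>R axis i 1) $ j * partial_deriv j f (x + s *\<^sub>R axis i 1))) (at s)" .
    moreover have "(\<Sum>j\<in>UNIV. (h *\<^sub>R axis i 1) $ j * partial_deriv j f (x + s *\<^sub>R axis i 1))
        = partial_deriv i f (x + s *\<^sub>R axis i 1) * h" for h
    proof -
      have "(\<Sum>j\<in>UNIV. (h *\<^sub>R axis i 1) $ j * partial_deriv j f (x + s *\<^sub>R axis i 1))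
          = (\<Sum>j\<in>UNIV. if j = i then h * partial_deriv j f (x + s *\<^sub>R axis i 1) else 0)"
        by (intro sum.cong) (auto simp: axis_def)
      then show ?thesis by simp
    qed
    ultimately show ?thesis by (simp add: has_field_derivative_def)
  qed
  have cont: "isCont (\<lambda>s. partial_deriv i f (x + s *\<^sub>R axis i 1)) s" for s
  proof -
    have "continuous_on UNIV (\<lambda>s. partial_deriv i f (x + s *\<^sub>R axis i 1))"
      by (rule continuous_on_compose2[OF smooth_continuous[OF smooth_partial_deriv[OF assms(1)], of UNIV]])
        (auto intro!: continuous_intros)
    then show ?thesis by (simp add: continuous_on_eq_continuous_at)
  qed
  have "(\<integral>s. partial_deriv i f (x + s *\<^sub>R axis i 1) * indicator {0..L} s \<partial>lborel)
      = f (x + L *\<^sub>R axis i 1) - f (x + 0 *\<^sub>R axis i 1)"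
    by (rule integral_FTC_Icc_real[where F = "\<lambda>s. f (x + s *\<^sub>R axis i 1)"]) (use assms D cont in auto)
  then show ?thesis by (simp add: mult.commute)
qed

text \<open>Cauchy-Schwarz along the segment bounds the square by L times the line integral of a^2;
  integrating over x and using translation invariance gives L^2 times the squared norm of a.\<close>

lemma line_integral_square_le:
  fixes a :: "plane \<Rightarrow> real"
  assumes a: "sq_int a" and "L \<ge> 0"
  shows "sq_int (\<lambda>x. \<integral>s. indicator {0..L} s * a (x + s *\<^sub>R d) \<partial>lborel)"
  unfolding sq_int_def
proof
  have [measurable]: "a \<in> borel_measurable borel" using a by (simp add: sq_int_def)
  define A where "A x = (\<integral>s. indicator {0..L} s * a (x + s *\<^sub>R d) \<partial>lborel)" for x
  have "(\<lambda>x. \<integral>s. indicator {0..L} s * a (x + s *\<^sub>R d) \<partial>lborel) \<in> borel_measurable lborel"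
    by measurable
  then show [measurable]: "(\<lambda>x. \<integral>s. indicator {0..L} s * a (x + s *\<^sub>R d) \<partial>lborel) \<in> borel_measurable borel"
    by simp
  have Am[measurable]: "A \<in> borel_measurable borel" unfolding A_def by measurable
  have pt: "ennreal ((A x)\<^sup>2) \<le> ennreal L * (\<integral>\<^sup>+s. indicator {0..L} s * ennreal ((a (x + s *\<^sub>R d))\<^sup>2) \<partial>lborel)" for x
  proof -
    have "ennreal \<bar>A x\<bar> \<le> (\<integral>\<^sup>+s. ennreal (norm (indicator {0..L} s * a (x + s *\<^sub>R d))) \<partial>lborel)"
    proof (cases "integrable lborel (\<lambda>s. indicator {0..L} s * a (x + s *\<^sub>R d))")
      case True
      from integral_norm_bound_ennreal[OF this] show ?thesis by (simp add: A_def)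
    next
      \<comment> \<open>On a line where the integrand is not integrable the integral has the default
        value 0, so the bound still holds.\<close>
      case False
      then show ?thesis by (simp add: A_def not_integrable_integral_eq)
    qed
    also have "\<dots> = (\<integral>\<^sup>+s. indicator {0..L} s * (indicator {0..L} s * ennreal \<bar>a (x + s *\<^sub>R d)\<bar>) \<partial>lborel)"
      by (intro nn_integral_cong) (auto simp: indicator_def)
    finally have "(ennreal \<bar>A x\<bar>)\<^sup>2 \<le> (\<integral>\<^sup>+s. indicator {0..L} s * (indicator {0..L} s * ennreal \<bar>a (x + s *\<^sub>R d)\<bar>) \<partial>lborel)\<^sup>2"
      by (intro power_mono) auto
    also have "\<dots> \<le> (\<integral>\<^sup>+s. (indicator {0..L} s)\<^sup>2 \<partial>lborel) * (\<integral>\<^sup>+s. (indicator {0..L} s * ennreal \<bar>a (x + s *\<^sub>R d)\<bar>)\<^sup>2 \<partial>lborel)"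
      by (rule Cauchy_Schwarz_nn_integral) measurable
    also have "(\<integral>\<^sup>+s. (indicator {0..L} s)\<^sup>2 \<partial>lborel) = (\<integral>\<^sup>+s. indicator {0..L} s \<partial>lborel)"
      by (intro nn_integral_cong) (auto simp: indicator_def)
    also have "\<dots> = ennreal L" using assms(2) by simp
    also have "(\<integral>\<^sup>+s. (indicator {0..L} s * ennreal \<bar>a (x + s *\<^sub>R d)\<bar>)\<^sup>2 \<partial>lborel)
        = (\<integral>\<^sup>+s. indicator {0..L} s * ennreal ((a (x + s *\<^sub>R d))\<^sup>2) \<partial>lborel)"
      by (intro nn_integral_cong) (auto simp: indicator_def ennreal_power)
    finally show ?thesis by (simp add: ennreal_power)
  qed
  have "(\<integral>\<^sup>+x. ennreal ((A x)\<^sup>2) \<partial>lborel)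
      \<le> (\<integral>\<^sup>+x. ennreal L * (\<integral>\<^sup>+s. indicator {0..L} s * ennreal ((a (x + s *\<^sub>R d))\<^sup>2) \<partial>lborel) \<partial>lborel)"
    by (rule nn_integral_mono) (rule pt)
  also have "\<dots> = ennreal L * (\<integral>\<^sup>+x. \<integral>\<^sup>+s. indicator {0..L} s * ennreal ((a (x + s *\<^sub>R d))\<^sup>2) \<partial>lborel \<partial>lborel)"
    by (rule nn_integral_cmult) measurable
  also have "(\<integral>\<^sup>+x. \<integral>\<^sup>+s. indicator {0..L} s * ennreal ((a (x + s *\<^sub>R d))\<^sup>2) \<partial>lborel \<partial>lborel)
      = (\<integral>\<^sup>+s. \<integral>\<^sup>+x. indicator {0..L} s * ennreal ((a (x + s *\<^sub>R d))\<^sup>2) \<partial>lborel \<partial>lborel)"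
    by (rule lborel_pair.Fubini') measurable
  also have "\<dots> = (\<integral>\<^sup>+s. indicator {0..L} s * (\<integral>\<^sup>+x. ennreal ((a x)\<^sup>2) \<partial>lborel) \<partial>lborel)"
    by (intro nn_integral_cong)
       (simp add: nn_integral_cmult nn_integral_translate[of "\<lambda>x. ennreal ((a x)\<^sup>2)"])
  also have "\<dots> = ennreal L * (\<integral>\<^sup>+x. ennreal ((a x)\<^sup>2) \<partial>lborel)"
    using assms(2) by (simp add: nn_integral_multc)
  also have "ennreal L * \<dots> < \<infinity>"
    using a by (auto simp: sq_int_def integrable_iff_bounded ennreal_mult_less_top)
  finally show "integrable lborel (\<lambda>x. (\<integral>s. indicator {0..L} s * a (x + s *\<^sub>R d) \<partial>lborel)\<^sup>2)"
    unfolding A_def[symmetric] by (intro integrableI_bounded) auto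
qed

section \<open>The potential of a divergence-free field\<close>

context bounded_open_set
begin

text \<open>The derivative of \<psi> along the line of integration is U1 by construction. For the
  other derivative, integration is moved onto the test function: \<Phi> integrates \<phi> upwards,
  its second derivative on \<Omega> is - \<phi>, and orthogonality of (U1, U2) to the gradient of
  \<Phi> trades the first derivative of \<Phi> for U2. \<open>ortho\<close> asks for a Borel g
  because its integral is taken with respect to \<open>lborel\<close>.\<close>

lemma potential_exists:
  assumes R: "\<Omega> \<subseteq> ball 0 R"
    and U: "sq_int U1" "sq_int U2" "\<And>x. x \<notin> \<Omega> \<Longrightarrow> U1 x = 0" "\<And>x. x \<notin> \<Omega> \<Longrightarrow> U2 x = 0"
    and ortho: "\<And>\<Phi> g. L2 \<Omega> \<Phi> \<Longrightarrow> L2 \<Omega> g \<Longrightarrow> weak_gradient \<Omega> \<Phi> g \<Longrightarrow> g \<in> borel_measurable borel \<Longrightarrow>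
      (\<integral>x. U1 x * g x $ 1 + U2 x * g x $ 2 \<partial>lborel) = 0"
  obtains \<psi> where "\<psi> \<in> borel_measurable borel" "\<And>M. sq_int (\<lambda>x. indicator (ball 0 M) x * \<psi> x)"
    "\<And>\<phi>. \<phi> \<in> test_fun UNIV \<Longrightarrow> (\<integral>x. \<psi> x * partial_deriv 1 \<phi> x \<partial>lborel) = (\<integral>x. U2 x * \<phi> x \<partial>lborel)"
    "\<And>\<phi>. \<phi> \<in> test_fun UNIV \<Longrightarrow> (\<integral>x. \<psi> x * partial_deriv 2 \<phi> x \<partial>lborel) = - (\<integral>x. U1 x * \<phi> x \<partial>lborel)"
    "\<And>x. x $ 2 \<le> - R \<Longrightarrow> \<psi> x = 0"
proof -
  define e :: plane where "e = axis 2 1"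
  have ne[simp]: "norm e = 1" by (simp add: e_def)
  have [measurable]: "U1 \<in> borel_measurable borel" "U2 \<in> borel_measurable borel"
    using U by (auto simp: sq_int_def)
  have U0: "U1 x = 0" "U2 x = 0" if "norm x \<ge> R" for x
  proof -
    have "x \<notin> \<Omega>" using R that by auto
    then show "U1 x = 0" "U2 x = 0" using U(3,4) by auto
  qed
  have intU: "integrable lborel U1" "integrable lborel U2"
    by (rule sq_int_integrable[OF U(1), of R] sq_int_integrable[OF U(2), of R], use U0 in simp)+
  \<comment> \<open>Integrating over the whole half-line avoids a dependence on a cut-off length; on
    a bounded set only a segment contributes, since U1 vanishes outside the ball.\<close>
  define \<psi> where "\<psi> x = (\<integral>s. indicator {0..} s * U1 (x + s *\<^sub>R (- e)) \<partial>lborel)" for x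
  define \<psi>L where "\<psi>L L x = (\<integral>s. indicator {0..L} s * U1 (x + s *\<^sub>R (- e)) \<partial>lborel)" for L x
  have \<psi>_eq: "\<psi> x = \<psi>L L x" if "norm x < M" "L \<ge> M + R" for x L M
    unfolding \<psi>_def \<psi>L_def
  proof (rule Bochner_Integration.integral_cong[OF refl])
    fix s :: real
    have "U1 (x + s *\<^sub>R (- e)) = 0" if "s > L"
    proof (rule U0)
      have "norm (s *\<^sub>R e) \<le> norm x + norm (s *\<^sub>R e - x)" using norm_triangle_sub by blast
      then have "\<bar>s\<bar> \<le> norm x + norm (x + s *\<^sub>R (- e))" by (simp add: norm_minus_commute)
      then show "R \<le> norm (x + s *\<^sub>R (- e))" using that \<open>norm x < M\<close> \<open>L \<ge> M + R\<close> by linarith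
    qed
    then show "indicator {0..} s * U1 (x + s *\<^sub>R (- e)) = indicator {0..L} s * U1 (x + s *\<^sub>R (- e))"
      by (auto simp: indicator_def)
  qed
  have "\<psi> \<in> borel_measurable lborel" unfolding \<psi>_def by measurable
  then have \<psi>m[measurable]: "\<psi> \<in> borel_measurable borel" by simp
  have sq: "sq_int (\<lambda>x. indicator (ball 0 M) x * \<psi> x)" for M
  proof (cases "M + R \<ge> 0")
    case True
    have "sq_int (\<psi>L (M + R))" unfolding \<psi>L_def by (rule line_integral_square_le[OF U(1) True])
    then show ?thesis
    proof (rule sq_int_bound[where M = 1])
      show "\<bar>indicator (ball 0 M) x * \<psi> x\<bar> \<le> 1 * \<bar>\<psi>L (M + R) x\<bar>" for x
        using \<psi>_eq[of x M "M + R"] by (auto simp: indicator_def)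
    qed (intro borel_measurable_times borel_measurable_indicator \<psi>m, simp)
  next
    case False
    then have "\<psi> x = 0" if "x \<in> ball 0 M" for x
      using that \<psi>_eq[of x M "M + R"] by (simp add: \<psi>L_def)
    then have "(\<lambda>x. indicator (ball 0 M) x * \<psi> x) = (\<lambda>x. 0)" by (auto simp: indicator_def)
    then show ?thesis by (simp add: sq_int_def)
  qed
  have swap: "(\<integral>x. \<psi> x * b x \<partial>lborel) = (\<integral>x. U1 x * (\<integral>s. indicator {0..L} s * b (x + s *\<^sub>R e) \<partial>lborel) \<partial>lborel)"
    if b: "b \<in> test_fun UNIV" and L: "L \<ge> M + R" and M: "\<And>x. b x \<noteq> 0 \<Longrightarrow> norm x < M" for b L M
  proof -
    have [measurable]: "b \<in> borel_measurable borel" using test_fun_borel[OF b] .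
    obtain B where B: "\<And>x. \<bar>b x\<bar> \<le> B" using test_fun_bounded[OF b] by metis
    have "(\<integral>x. \<psi> x * b x \<partial>lborel) = (\<integral>x. \<psi>L L x * b x \<partial>lborel)"
    proof (rule Bochner_Integration.integral_cong[OF refl])
      show "\<psi> x * b x = \<psi>L L x * b x" for x
        using M[of x] \<psi>_eq[OF _ L, of x] by (cases "b x = 0") auto
    qed
    also have "\<dots> = (\<integral>x. U1 x * (\<integral>s. indicator {0..L} s * b (x - s *\<^sub>R (- e)) \<partial>lborel) \<partial>lborel)"
      unfolding \<psi>L_def by (rule shift_Fubini_integrable[OF intU(1) _ B]) measurable
    finally show ?thesis by simp
  qed
  have main: "(\<integral>x. \<psi> x * partial_deriv 1 \<phi> x \<partial>lborel) = (\<integral>x. U2 x * \<phi> x \<partial>lborel)"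
      "(\<integral>x. \<psi> x * partial_deriv 2 \<phi> x \<partial>lborel) = - (\<integral>x. U1 x * \<phi> x \<partial>lborel)"
    if \<phi>: "\<phi> \<in> test_fun UNIV" for \<phi>
  proof -
    obtain K where K: "smooth \<phi>" "compact K" "\<And>x. \<phi> x \<noteq> 0 \<Longrightarrow> x \<in> K"
      using \<phi> by (rule test_funE) (rule that)
    have Kd: "partial_deriv i \<phi> x \<noteq> 0 \<Longrightarrow> x \<in> K" for i x
    proof -
      assume nz: "partial_deriv i \<phi> x \<noteq> 0"
      have "closure {x. \<phi> x \<noteq> 0} \<subseteq> K" using K by (intro closure_minimal compact_imp_closed) auto
      \<comment> \<open>Taking the compact K itself as the domain lets the support of the
        derivatives be read off.\<close>
      then have "\<phi> \<in> test_fun K" using \<phi> by (auto simp: test_fun_def)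
      from test_funE[OF test_fun_partial_deriv[OF this, of i]] nz show "x \<in> K" by metis
    qed
    obtain M where M: "M > 0" "\<And>x. x \<in> K \<Longrightarrow> norm x < M"
      using bounded_pos_less compact_imp_bounded[OF K(2)] by metis
    define L where "L = \<bar>M + R\<bar>"
    have L: "L \<ge> M + R" "L \<ge> 0" by (auto simp: L_def)
    have ind: "integrable lborel (indicator {0..L} :: real \<Rightarrow> real)"
      by (intro integrable_real_indicator) (auto simp: emeasure_lborel_Icc_eq)
    define \<Phi> where "\<Phi> x = (\<integral>s. indicator {0..L} s * \<phi> (x + s *\<^sub>R e) \<partial>lborel)" for x
    define \<Phi>d where "\<Phi>d i x = (\<integral>s. indicator {0..L} s * partial_deriv i \<phi> (x + s *\<^sub>R e) \<partial>lborel)" for i x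
    have [measurable]: "\<phi> \<in> borel_measurable borel" "partial_deriv i \<phi> \<in> borel_measurable borel" for i
      using K(1) smooth_borel smooth_partial_deriv by auto
    have "\<Phi> \<in> borel_measurable lborel" "\<Phi>d i \<in> borel_measurable lborel" for i
      unfolding \<Phi>_def \<Phi>d_def by measurable
    then have [measurable]: "\<Phi> \<in> borel_measurable borel" "\<Phi>d i \<in> borel_measurable borel" for i by auto
    \<comment> \<open>The upper end point x + L e has norm greater than M for x in \<Omega>, hence
      lies outside the support of \<phi>, and only the lower end point contributes.\<close>
    have \<Phi>d2: "\<Phi>d 2 x = - \<phi> x" if "x \<in> \<Omega>" for x
    proof -
      have "\<phi> (x + L *\<^sub>R e) = 0"
      proof (rule ccontr)
        assume "\<phi> (x + L *\<^sub>R e) \<noteq> 0"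
        then have "norm (x + L *\<^sub>R e) < M" using K(3) M(2) by blast
        moreover have "norm (L *\<^sub>R e) \<le> norm (x + L *\<^sub>R e) + norm x"
          using norm_triangle_ineq4[of "x + L *\<^sub>R e" x] by simp
        moreover have "norm x < R" using R that by auto
        ultimately show False using L by simp
      qed
      then show ?thesis
        using integral_partial_deriv_line[OF K(1) L(2), of 2 x] by (simp add: \<Phi>d_def e_def)
    qed
    have bdd: "L2 \<Omega> (\<lambda>x. \<integral>s. indicator {0..L} s * b (x + s *\<^sub>R e) \<partial>lborel)" if b: "b \<in> test_fun UNIV" for b
    proof -
      obtain B where B: "B > 0" "\<And>x. \<bar>b x\<bar> \<le> B" using test_fun_bounded[OF b] by metis
      have [measurable]: "b \<in> borel_measurable borel" using test_fun_borel[OF b] .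
      have "(\<lambda>x. \<integral>s. indicator {0..L} s * b (x + s *\<^sub>R e) \<partial>lborel) \<in> borel_measurable lborel" by measurable
      then show ?thesis
      proof (intro L2_bounded_borel)
        fix x
        have "norm (\<integral>s. indicator {0..L} s * b (x + s *\<^sub>R e) \<partial>lborel) \<le> (\<integral>s. norm (indicator {0..L} s * b (x + s *\<^sub>R e)) \<partial>lborel)"
          by (rule integral_norm_bound)
        also have "\<dots> \<le> (\<integral>s. B * indicator {0..L} s \<partial>lborel)"
        proof (rule integral_mono')
          show "integrable lborel (\<lambda>s. B * indicator {0..L} s :: real)" using ind by simp
        qed (use B in \<open>auto simp: indicator_def\<close>)
        finally show "norm (\<integral>s. indicator {0..L} s * b (x + s *\<^sub>R e) \<partial>lborel) \<le> B * L"
          using L(2) by simp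
      qed simp
    qed
    define g where "g x = (\<chi> i. \<Phi>d i x)" for x
    have gm: "g \<in> borel_measurable borel"
    proof -
      have "g x = \<Phi>d 1 x *\<^sub>R axis 1 1 + \<Phi>d 2 x *\<^sub>R axis 2 1" for x
        by (simp add: g_def vec_eq_iff forall_2 axis_def)
      then have "g = (\<lambda>x. \<Phi>d 1 x *\<^sub>R axis 1 1 + \<Phi>d 2 x *\<^sub>R axis 2 1)" by (rule ext)
      then show ?thesis by simp
    qed
    have "L2 \<Omega> (\<Phi>d i)" for i unfolding \<Phi>d_def by (rule bdd[OF test_fun_partial_deriv[OF \<phi>]])
    have L2g: "L2 \<Omega> g"
    proof (rule L2_bound[where K = 1 and u = "\<lambda>x. \<bar>\<Phi>d 1 x\<bar> + \<bar>\<Phi>d 2 x\<bar>"])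
      have "L2 \<Omega> (\<lambda>x. \<bar>\<Phi>d i x\<bar>)" for i
        using \<open>L2 \<Omega> (\<Phi>d i)\<close> by (rule L2_bound[where K = 1]) (auto intro: borel_measurable_lebesgue_on)
      then show "L2 \<Omega> (\<lambda>x. \<bar>\<Phi>d 1 x\<bar> + \<bar>\<Phi>d 2 x\<bar>)" by (intro L2_add)
      show "g \<in> borel_measurable (lebesgue_on \<Omega>)" by (rule borel_measurable_lebesgue_on[OF gm])
      show "AE x in lebesgue_on \<Omega>. norm (g x) \<le> 1 * norm (\<bar>\<Phi>d 1 x\<bar> + \<bar>\<Phi>d 2 x\<bar>)"
        using norm_le_l1_cart[of "g x" for x] by (simp add: g_def sum_2)
    qed
    have "weak_gradient \<Omega> \<Phi> g"
      unfolding weak_gradient_def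
    proof (intro ballI allI)
      fix \<eta> i assume \<eta>: "\<eta> \<in> test_fun \<Omega>"
      have \<eta>U: "\<eta> \<in> test_fun UNIV" using \<eta> test_fun_mono by blast
      have z: "\<eta> x = 0" "partial_deriv i \<eta> x = 0" if "x \<notin> \<Omega>" for x
        using that test_fun_outside[OF \<eta>] test_fun_outside[OF test_fun_partial_deriv[OF \<eta>]] by auto
      have [measurable]: "\<eta> \<in> borel_measurable borel" "partial_deriv i \<eta> \<in> borel_measurable borel"
        using test_fun_borel[OF \<eta>U] test_fun_borel[OF test_fun_partial_deriv[OF \<eta>U]] by auto
      obtain B where B: "\<And>x. \<bar>\<phi> x\<bar> \<le> B" using test_fun_bounded[OF \<phi>] by metis
      obtain B' where B': "\<And>x. \<bar>partial_deriv i \<phi> x\<bar> \<le> B'" using test_fun_bounded[OF test_fun_partial_deriv[OF \<phi>]] by metis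
      have "(\<integral>x. \<Phi> x * partial_deriv i \<eta> x \<partial>lebesgue_on \<Omega>) = (\<integral>x. indicator \<Omega> x * (\<Phi> x * partial_deriv i \<eta> x) \<partial>lborel)"
        by (rule integral_lebesgue_on[OF borel]) measurable
      also have "\<dots> = (\<integral>x. \<Phi> x * partial_deriv i \<eta> x \<partial>lborel)"
        using z by (intro Bochner_Integration.integral_cong) (auto simp: indicator_def)
      also have "\<dots> = (\<integral>s. indicator {0..L} s * (\<integral>x. \<phi> (x + s *\<^sub>R e) * partial_deriv i \<eta> x \<partial>lborel) \<partial>lborel)"
        unfolding \<Phi>_def by (rule shift_Fubini_bounded[OF _ integrable_test_fun[OF test_fun_partial_deriv[OF \<eta>U]] B]) measurable
      also have "\<dots> = (\<integral>s. indicator {0..L} s * - (\<integral>x. partial_deriv i \<phi> (x + s *\<^sub>R e) * \<eta> x \<partial>lborel) \<partial>lborel)"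
      proof (rule Bochner_Integration.integral_cong[OF refl])
        fix s :: real
        have "smooth (\<lambda>x. \<phi> (s *\<^sub>R e + 1 *\<^sub>R x))" by (rule smooth_affine[OF K(1)])
        from integration_by_parts[OF this \<eta>U, of i]
        show "indicator {0..L} s * (\<integral>x. \<phi> (x + s *\<^sub>R e) * partial_deriv i \<eta> x \<partial>lborel)
          = indicator {0..L} s * - (\<integral>x. partial_deriv i \<phi> (x + s *\<^sub>R e) * \<eta> x \<partial>lborel)"
          unfolding partial_deriv_affine[OF smooth_differentiable[OF K(1)]] by (simp add: add.commute)
      qed
      also have "\<dots> = - (\<integral>s. indicator {0..L} s * (\<integral>x. partial_deriv i \<phi> (x + s *\<^sub>R e) * \<eta> x \<partial>lborel) \<partial>lborel)"
        by simp
      also have "(\<integral>s. indicator {0..L} s * (\<integral>x. partial_deriv i \<phi> (x + s *\<^sub>R e) * \<eta> x \<partial>lborel) \<partial>lborel)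
          = (\<integral>x. \<Phi>d i x * \<eta> x \<partial>lborel)"
        unfolding \<Phi>d_def by (rule shift_Fubini_bounded[OF _ integrable_test_fun[OF \<eta>U] B', symmetric]) measurable
      also have "\<dots> = (\<integral>x. indicator \<Omega> x * (\<Phi>d i x * \<eta> x) \<partial>lborel)"
        using z by (intro Bochner_Integration.integral_cong) (auto simp: indicator_def)
      also have "\<dots> = (\<integral>x. \<Phi>d i x * \<eta> x \<partial>lebesgue_on \<Omega>)"
        by (rule integral_lebesgue_on[OF borel, symmetric]) measurable
      finally show "(\<integral>x. \<Phi> x * partial_deriv i \<eta> x \<partial>lebesgue_on \<Omega>) = - (\<integral>x. g x $ i * \<eta> x \<partial>lebesgue_on \<Omega>)"
        by (simp add: g_def)
    qed
    moreover have "L2 \<Omega> \<Phi>" unfolding \<Phi>_def by (rule bdd[OF \<phi>])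
    ultimately have o: "(\<integral>x. U1 x * \<Phi>d 1 x + U2 x * \<Phi>d 2 x \<partial>lborel) = 0"
      using ortho[OF _ L2g _ gm] by (simp add: g_def)
    have swapd: "(\<integral>x. \<psi> x * partial_deriv i \<phi> x \<partial>lborel) = (\<integral>x. U1 x * \<Phi>d i x \<partial>lborel)" for i
      unfolding \<Phi>d_def using Kd M(2) by (intro swap[OF test_fun_partial_deriv[OF \<phi>] L(1)]) blast
    \<comment> \<open>Off \<Omega> the formula for \<Phi>d 2 may fail, but there U1 and U2
      vanish.\<close>
    have U2d: "U2 x * \<Phi>d 2 x = - (U2 x * \<phi> x)" and U1d: "U1 x * \<Phi>d 2 x = - (U1 x * \<phi> x)" for x
      using \<Phi>d2[of x] U(3,4)[of x] by (cases "x \<in> \<Omega>"; simp)+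
    show "(\<integral>x. \<psi> x * partial_deriv 2 \<phi> x \<partial>lborel) = - (\<integral>x. U1 x * \<phi> x \<partial>lborel)"
      by (simp add: swapd U1d)
    have bd: "integrable lborel (\<lambda>x. u x * b x)" if "integrable lborel u" "b \<in> borel_measurable borel" "\<And>x. \<bar>b x\<bar> \<le> B" for u b :: "plane \<Rightarrow> real" and B
    proof (rule Bochner_Integration.integrable_bound)
      show "integrable lborel (\<lambda>x. B * u x)" using that(1) by simp
      have [measurable]: "u \<in> borel_measurable borel" using that(1) by auto
      show "(\<lambda>x. u x * b x) \<in> borel_measurable lborel" using that(2) by measurable
      show "AE x in lborel. norm (u x * b x) \<le> norm (B * u x)"
        using that(3) order_trans[OF that(3) abs_ge_self] by (auto simp: abs_mult mult.commute intro!: mult_right_mono)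
    qed
    obtain B where B: "\<And>x. \<bar>\<phi> x\<bar> \<le> B" using test_fun_bounded[OF \<phi>] by metis
    obtain B' where B': "\<And>x. \<bar>partial_deriv 1 \<phi> x\<bar> \<le> B'" using test_fun_bounded[OF test_fun_partial_deriv[OF \<phi>]] by metis
    have "\<bar>\<Phi>d 1 x\<bar> \<le> B' * L" for x
    proof -
      have "norm (\<Phi>d 1 x) \<le> (\<integral>s. norm (indicator {0..L} s * partial_deriv 1 \<phi> (x + s *\<^sub>R e)) \<partial>lborel)"
        unfolding \<Phi>d_def by (rule integral_norm_bound)
      also have "\<dots> \<le> (\<integral>s. B' * indicator {0..L} s \<partial>lborel)"
      proof (rule integral_mono')
        show "integrable lborel (\<lambda>s. B' * indicator {0..L} s :: real)" using ind by simp
      qed (use B' order_trans[OF abs_ge_zero B'] in \<open>auto simp: indicator_def\<close>)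
      finally show ?thesis using L(2) by simp
    qed
    from bd[OF intU(1) _ this] have i1: "integrable lborel (\<lambda>x. U1 x * \<Phi>d 1 x)" by simp
    from bd[OF intU(2) _ B] have "integrable lborel (\<lambda>x. U2 x * \<phi> x)" by simp
    with i1 o show "(\<integral>x. \<psi> x * partial_deriv 1 \<phi> x \<partial>lborel) = (\<integral>x. U2 x * \<phi> x \<partial>lborel)"
      by (simp add: swapd U2d)
  qed
  have low: "\<psi> x = 0" if "x $ 2 \<le> - R" for x
  proof -
    have "indicator {0..} s * U1 (x + s *\<^sub>R (- e)) = 0" for s :: real
    proof (cases "s \<ge> 0")
      case True
      have "\<bar>(x + s *\<^sub>R (- e)) $ 2\<bar> \<le> norm (x + s *\<^sub>R (- e))" by (rule component_le_norm_cart)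
      then have "R \<le> norm (x + s *\<^sub>R (- e))" using that True by (simp add: e_def)
      then show ?thesis by (simp add: U0)
    qed simp
    then show ?thesis unfolding \<psi>_def by (simp only: Bochner_Integration.integral_zero)
  qed
  show ?thesis by (rule that[OF \<psi>m sq main low])
qed

end

subsection \<open>Functions with vanishing weak gradient\<close>

text \<open>On the ball each mollification has zero derivative, hence is a constant c. The mean m of
  v minimises the L2 distance to constants, so this distance is at most the mollification error and
  must be 0. Using m makes it unnecessary to follow the constants c to a limit.\<close>

lemma weakly_constant_on_ball:
  assumes \<psi>: "\<psi> \<in> borel_measurable borel" "\<And>M. sq_int (\<lambda>x. indicator (ball 0 M) x * \<psi> x)" and "r > 0"
    and zero: "\<And>\<phi> i. \<phi> \<in> test_fun (ball x0 (2 * r)) \<Longrightarrow> (\<integral>x. \<psi> x * partial_deriv i \<phi> x \<partial>lborel) = 0"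
  shows "\<exists>c. AE y in lborel. y \<in> ball x0 r \<longrightarrow> \<psi> y = c"
proof -
  have [measurable]: "\<psi> \<in> borel_measurable borel" by fact
  define v where "v y = indicator (ball x0 (2 * r)) y * \<psi> y" for y
  have vm[measurable]: "v \<in> borel_measurable borel"
    unfolding v_def by (intro borel_measurable_times borel_measurable_indicator) auto
  have sub: "y \<in> ball 0 (norm x0 + 2 * r)" if "y \<in> ball x0 (2 * r)" for y
    using that norm_triangle_sub[of y x0] by (auto simp: dist_norm norm_minus_commute)
  have vsq: "sq_int v"
  proof (rule sq_int_bound[OF \<psi>(2)[of "norm x0 + 2 * r"] vm, where M = 1])
    show "\<bar>v y\<bar> \<le> 1 * \<bar>indicator (ball 0 (norm x0 + 2 * r)) y * \<psi> y\<bar>" for y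
      using sub[of y] by (cases "y \<in> ball x0 (2 * r)") (simp_all add: v_def)
  qed
  have vsupp: "v y = 0" if "y \<notin> ball 0 (norm x0 + 2 * r)" for y
  proof -
    have "y \<notin> ball x0 (2 * r)" using that sub by blast
    then show ?thesis by (simp add: v_def)
  qed
  have vint: "integrable lborel v" by (rule sq_int_integrable[OF vsq vsupp])
  obtain \<rho> where \<rho>: "\<And>n. mollifier 0 (1 / real (Suc n)) (\<rho> n)"
    using mollifier_sequence by blast
  have lim: "(\<lambda>n. \<integral>y. (conv (\<rho> n) v y - v y)\<^sup>2 \<partial>lborel) \<longlonglongrightarrow> 0"
    by (rule mollify_tendsto[OF vsq vsupp \<rho>])
       (use LIMSEQ_inverse_real_of_nat in \<open>simp_all add: inverse_eq_divide\<close>)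
  define B where "B = ball x0 r"
  have Bb[measurable]: "B \<in> sets borel" by (simp add: B_def)
  define W V Q where "W = (\<integral>y. indicator B y \<partial>(lborel :: plane measure) :: real)"
    and "V = (\<integral>y. indicator B y * v y \<partial>lborel)" and "Q = (\<integral>y. indicator B y * (v y)\<^sup>2 \<partial>lborel)"
  have finB: "emeasure lborel B < \<infinity>" unfolding B_def by (rule emeasure_bounded_finite) simp
  have i1: "integrable lborel (indicator B :: plane \<Rightarrow> real)"
    using finB by (simp add: integrable_indicator_iff)
  have i2: "integrable lborel (\<lambda>y. indicator B y * v y)"
    using integrable_mult_indicator[OF _ vint, of B] by simp
  have i3: "integrable lborel (\<lambda>y. indicator B y * (v y)\<^sup>2)"
    using integrable_mult_indicator[of B lborel "\<lambda>y. (v y)\<^sup>2"] vsq by (simp add: sq_int_def)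
  have expand: "indicator B y * (v y - c)\<^sup>2 = indicator B y * (v y)\<^sup>2 - 2 * c * (indicator B y * v y) + c\<^sup>2 * indicator B y" for y c
    by (simp add: power2_eq_square algebra_simps)
  have i4: "integrable lborel (\<lambda>y. indicator B y * (v y - c)\<^sup>2)" for c
    unfolding expand using i1 i2 i3 by simp
  have val: "(\<integral>y. indicator B y * (v y - c)\<^sup>2 \<partial>lborel) = Q - 2 * c * V + c\<^sup>2 * W" for c
    unfolding expand using i1 i2 i3 by (simp add: W_def V_def Q_def)
  have "W > 0"
  proof -
    have "W = measure lborel B" by (simp add: W_def)
    also have "\<dots> > 0" unfolding B_def using content_ball_pos[OF \<open>r > 0\<close>, of x0] by simp
    finally show ?thesis .
  qed
  define m where "m = V / W"
  have le: "Q - 2 * m * V + m\<^sup>2 * W \<le> (\<integral>y. (conv (\<rho> n) v y - v y)\<^sup>2 \<partial>lborel)" if n: "1 / real (Suc n) < r" for n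
  proof -
    have test: "\<rho> n \<in> test_fun UNIV" and supp: "\<rho> n y \<noteq> 0 \<Longrightarrow> norm y < 1 / real (Suc n)" for y
      using \<rho>[of n] by (auto simp: mollifier_def)
    have supp': "norm y < 1 / real (Suc n)" if "partial_deriv i (\<rho> n) y \<noteq> 0" for y i
    proof (rule ccontr)
      assume far: "\<not> norm y < 1 / real (Suc n)"
      \<comment> \<open>The kernel is nonnegative, so each of its zeros is a minimum and the
        derivative vanishes there; thus the derivative is nonzero only inside the same open
        ball.\<close>
      have "partial_deriv i (\<rho> n) y = 0"
      proof (rule partial_deriv_eq[where D = "\<lambda>h. 0"])
        have nonneg: "\<rho> n z \<ge> 0" for z using \<rho>[of n] by (simp add: mollifier_def)
        have "\<rho> n y = 0" using far supp by blast
        have "(\<rho> n has_derivative (\<lambda>h. \<Sum>i\<in>UNIV. h $ i * partial_deriv i (\<rho> n) y)) (at y)"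
          by (rule smooth_has_derivative[OF test_fun_smooth[OF test]])
        moreover have "(\<lambda>h. \<Sum>i\<in>UNIV. h $ i * partial_deriv i (\<rho> n) y) = (\<lambda>h. 0)"
          using has_derivative_local_min[OF calculation] nonneg \<open>\<rho> n y = 0\<close> by simp
        ultimately show "(\<rho> n has_derivative (\<lambda>h. 0)) (at y)" by simp
      qed
      with that show False by simp
    qed
    have "(conv (\<rho> n) v has_derivative (\<lambda>h. 0)) (at y within B)" if y: "y \<in> B" for y
    proof -
      have near: "z \<in> ball x0 (2 * r)" if "norm (y - z) < 1 / real (Suc n)" for z
        using that n y dist_triangle[of x0 z y] by (auto simp: B_def dist_norm)
      have "conv (partial_deriv i (\<rho> n)) v y = 0" for i
      proof -
        have tz: "(\<lambda>z. \<rho> n (y + (- 1) *\<^sub>R z)) \<in> test_fun UNIV" by (rule test_fun_affine[OF test]) simp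
        have "(\<lambda>z. \<rho> n (y + (- 1) *\<^sub>R z)) \<in> test_fun (ball x0 (2 * r))"
        proof (rule test_funI[OF test_fun_smooth[OF tz] compact_cball])
          show "cball x0 (dist x0 y + 1 / real (Suc n)) \<subseteq> ball x0 (2 * r)"
            using y n by (auto simp: B_def)
          show "z \<in> cball x0 (dist x0 y + 1 / real (Suc n))" if "\<rho> n (y + (- 1) *\<^sub>R z) \<noteq> 0" for z
            using supp[OF that] dist_triangle[of x0 z y] by (simp add: dist_norm)
        qed
        from zero[OF this, of i] have "(\<integral>z. \<psi> z * partial_deriv i (\<rho> n) (y - z) \<partial>lborel) = 0"
          unfolding partial_deriv_affine[OF smooth_differentiable[OF test_fun_smooth[OF test]]] by simp
        moreover have "conv (partial_deriv i (\<rho> n)) v y = (\<integral>z. \<psi> z * partial_deriv i (\<rho> n) (y - z) \<partial>lborel)"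
          unfolding conv_def
        proof (rule Bochner_Integration.integral_cong[OF refl])
          fix z
          show "partial_deriv i (\<rho> n) (y - z) * v z = \<psi> z * partial_deriv i (\<rho> n) (y - z)"
            using near[of z] supp'[of i "y - z"] by (cases "partial_deriv i (\<rho> n) (y - z) = 0") (auto simp: v_def)
        qed
        ultimately show ?thesis by simp
      qed
      then show ?thesis
        using has_derivative_at_withinI[OF conv_has_derivative[OF test vint, of y], of B] by simp
    qed
    then obtain c where c: "\<And>y. y \<in> B \<Longrightarrow> conv (\<rho> n) v y = c"
      using has_derivative_zero_constant[of B "conv (\<rho> n) v"] by (auto simp: B_def)
    have "Q - 2 * m * V + m\<^sup>2 * W = Q - 2 * c * V + c\<^sup>2 * W - W * (c - m)\<^sup>2"
      using \<open>W > 0\<close> by (simp add: m_def power2_eq_square field_simps)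
    also have "\<dots> \<le> Q - 2 * c * V + c\<^sup>2 * W" using \<open>W > 0\<close> by simp
    also have "\<dots> = (\<integral>y. indicator B y * (v y - c)\<^sup>2 \<partial>lborel)" by (rule val[symmetric])
    also have "\<dots> \<le> (\<integral>y. (conv (\<rho> n) v y - v y)\<^sup>2 \<partial>lborel)"
    proof (rule integral_mono)
      show "integrable lborel (\<lambda>y. (conv (\<rho> n) v y - v y)\<^sup>2)"
        using sq_int_conv_diff[OF \<rho> vsq vint] by (simp add: sq_int_def)
      show "indicator B y * (v y - c)\<^sup>2 \<le> (conv (\<rho> n) v y - v y)\<^sup>2" for y
        using c[of y] by (cases "y \<in> B") (auto simp: power2_commute)
    qed (rule i4)
    finally show ?thesis .
  qed
  have "Q - 2 * m * V + m\<^sup>2 * W \<le> 0"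
  proof (rule LIMSEQ_le_const[OF lim])
    obtain N where "1 / real (Suc N) < r" using nat_approx_posE[OF \<open>r > 0\<close>] by blast
    moreover have "1 / real (Suc n) \<le> 1 / real (Suc N)" if "n \<ge> N" for n
      using that by (intro divide_left_mono) auto
    ultimately have "1 / real (Suc n) < r" if "n \<ge> N" for n
      using that by (meson order_le_less_trans)
    then show "\<exists>N. \<forall>n\<ge>N. Q - 2 * m * V + m\<^sup>2 * W \<le> (\<integral>y. (conv (\<rho> n) v y - v y)\<^sup>2 \<partial>lborel)"
      using le by blast
  qed
  moreover have "0 \<le> (\<integral>y. indicator B y * (v y - m)\<^sup>2 \<partial>lborel)" by simp
  ultimately have "(\<integral>y. indicator B y * (v y - m)\<^sup>2 \<partial>lborel) = 0"
    unfolding val by linarith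
  then have "AE y in lborel. indicator B y * (v y - m)\<^sup>2 = 0"
    using integral_nonneg_eq_0_iff_AE[OF i4[of m]] by simp
  then have "AE y in lborel. y \<in> ball x0 r \<longrightarrow> \<psi> y = m"
    by eventually_elim (use \<open>r > 0\<close> in \<open>auto simp: v_def B_def indicator_def split: if_splits\<close>)
  then show ?thesis by blast
qed

lemma AE_const_unique:
  fixes W :: "plane set"
  assumes "open W" "W \<noteq> {}" "AE y in lborel. y \<in> W \<longrightarrow> \<psi> y = c" "AE y in lborel. y \<in> W \<longrightarrow> \<psi> y = c'"
  shows "c = c'"
proof (rule ccontr)
  assume "c \<noteq> c'"
  from assms(3,4) have "AE y in lborel. y \<notin> W"
    by eventually_elim (use \<open>c \<noteq> c'\<close> in auto)
  then have "W \<in> null_sets lborel"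
    using assms(1) by (intro iffD2[OF AE_iff_null_sets]) auto
  then have "negligible W" by (simp add: negligible_iff_null_sets null_sets_completionI)
  then show False using open_not_negligible assms by blast
qed

text \<open>\<psi> is determined only almost everywhere, while constancy on connected sets is a
  pointwise statement; k x is the almost everywhere constant value near x. It does not depend on the
  ball because overlapping balls meet in a nonempty open set, which is not null.\<close>

lemma locally_constant_representative:
  fixes E :: "plane set"
  assumes "\<And>x. x \<in> E \<Longrightarrow> \<exists>r>0. ball x r \<subseteq> E \<and> (\<exists>c. AE y in lborel. y \<in> ball x r \<longrightarrow> \<psi> y = c)"
  obtains k where "AE y in lborel. y \<in> E \<longrightarrow> \<psi> y = k y"
    "\<And>C. connected C \<Longrightarrow> C \<subseteq> E \<Longrightarrow> k constant_on C"
    "\<And>x c r. x \<in> E \<Longrightarrow> r > 0 \<Longrightarrow> AE y in lborel. y \<in> ball x r \<longrightarrow> \<psi> y = c \<Longrightarrow> k x = c"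
proof -
  have "\<forall>x. \<exists>r c. x \<in> E \<longrightarrow> r > 0 \<and> ball x r \<subseteq> E \<and> (AE y in lborel. y \<in> ball x r \<longrightarrow> \<psi> y = c)"
    using assms by blast
  from choice[OF this] obtain r where
    "\<forall>x. \<exists>c. x \<in> E \<longrightarrow> r x > 0 \<and> ball x (r x) \<subseteq> E \<and> (AE y in lborel. y \<in> ball x (r x) \<longrightarrow> \<psi> y = c)"
    by blast
  from choice[OF this] obtain k where
    rk': "\<forall>x. x \<in> E \<longrightarrow> r x > 0 \<and> ball x (r x) \<subseteq> E \<and> (AE y in lborel. y \<in> ball x (r x) \<longrightarrow> \<psi> y = k x)"
    by blast
  have rk: "r x > 0" "ball x (r x) \<subseteq> E" "AE y in lborel. y \<in> ball x (r x) \<longrightarrow> \<psi> y = k x" if "x \<in> E" for x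
    using rk' that by blast+
  have uniq: "k x = c" if "x \<in> E" "t > 0" "AE y in lborel. y \<in> ball x' t \<longrightarrow> \<psi> y = c" "x \<in> ball x' t" for x x' c t
  proof (rule AE_const_unique)
    show "open (ball x (r x) \<inter> ball x' t)" by (intro open_Int open_ball)
    have "x \<in> ball x (r x) \<inter> ball x' t" using that(4) rk(1)[OF that(1)] by simp
    then show "ball x (r x) \<inter> ball x' t \<noteq> {}" by blast
    show "AE y in lborel. y \<in> ball x (r x) \<inter> ball x' t \<longrightarrow> \<psi> y = k x"
      using rk(3)[OF that(1)] by eventually_elim auto
    show "AE y in lborel. y \<in> ball x (r x) \<inter> ball x' t \<longrightarrow> \<psi> y = c"
      using that(3) by eventually_elim auto
  qed
  have loc: "k y = k x" if "x \<in> E" "y \<in> ball x (r x)" for x y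
    using that rk(2)[OF that(1)] by (intro uniq[OF _ rk(1)[OF that(1)] rk(3)[OF that(1)] that(2)]) auto
  show ?thesis
  proof (rule that[of k])
    show "AE y in lborel. y \<in> E \<longrightarrow> \<psi> y = k y"
    proof (rule AE_of_locally_AE)
      fix x assume x: "x \<in> E"
      have "AE y in lborel. y \<in> ball x (r x) \<longrightarrow> \<psi> y = k y"
        using rk(3)[OF x] by eventually_elim (use loc[OF x] in auto)
      then show "\<exists>r>0. AE y in lborel. y \<in> ball x r \<longrightarrow> \<psi> y = k y" using rk(1)[OF x] by blast
    qed
    show "k constant_on C" if C: "connected C" "C \<subseteq> E" for C
    proof (rule locally_constant_imp_constant[OF C(1)])
      fix a assume "a \<in> C"
      then have "a \<in> E" using C by blast
      show "\<exists>T. openin (top_of_set C) T \<and> a \<in> T \<and> (\<forall>x\<in>T. k x = k a)"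
      proof (intro exI conjI ballI)
        show "openin (top_of_set C) (C \<inter> ball a (r a))" by (rule openin_open_Int) simp
        show "a \<in> C \<inter> ball a (r a)" using \<open>a \<in> C\<close> rk(1)[OF \<open>a \<in> E\<close>] by simp
        show "k x = k a" if "x \<in> C \<inter> ball a (r a)" for x using loc[OF \<open>a \<in> E\<close>] that by blast
      qed
    qed
    show "k x = c" if "x \<in> E" "r > 0" "AE y in lborel. y \<in> ball x r \<longrightarrow> \<psi> y = c" for x c r
      using uniq[OF that(1,2,3)] that(2) by simp
  qed
qed

subsection \<open>Lipschitz boundaries\<close>

text \<open>Moving a piece of the closure upwards along the graph direction pushes it into the open set;
  below the graph the complement is connected.\<close>

lemma lipschitz_boundary_local:
  assumes lip: "lipschitz_boundary \<Omega>" and "open \<Omega>" and z: "z \<in> frontier \<Omega>"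
  obtains s C where "s > 0" "connected C" "ball z s \<inter> - closure \<Omega> \<subseteq> C" "C \<subseteq> - closure \<Omega>"
    "z \<in> closure (- closure \<Omega>)"
    "\<And>\<epsilon>. \<epsilon> > 0 \<Longrightarrow> \<exists>a \<delta>. \<delta> > 0 \<and> norm a + \<delta> < \<epsilon> \<and> (\<forall>k\<in>closure \<Omega> \<inter> cball z s. \<forall>y\<in>cball a \<delta>. k + y \<in> \<Omega>)"
proof -
  obtain r Q \<gamma> K where "r > 0" and Q: "orthogonal_transformation (Q :: plane \<Rightarrow> plane)"
    and \<gamma>: "K-lipschitz_on UNIV (\<gamma> :: real \<Rightarrow> real)"
    and graph: "\<Omega> \<inter> ball z r = {x \<in> ball z r. \<gamma> (Q x $ 1) < Q x $ 2}"
    using lip z unfolding lipschitz_boundary_def by blast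
  have "K \<ge> 0" using \<gamma> by (rule lipschitz_on_nonneg)
  have \<gamma>_le: "\<gamma> a \<le> \<gamma> b + K * \<bar>a - b\<bar>" for a b
    using lipschitz_onD[OF \<gamma>, of a b] by (simp add: dist_real_def)
  \<comment> \<open>Rotated coordinates: near z the set \<Omega> is where q exceeds \<gamma>
    composed with p.\<close>
  define p q where "p x = Q x $ 1" and "q x = Q x $ 2" for x
  have Ql: "linear Q" and Qn: "norm (Q x) = norm x" for x
    using Q by (auto simp: orthogonal_transformation)
  have Qc: "continuous_on UNIV Q" using Ql by (simp add: linear_continuous_on linear_conv_bounded_linear)
  have pq_add: "p (x + y) = p x + p y" "q (x + y) = q x + q y" "p (c *\<^sub>R x) = c * p x" "q (c *\<^sub>R x) = c * q x"
    "p (x - y) = p x - p y" "q (x - y) = q x - q y" for x y c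
    by (simp_all add: p_def q_def linear_add[OF Ql] linear_cmul[OF Ql] linear_diff[OF Ql])
  have pq_le: "\<bar>p x\<bar> \<le> norm x" "\<bar>q x\<bar> \<le> norm x" for x
    using component_le_norm_cart[of "Q x"] by (simp_all add: p_def q_def Qn)
  have norm_le: "norm x \<le> \<bar>p x\<bar> + \<bar>q x\<bar>" for x
    using norm_le_l1_cart[of "Q x"] by (simp add: p_def q_def Qn sum_2)
  have "surj Q" using Q by (rule orthogonal_transformation_surj)
  then obtain e where Qe: "Q e = axis 2 1" by (metis surjD)
  have e: "p e = 0" "q e = 1" "norm e = 1"
    using Qn[of e] by (simp_all add: p_def q_def Qe) (simp_all add: axis_def)
  have cont: "continuous_on UNIV p" "continuous_on UNIV q" "continuous_on UNIV (\<lambda>x. \<gamma> (p x))"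
  proof -
    show cp: "continuous_on UNIV p" "continuous_on UNIV q"
      unfolding p_def q_def by (intro continuous_intros Qc)+
    show "continuous_on UNIV (\<lambda>x. \<gamma> (p x))"
      by (rule continuous_on_compose2[OF lipschitz_on_continuous_on[OF \<gamma>] cp(1)]) simp
  qed
  have in\<Omega>: "x \<in> \<Omega> \<longleftrightarrow> \<gamma> (p x) < q x" if "x \<in> ball z r" for x
  proof -
    have "x \<in> \<Omega> \<longleftrightarrow> x \<in> \<Omega> \<inter> ball z r" using that by blast
    also have "\<dots> \<longleftrightarrow> \<gamma> (p x) < q x" unfolding graph using that by (simp add: p_def q_def)
    finally show ?thesis .
  qed
  have below: "x \<notin> closure \<Omega>" if "x \<in> ball z r" "q x < \<gamma> (p x)" for x
  proof -
    have op: "open {x. q x < \<gamma> (p x)}" using cont by (intro open_Collect_less)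
    have "ball z r \<inter> {x. q x < \<gamma> (p x)} \<inter> \<Omega> = {}" using in\<Omega> by force
    then have "ball z r \<inter> {x. q x < \<gamma> (p x)} \<inter> closure \<Omega> = {}"
      using open_Int_closure_eq_empty[OF open_Int[OF open_ball op]] by blast
    with that show ?thesis by blast
  qed
  have above: "x \<in> closure \<Omega>" if "x \<in> ball z r" "\<gamma> (p x) \<le> q x" for x
    unfolding closure_approachable
  proof (intro allI impI)
    fix \<epsilon> :: real assume "\<epsilon> > 0"
    define t where "t = min (\<epsilon> / 2) ((r - dist z x) / 2)"
    have t: "t > 0" "t < \<epsilon>" "t < r - dist z x" using \<open>\<epsilon> > 0\<close> that by (auto simp: t_def min_def field_simps)
    have d: "dist (x + t *\<^sub>R e) x = t" using t by (simp add: dist_norm e)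
    have "dist z (x + t *\<^sub>R e) \<le> dist z x + dist (x + t *\<^sub>R e) x" by (metis dist_commute dist_triangle)
    then have "x + t *\<^sub>R e \<in> ball z r" using d t by simp
    then have "x + t *\<^sub>R e \<in> \<Omega>" using in\<Omega> t that by (simp add: pq_add e)
    then show "\<exists>y\<in>\<Omega>. dist y x < \<epsilon>" using d t by (intro bexI[of _ "x + t *\<^sub>R e"]) auto
  qed
  have zr: "z \<in> ball z r" using \<open>r > 0\<close> by simp
  have "z \<in> closure \<Omega>" "z \<notin> \<Omega>" using z \<open>open \<Omega>\<close> by (auto simp: frontier_def interior_open)
  then have qz: "q z = \<gamma> (p z)" using below[OF zr] in\<Omega>[OF zr] by force
  \<comment> \<open>With h = 2 (K + 1) s below, s + h = (2 K + 3) s < r, so a region of half-width s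
    and depth h stays in the ball around z.\<close>
  define s where "s = r / (2 * K + 4)"
  have s: "s > 0" "s * (2 * K + 4) = r" using \<open>r > 0\<close> \<open>K \<ge> 0\<close> by (auto simp: s_def)
  have "K * s \<ge> 0" using s \<open>K \<ge> 0\<close> by simp
  then have sr: "4 * s \<le> r" using s by (simp add: algebra_simps)
  define h where "h = 2 * (K + 1) * s"
  have sh: "s + h < r" "2 * s \<le> h" "K * s < h" "(K + 1) * s < h"
    using s \<open>K * s \<ge> 0\<close> by (auto simp: h_def algebra_simps)
  \<comment> \<open>The part below the graph over an interval of half-width s, truncated at a depth
    h that exceeds the maximal variation K s of the graph by enough to contain a horizontal
    slice.\<close>
  define C where "C = {x. \<bar>p x - p z\<bar> < s \<and> q z - h < q x \<and> q x < \<gamma> (p x)}"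
  have \<gamma>near: "\<gamma> (p x) \<le> q z + K * s" "q z - K * s \<le> \<gamma> (p x)" if "\<bar>p x - p z\<bar> < s" for x
  proof -
    have "K * \<bar>p x - p z\<bar> \<le> K * s" using that \<open>K \<ge> 0\<close> by (intro mult_left_mono) auto
    then show "\<gamma> (p x) \<le> q z + K * s" "q z - K * s \<le> \<gamma> (p x)"
      using \<gamma>_le[of "p x" "p z"] \<gamma>_le[of "p z" "p x"] by (auto simp: qz abs_minus_commute)
  qed
  have Cball: "x \<in> ball z r" if "x \<in> C" for x
  proof -
    have "\<bar>q x - q z\<bar> < h" using that \<gamma>near(1)[of x] sh by (auto simp: C_def)
    moreover have "\<bar>p x - p z\<bar> < s" using that by (simp add: C_def)
    ultimately have "norm (x - z) < s + h" using norm_le[of "x - z"] by (simp add: pq_add)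
    then show ?thesis using sh by (simp add: dist_norm norm_minus_commute)
  qed
  have CE: "C \<subseteq> - closure \<Omega>" using below Cball by (auto simp: C_def)
  have EC: "ball z s \<inter> - closure \<Omega> \<subseteq> C"
  proof
    fix x assume x: "x \<in> ball z s \<inter> - closure \<Omega>"
    then have n: "norm (x - z) < s" by (simp add: dist_norm norm_minus_commute)
    then have "\<bar>p x - p z\<bar> < s" "\<bar>q x - q z\<bar> < s" using pq_le[of "x - z"] by (auto simp: pq_add)
    moreover have "x \<in> ball z r" using x sr s by auto
    then have "q x < \<gamma> (p x)" using above x by force
    ultimately show "x \<in> C" using sh s by (auto simp: C_def)
  qed
  have "connected C"
  proof -
    \<comment> \<open>A level below all graph values over the interval, by the Lipschitz bound, and
      above the bottom of C. The slice H at this level is convex.\<close>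
    define l where "l = q z - (K + 1) * s"
    define H where "H = {x. \<bar>p x - p z\<bar> < s \<and> q x = l}"
    have HC: "H \<subseteq> C"
    proof
      fix x assume "x \<in> H"
      then show "x \<in> C" using \<gamma>near(2)[of x] sh s by (auto simp: H_def C_def l_def algebra_simps)
    qed
    have "convex H"
    proof (rule convexI)
      fix x y and u v :: real assume "x \<in> H" "y \<in> H" and uv: "0 \<le> u" "0 \<le> v" "u + v = 1"
      then have xy: "\<bar>p x - p z\<bar> < s" "\<bar>p y - p z\<bar> < s" "q x = l" "q y = l" by (auto simp: H_def)
      have "v = 1 - u" using uv(3) by simp
      then have "u * p x + v * p y - p z = u * (p x - p z) + v * (p y - p z)"
        by (simp only:) (simp add: algebra_simps)
      moreover have "\<bar>u * (p x - p z) + v * (p y - p z)\<bar> < s"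
        using convex_bound_lt[of "\<bar>p x - p z\<bar>" s "\<bar>p y - p z\<bar>" u v] xy uv
          abs_triangle_ineq[of "u * (p x - p z)" "v * (p y - p z)"] by (simp add: abs_mult)
      moreover have "u * a + v * a = a" for a using uv(3) by (metis distrib_right mult_1)
      ultimately show "u *\<^sub>R x + v *\<^sub>R y \<in> H" using xy by (simp add: H_def pq_add)
    qed
    \<comment> \<open>Every point of C is joined to H by a vertical segment inside C; the connected
      pieces S x all contain H, so their union C is connected.\<close>
    define S where "S x = closed_segment x (x + (l - q x) *\<^sub>R e) \<union> H" for x
    have SC: "S x \<subseteq> C" if "x \<in> C" for x
    proof -
      have "w \<in> C" if w: "w \<in> closed_segment x (x + (l - q x) *\<^sub>R e)" for w
      proof -
        obtain t where t: "0 \<le> t" "t \<le> 1" "w = (1 - t) *\<^sub>R x + t *\<^sub>R (x + (l - q x) *\<^sub>R e)"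
          using w by (auto simp: closed_segment_def)
        have pw: "p w = p x" and qw: "q w = (1 - t) * q x + t * l"
          by (simp_all add: t(3) pq_add e) (simp_all add: algebra_simps)
        have xC: "\<bar>p x - p z\<bar> < s" "q z - h < q x" "q x < \<gamma> (p x)" using \<open>x \<in> C\<close> by (auto simp: C_def)
        have lC: "q z - h < l" "l < \<gamma> (p x)"
          using \<gamma>near(2)[OF xC(1)] sh s by (auto simp: l_def algebra_simps)
        have "(1 - t) * q x + t * l < \<gamma> (p x)"
          using convex_bound_lt[OF xC(3) lC(2), of "1 - t" t] t by simp
        moreover have "(1 - t) * (- q x) + t * (- l) < - (q z - h)"
          using convex_bound_lt[of "- q x" "- (q z - h)" "- l" "1 - t" t] xC lC t by simp
        then have "q z - h < (1 - t) * q x + t * l" by (simp add: algebra_simps)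
        ultimately show "w \<in> C" using xC by (simp add: C_def pw qw)
      qed
      then show ?thesis using HC by (auto simp: S_def)
    qed
    have top: "x + (l - q x) *\<^sub>R e \<in> H" if "x \<in> C" for x
      using that by (simp add: H_def C_def pq_add e)
    have conS: "connected (S x)" if "x \<in> C" for x
      unfolding S_def
    proof (rule connected_Un)
      show "closed_segment x (x + (l - q x) *\<^sub>R e) \<inter> H \<noteq> {}" using top[OF that] by auto
    qed (use \<open>convex H\<close> in \<open>auto intro: convex_connected\<close>)
    have "z + (l - q z) *\<^sub>R e \<in> H" using s by (simp add: H_def pq_add e)
    then have "\<Inter>(S ` C) \<noteq> {}" by (auto simp: S_def)
    then have "connected (\<Union>(S ` C))" using conS by (intro connected_Union) auto
    moreover have "\<Union>(S ` C) = C" using SC by (auto simp: S_def)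
    ultimately show ?thesis by simp
  qed
  have zE: "z \<in> closure (- closure \<Omega>)"
    unfolding closure_approachable
  proof (intro allI impI)
    fix \<epsilon> :: real assume "\<epsilon> > 0"
    define t where "t = min (\<epsilon> / 2) (r / 2)"
    have t: "t > 0" "t < \<epsilon>" "t < r" using \<open>\<epsilon> > 0\<close> \<open>r > 0\<close> by (auto simp: t_def)
    have "z - t *\<^sub>R e \<notin> closure \<Omega>"
      using t qz by (intro below) (auto simp: dist_norm pq_add e)
    then show "\<exists>y\<in>- closure \<Omega>. dist y z < \<epsilon>"
      using t by (intro bexI[of _ "z - t *\<^sub>R e"]) (auto simp: dist_norm e)
  qed
  have push: "\<exists>a \<delta>. \<delta> > 0 \<and> norm a + \<delta> < \<epsilon> \<and> (\<forall>k\<in>closure \<Omega> \<inter> cball z s. \<forall>y\<in>cball a \<delta>. k + y \<in> \<Omega>)"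
    if "\<epsilon> > 0" for \<epsilon>
  proof -
    define t where "t = min (\<epsilon> / 2) (r / 8)"
    have t: "t > 0" "t \<le> \<epsilon> / 2" "t \<le> r / 8" using \<open>\<epsilon> > 0\<close> \<open>r > 0\<close> by (auto simp: t_def)
    \<comment> \<open>An error \<delta> in the displacement t e can raise the graph by K \<delta>
      and lower the height by \<delta>; the total (1 + K) \<delta> is t / 2, less than the gain
      t.\<close>
    define \<delta> where "\<delta> = t / (2 * (1 + K))"
    have \<delta>: "\<delta> > 0" "(1 + K) * \<delta> = t / 2" using t \<open>K \<ge> 0\<close> by (auto simp: \<delta>_def field_simps)
    have "K * \<delta> \<ge> 0" using \<delta>(1) \<open>K \<ge> 0\<close> by simp
    then have "\<delta> \<le> t / 2" using \<delta> by (simp add: algebra_simps)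
    have "k + y \<in> \<Omega>" if k: "k \<in> closure \<Omega>" "k \<in> cball z s" and y: "y \<in> cball (t *\<^sub>R e) \<delta>" for k y
    proof -
      have ny: "norm (y - t *\<^sub>R e) \<le> \<delta>" using y by (simp add: dist_norm norm_minus_commute)
      then have py: "\<bar>p y\<bar> \<le> \<delta>" "q y \<ge> t - \<delta>"
        using pq_le[of "y - t *\<^sub>R e"] by (auto simp: pq_add e)
      have kr: "k \<in> ball z r" using k(2) sr s by auto
      have "norm y \<le> norm (y - t *\<^sub>R e) + norm (t *\<^sub>R e)"
        by (metis diff_add_cancel norm_triangle_ineq)
      then have "norm y \<le> \<delta> + t" using ny t by (simp add: e)
      moreover have "dist z (k + y) \<le> dist z k + norm y"
        using dist_triangle[of z "k + y" k] by (simp add: dist_norm)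
      ultimately have "dist z (k + y) < r"
        using k(2) sr t \<open>\<delta> \<le> t / 2\<close> \<open>r > 0\<close> by simp
      moreover have "\<gamma> (p k) \<le> q k" using below[OF kr] k(1) by force
      then have "\<gamma> (p (k + y)) < q (k + y)"
        using \<gamma>_le[of "p k + p y" "p k"] mult_left_mono[OF py(1) \<open>K \<ge> 0\<close>] py(2) \<delta> t
        by (simp add: pq_add algebra_simps)
      ultimately show ?thesis using in\<Omega>[of "k + y"] by simp
    qed
    moreover have "norm (t *\<^sub>R e) + \<delta> < \<epsilon>" using t \<open>\<delta> \<le> t / 2\<close> by (simp add: e)
    ultimately show ?thesis using \<delta>(1) by (intro exI[of _ "t *\<^sub>R e"] exI[of _ \<delta>]) auto
  qed
  show ?thesis by (rule that[OF s(1) \<open>connected C\<close> EC CE zE push])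
qed

subsection \<open>Membership in the closure of the test functions\<close>

text \<open>The weak identity is applied to the reflected kernel centred at x; the sign produced by
  the reflection cancels the minus sign of integration by parts.\<close>

lemma conv_partial_deriv_weak:
  assumes "\<rho> \<in> test_fun UNIV"
    and weak: "\<And>\<phi>. \<phi> \<in> test_fun UNIV \<Longrightarrow> (\<integral>x. v x * partial_deriv i \<phi> x \<partial>lborel) = - (\<integral>x. g x * \<phi> x \<partial>lborel)"
  shows "conv (partial_deriv i \<rho>) v x = conv \<rho> g x"
proof -
  have "(\<lambda>y. \<rho> (x + (- 1) *\<^sub>R y)) \<in> test_fun UNIV" by (rule test_fun_affine[OF assms(1)]) simp
  from weak[OF this] show ?thesis
    unfolding partial_deriv_affine[OF smooth_differentiable[OF test_fun_smooth[OF assms(1)]]] conv_def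
    by (simp add: mult.commute)
qed

text \<open>The indicator of the ball of radius 2 s / 3, mollified with width s / 3, is still 1 on
  the ball of radius s / 3 and vanishes outside radius s.\<close>

lemma cutoff_exists:
  fixes z :: plane
  assumes "s > 0"
  obtains b where "b \<in> test_fun UNIV" "\<And>x. x \<in> ball z (s / 3) \<Longrightarrow> b x = 1" "\<And>x. b x \<noteq> 0 \<Longrightarrow> x \<in> ball z s"
proof -
  obtain \<rho> where \<rho>: "mollifier 0 (s / 3) \<rho>" using mollifier_exists[of "s / 3" 0] assms by auto
  have test: "\<rho> \<in> test_fun UNIV" and supp: "\<rho> x \<noteq> 0 \<Longrightarrow> norm x < s / 3" for x
    using \<rho> by (auto simp: mollifier_def)
  define I where "I = (indicator (ball z (2 * s / 3)) :: plane \<Rightarrow> real)"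
  have int: "integrable lborel I"
    using emeasure_bounded_finite[OF bounded_ball[of z "2 * s / 3"]] by (simp add: I_def integrable_indicator_iff)
  have S: "x \<in> ball z s" if "conv \<rho> I x \<noteq> 0" for x
  proof (rule ccontr)
    assume far: "x \<notin> ball z s"
    have "conv \<rho> I x = 0"
    proof (rule conv_eq_0[where S = "ball 0 (s / 3)" and K = "ball z (2 * s / 3)"])
      show "AE y in lborel. y \<notin> ball z (2 * s / 3) \<longrightarrow> I y = 0" by (simp add: I_def indicator_def)
      show "x - y \<notin> ball 0 (s / 3)" if "y \<in> ball z (2 * s / 3)" for y
        using far that dist_triangle[of z x y] by (auto simp: dist_norm norm_minus_commute)
    qed (use supp in auto)
    with that show False by simp
  qed
  show ?thesis
  proof (rule that[of "conv \<rho> I"])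
    show "conv \<rho> I \<in> test_fun UNIV"
      by (rule test_funI[of _ "cball z s"]) (use S smooth_conv[OF test int] in \<open>auto intro: less_imp_le\<close>)
    show "conv \<rho> I x = 1" if "x \<in> ball z (s / 3)" for x
    proof -
      have "conv \<rho> I x = conv \<rho> (\<lambda>y. 1) x"
        unfolding conv_def
      proof (rule Bochner_Integration.integral_cong[OF refl])
        fix y
        show "\<rho> (x - y) * I y = \<rho> (x - y) * 1"
        proof (cases "\<rho> (x - y) = 0")
          case False
          then have "dist x y < s / 3" using supp by (simp add: dist_norm)
          then have "y \<in> ball z (2 * s / 3)" using that dist_triangle[of z y x] by simp
          then show ?thesis by (simp add: I_def)
        qed simp
      qed
      then show ?thesis using conv_const[OF \<rho>] by simp
    qed
  qed (rule S)
qed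

context bounded_open_set
begin

lemma sq_int_L2:
  assumes "sq_int f"
  shows "L2 \<Omega> f" "(L2norm \<Omega> f)\<^sup>2 \<le> (\<integral>x. (f x)\<^sup>2 \<partial>lborel)"
proof -
  have m: "f \<in> borel_measurable borel" "(\<lambda>x. (f x)\<^sup>2) \<in> borel_measurable borel"
    and i: "integrable lborel (\<lambda>x. (f x)\<^sup>2)"
    using assms by (auto simp: sq_int_def)
  have i': "integrable lborel (\<lambda>x. indicator \<Omega> x * (f x)\<^sup>2)"
    using integrable_mult_indicator[of \<Omega> lborel "\<lambda>x. (f x)\<^sup>2"] borel i by simp
  then show "L2 \<Omega> f"
    using integrable_lebesgue_on_iff[OF borel m(2)] borel_measurable_lebesgue_on[OF m(1)] by (simp add: L2_def)
  have "(L2norm \<Omega> f)\<^sup>2 = (\<integral>x. indicator \<Omega> x * (f x)\<^sup>2 \<partial>lborel)"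
    using integral_lebesgue_on[OF borel m(2)] by (simp add: L2norm_square)
  also have "\<dots> \<le> (\<integral>x. (f x)\<^sup>2 \<partial>lborel)"
    using i i' by (intro integral_mono) (auto simp: indicator_def)
  finally show "(L2norm \<Omega> f)\<^sup>2 \<le> (\<integral>x. (f x)\<^sup>2 \<partial>lborel)" .
qed

lemma L2_vec:
  assumes "\<And>i. L2 \<Omega> (G i)"
  shows "L2 \<Omega> (\<lambda>x. (\<chi> i. G i x) :: plane)"
proof -
  have "L2 \<Omega> (\<lambda>x. G i x *\<^sub>R (axis i 1 :: plane))" for i
  proof (rule L2_bound[OF assms[of i], where K = 1])
    show "(\<lambda>x. G i x *\<^sub>R (axis i 1 :: plane)) \<in> borel_measurable (lebesgue_on \<Omega>)"
      by (rule borel_measurable_scaleR[OF L2_measurable[OF assms] borel_measurable_const])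
  qed simp
  then have "L2 \<Omega> (\<lambda>x. G 1 x *\<^sub>R (axis 1 1 :: plane) + G 2 x *\<^sub>R axis 2 1)" by (intro L2_add)
  moreover have "(\<lambda>x. G 1 x *\<^sub>R (axis 1 1 :: plane) + G 2 x *\<^sub>R axis 2 1) = (\<lambda>x. \<chi> i. G i x)"
    by (auto simp: fun_eq_iff vec_eq_iff forall_2 axis_def)
  ultimately show ?thesis by simp
qed

text \<open>Convolution with mollifiers centred at the displacements \<open>a\<close> produces test functions.\<close>

lemma H10_of_pushable:
  assumes v: "sq_int v" "\<And>x. x \<notin> ball 0 R \<Longrightarrow> v x = 0"
    and G: "\<And>i. sq_int (G i)" "\<And>i x. x \<notin> ball 0 R \<Longrightarrow> G i x = 0"
    and weak: "\<And>\<phi> i. \<phi> \<in> test_fun UNIV \<Longrightarrow> (\<integral>x. v x * partial_deriv i \<phi> x \<partial>lborel) = - (\<integral>x. G i x * \<phi> x \<partial>lborel)"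
    and K: "compact K" "AE y in lborel. y \<notin> K \<longrightarrow> v y = 0"
    and push: "\<And>\<epsilon>. \<epsilon> > 0 \<Longrightarrow> \<exists>a \<delta>. \<delta> > 0 \<and> norm a + \<delta> < \<epsilon> \<and> (\<forall>k\<in>K. \<forall>y\<in>cball a \<delta>. k + y \<in> \<Omega>)"
  shows "v \<in> H10 \<Omega>"
proof -
  have vm: "v \<in> borel_measurable borel" and Gm: "G i \<in> borel_measurable borel" for i
    using v(1) G(1) by (auto simp: sq_int_def)
  have vint: "integrable lborel v" by (rule sq_int_integrable[OF v])
  have Gint: "integrable lborel (G i)" for i by (rule sq_int_integrable[OF G])
  define g where "g x = (\<chi> i. G i x)" for x
  have Lg: "L2 \<Omega> g" unfolding g_def using G(1) by (intro L2_vec sq_int_L2)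
  have wg: "weak_gradient \<Omega> v g" unfolding g_def by (rule weak_gradient_of_plane[OF borel vm Gm weak])
  have vH1: "v \<in> H1 \<Omega>" by (rule H1I[OF sq_int_L2(1)[OF v(1)] Lg wg])
  have "\<forall>n. \<exists>a \<delta>. \<delta> > 0 \<and> norm a + \<delta> < 1 / real (Suc n) \<and> (\<forall>k\<in>K. \<forall>y\<in>cball a \<delta>. k + y \<in> \<Omega>)"
    using push by simp
  from choice[OF this] obtain a where
    "\<forall>n. \<exists>\<delta>. \<delta> > 0 \<and> norm (a n) + \<delta> < 1 / real (Suc n) \<and> (\<forall>k\<in>K. \<forall>y\<in>cball (a n) \<delta>. k + y \<in> \<Omega>)" by blast
  from choice[OF this] obtain \<delta> where
    a\<delta>: "\<And>n. \<delta> n > 0" "\<And>n. norm (a n) + \<delta> n < 1 / real (Suc n)" "\<And>n k y. k \<in> K \<Longrightarrow> y \<in> cball (a n) (\<delta> n) \<Longrightarrow> k + y \<in> \<Omega>"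
    by blast
  have lim: "(\<lambda>n. norm (a n) + \<delta> n) \<longlonglongrightarrow> 0"
  proof (rule LIMSEQ_0_le)
    show "(\<lambda>n. 1 / real (Suc n)) \<longlonglongrightarrow> 0" using LIMSEQ_inverse_real_of_nat by (simp add: inverse_eq_divide)
    show "0 \<le> norm (a n) + \<delta> n" for n using a\<delta>(1)[of n] by (simp add: add_nonneg_nonneg less_imp_le)
    show "norm (a n) + \<delta> n \<le> 1 / real (Suc n)" for n using a\<delta>(2)[of n] by simp
  qed
  have "\<forall>n. \<exists>\<rho>. mollifier (a n) (\<delta> n) \<rho>" using mollifier_exists[OF a\<delta>(1)] by metis
  then obtain \<rho> where \<rho>: "\<And>n. mollifier (a n) (\<delta> n) (\<rho> n)" by metis
  have test: "\<rho> n \<in> test_fun UNIV" and supp: "\<rho> n y \<noteq> 0 \<Longrightarrow> y \<in> ball (a n) (\<delta> n)" for n y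
    using \<rho>[of n] by (auto simp: mollifier_def)
  define w where "w n = conv (\<rho> n) v" for n
  have sm: "smooth (w n)" for n unfolding w_def by (rule smooth_conv[OF test vint])
  have wtest: "w n \<in> test_fun \<Omega>" for n
  proof (rule test_funI[OF sm])
    \<comment> \<open>The kernel is supported near the displacement a n, so smoothing moves K into
      this compact sum, which \<open>push\<close> places inside \<Omega>.\<close>
    let ?S = "{x + y | x y. x \<in> K \<and> y \<in> cball (a n) (\<delta> n)}"
    show "compact ?S" by (rule compact_sums[OF K(1) compact_cball])
    show "?S \<subseteq> \<Omega>" using a\<delta>(3) by blast
    show "x \<in> ?S" if "w n x \<noteq> 0" for x
    proof (rule ccontr)
      assume nS: "x \<notin> ?S"
      have "conv (\<rho> n) v x = 0"
      proof (rule conv_eq_0[OF supp K(2)])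
        fix k assume "k \<in> K"
        show "x - k \<notin> ball (a n) (\<delta> n)"
        proof
          assume "x - k \<in> ball (a n) (\<delta> n)"
          then have "x - k \<in> cball (a n) (\<delta> n)" by auto
          moreover have "x = k + (x - k)" by simp
          ultimately show False using nS \<open>k \<in> K\<close> by blast
        qed
      qed
      with that show False by (simp add: w_def)
    qed
  qed
  have cg: "classical_grad (w n) x $ i = conv (\<rho> n) (G i) x" for n x i
    by (simp add: classical_grad_def w_def partial_deriv_conv[OF test vint] conv_partial_deriv_weak[OF test weak])
  have L2lim: "(\<lambda>n. L2norm \<Omega> (\<lambda>x. conv (\<rho> n) f x - f x)) \<longlonglongrightarrow> 0"
    if f: "sq_int f" "\<And>x. x \<notin> ball 0 R \<Longrightarrow> f x = 0" for f
  proof -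
    have fint: "integrable lborel f" by (rule sq_int_integrable[OF f])
    have "(\<lambda>n. sqrt (\<integral>x. (conv (\<rho> n) f x - f x)\<^sup>2 \<partial>lborel)) \<longlonglongrightarrow> sqrt 0"
      by (intro tendsto_real_sqrt mollify_tendsto[OF f \<rho> a\<delta>(1) lim])
    then have l: "(\<lambda>n. sqrt (\<integral>x. (conv (\<rho> n) f x - f x)\<^sup>2 \<partial>lborel)) \<longlonglongrightarrow> 0" by simp
    show ?thesis
      by (rule LIMSEQ_0_le[OF l]) (auto intro: L2norm_nonneg real_le_rsqrt sq_int_L2(2)[OF sq_int_conv_diff[OF \<rho> f(1) fint]])
  qed
  have "H1_conv \<Omega> w v"
    unfolding H1_conv_iff
  proof
    show "(\<lambda>n. L2norm \<Omega> (\<lambda>x. w n x - v x)) \<longlonglongrightarrow> 0" unfolding w_def by (rule L2lim[OF v])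
    have "(\<lambda>n. L2norm \<Omega> (\<lambda>x. conv (\<rho> n) (G 1) x - G 1 x) + L2norm \<Omega> (\<lambda>x. conv (\<rho> n) (G 2) x - G 2 x)) \<longlonglongrightarrow> 0"
      by (intro tendsto_add_zero L2lim G)
    then show "(\<lambda>n. grad_norm (\<lambda>x. w n x - v x)) \<longlonglongrightarrow> 0"
    proof (rule LIMSEQ_0_le)
      fix n
      define d where "d i x = conv (\<rho> n) (G i) x - G i x" for i x
      have Ld: "L2 \<Omega> (d i)" for i unfolding d_def by (rule sq_int_L2(1)[OF sq_int_conv_diff[OF \<rho> G(1) Gint]])
      have "AE x in lebesgue_on \<Omega>. grad \<Omega> (\<lambda>x. w n x - v x) x = (\<chi> i. d i x)"
        using grad_diff[OF smooth_H1[OF sm[of n]] vH1] grad_smooth[OF sm[of n]] grad_eq[OF sq_int_L2(1)[OF v(1)] Lg wg]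
        by eventually_elim (simp add: vec_eq_iff cg g_def d_def)
      then have "grad_norm (\<lambda>x. w n x - v x) = L2norm \<Omega> (\<lambda>x. (\<chi> i. d i x) :: plane)"
        by (rule L2norm_cong[OF _ grad_L2[OF H1_diff[OF smooth_H1[OF sm] vH1]] L2_vec[OF Ld]])
      also have "(\<lambda>x. (\<chi> i. d i x) :: plane) = (\<lambda>x. d 1 x *\<^sub>R axis 1 1 + d 2 x *\<^sub>R axis 2 1)"
        by (auto simp: fun_eq_iff vec_eq_iff forall_2 axis_def)
      also have "L2norm \<Omega> \<dots> \<le> L2norm \<Omega> (\<lambda>x. d 1 x *\<^sub>R (axis 1 1 :: plane)) + L2norm \<Omega> (\<lambda>x. d 2 x *\<^sub>R (axis 2 1 :: plane))"
      proof (rule L2norm_add_le)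
        have "L2 \<Omega> (\<lambda>x. d i x *\<^sub>R (axis j 1 :: plane))" for i j
        proof (rule L2_bound[OF Ld[of i], where K = 1])
          show "(\<lambda>x. d i x *\<^sub>R (axis j 1 :: plane)) \<in> borel_measurable (lebesgue_on \<Omega>)"
            by (rule borel_measurable_scaleR[OF L2_measurable[OF Ld] borel_measurable_const])
        qed simp
        then show "L2 \<Omega> (\<lambda>x. d 1 x *\<^sub>R (axis 1 1 :: plane))" "L2 \<Omega> (\<lambda>x. d 2 x *\<^sub>R (axis 2 1 :: plane))" by auto
      qed
      also have "\<dots> = L2norm \<Omega> (d 1) + L2norm \<Omega> (d 2)" by (simp add: L2norm_def)
      finally show "grad_norm (\<lambda>x. w n x - v x) \<le> L2norm \<Omega> (\<lambda>x. conv (\<rho> n) (G 1) x - G 1 x) + L2norm \<Omega> (\<lambda>x. conv (\<rho> n) (G 2) x - G 2 x)"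
        by (simp add: d_def[abs_def])
    qed (rule L2norm_nonneg)
  qed
  then show ?thesis using H10I[OF vH1] wtest by blast
qed

end

section \<open>Localisation by smooth cut-offs\<close>

lemma test_fun_in_ball:
  assumes "f \<in> test_fun \<Omega>"
  obtains M where "M > 0" "\<And>x. x \<notin> ball 0 M \<Longrightarrow> f x = 0" "\<And>x i. x \<notin> ball 0 M \<Longrightarrow> partial_deriv i f x = 0"
proof -
  obtain K where K: "smooth f" "compact K" "\<And>x. f x \<noteq> 0 \<Longrightarrow> x \<in> K"
    using assms by (rule test_funE) (rule that)
  obtain M where M: "M > 0" "\<And>x. x \<in> K \<Longrightarrow> norm x < M"
    using bounded_pos_less compact_imp_bounded[OF K(2)] by metis
  have "f \<in> test_fun (ball 0 M)"
    by (rule test_funI[OF K(1,2)]) (use K M in auto)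
  note * = test_funE[OF this] test_funE[OF test_fun_partial_deriv[OF this]]
  show ?thesis using that[OF M(1)] * by metis
qed

lemma integrable_local_mult_test:
  assumes \<psi>: "\<And>M. sq_int (\<lambda>x. indicator (ball 0 M) x * \<psi> x)" and b: "b \<in> test_fun UNIV"
  shows "integrable lborel (\<lambda>x. \<psi> x * b x)"
proof -
  obtain M where M: "\<And>x. x \<notin> ball 0 M \<Longrightarrow> b x = 0" using test_fun_in_ball[OF b] by metis
  have "integrable lborel (\<lambda>x. (indicator (ball 0 M) x * \<psi> x) * b x)"
  proof (rule integrable_mult_square)
    show "b \<in> borel_measurable lborel" using test_fun_borel[OF b] by simp
    have "(\<lambda>x. b x * b x) \<in> test_fun UNIV" by (rule test_fun_mult[OF test_fun_smooth[OF b] b])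
    from integrable_test_fun[OF this] show "integrable lborel (\<lambda>x. (b x)\<^sup>2)" by (simp add: power2_eq_square)
  qed (use \<psi>[of M] in \<open>auto simp: sq_int_def\<close>)
  moreover have "(indicator (ball 0 M) x * \<psi> x) * b x = \<psi> x * b x" for x
    using M[of x] by (cases "x \<in> ball 0 M") simp_all
  ultimately show ?thesis by simp
qed

lemma sq_int_test_fun_mult:
  assumes \<psi>: "\<psi> \<in> borel_measurable borel" "\<And>M. sq_int (\<lambda>x. indicator (ball 0 M) x * \<psi> x)" and b: "b \<in> test_fun UNIV"
  shows "sq_int (\<lambda>x. b x * \<psi> x)"
proof -
  obtain M where M: "\<And>x. x \<notin> ball 0 M \<Longrightarrow> b x = 0" using test_fun_in_ball[OF b] by metis
  obtain B where B: "\<And>x. \<bar>b x\<bar> \<le> B" using test_fun_bounded[OF b] by metis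
  show ?thesis
  proof (rule sq_int_bound[OF \<psi>(2)[of M], where M = B])
    show "(\<lambda>x. b x * \<psi> x) \<in> borel_measurable borel"
      by (rule borel_measurable_times[OF test_fun_borel[OF b] \<psi>(1)])
    show "\<bar>b x * \<psi> x\<bar> \<le> B * \<bar>indicator (ball 0 M) x * \<psi> x\<bar>" for x
      using M[of x] B[of x] by (cases "x \<in> ball 0 M") (simp_all add: abs_mult mult_right_mono)
  qed
qed

lemma sq_int_test_fun: "b \<in> test_fun UNIV \<Longrightarrow> sq_int b"
  using integrable_test_fun[OF test_fun_mult[OF test_fun_smooth]] test_fun_borel
  by (simp add: sq_int_def power2_eq_square)

text \<open>The weak product rule: \<kappa> \<phi> is itself a test function for \<psi>, and the
  constant c is accounted for by the vanishing integral of the derivative of \<kappa>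
  \<phi>.\<close>

lemma weak_gradient_cutoff:
  assumes \<psi>: "\<psi> \<in> borel_measurable borel" "\<And>M. sq_int (\<lambda>x. indicator (ball 0 M) x * \<psi> x)"
    and g: "sq_int g"
    and weak: "\<And>\<phi>. \<phi> \<in> test_fun UNIV \<Longrightarrow> (\<integral>x. \<psi> x * partial_deriv i \<phi> x \<partial>lborel) = - (\<integral>x. g x * \<phi> x \<partial>lborel)"
    and \<kappa>: "\<kappa> \<in> test_fun UNIV" and \<phi>: "\<phi> \<in> test_fun UNIV"
  shows "(\<integral>x. (\<kappa> x * (\<psi> x - c)) * partial_deriv i \<phi> x \<partial>lborel)
    = - (\<integral>x. (\<kappa> x * g x + partial_deriv i \<kappa> x * (\<psi> x - c)) * \<phi> x \<partial>lborel)"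
proof -
  have s: "smooth \<kappa>" "smooth \<phi>" "smooth (partial_deriv i \<kappa>)" using \<kappa> \<phi> test_fun_smooth smooth_partial_deriv by auto
  have t1: "(\<lambda>x. \<kappa> x * \<phi> x) \<in> test_fun UNIV" by (rule test_fun_mult[OF s(1) \<phi>])
  have t2: "(\<lambda>x. \<kappa> x * partial_deriv i \<phi> x) \<in> test_fun UNIV" by (rule test_fun_mult[OF s(1) test_fun_partial_deriv[OF \<phi>]])
  have t3: "(\<lambda>x. partial_deriv i \<kappa> x * \<phi> x) \<in> test_fun UNIV" by (rule test_fun_mult[OF s(3) \<phi>])
  have pd: "partial_deriv i (\<lambda>x. \<kappa> x * \<phi> x) = (\<lambda>x. \<kappa> x * partial_deriv i \<phi> x + partial_deriv i \<kappa> x * \<phi> x)"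
    by (rule partial_deriv_mult[OF smooth_differentiable smooth_differentiable]) (rule s)+
  have gl: "sq_int (\<lambda>x. indicator (ball 0 M) x * g x)" for M
  proof (rule sq_int_bound[OF g, where M = 1])
    show "(\<lambda>x. indicator (ball 0 M) x * g x) \<in> borel_measurable borel"
      using g by (intro borel_measurable_times borel_measurable_indicator) (auto simp: sq_int_def)
  qed (auto simp: indicator_def)
  note i = integrable_local_mult_test[OF \<psi>(2) t2] integrable_local_mult_test[OF \<psi>(2) t3]
    integrable_local_mult_test[OF gl t1] integrable_test_fun[OF t2] integrable_test_fun[OF t3]
  have "(\<integral>x. \<psi> x * (\<kappa> x * partial_deriv i \<phi> x) + \<psi> x * (partial_deriv i \<kappa> x * \<phi> x) \<partial>lborel) = - (\<integral>x. g x * (\<kappa> x * \<phi> x) \<partial>lborel)"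
    using weak[OF t1] unfolding pd by (simp add: distrib_left)
  then have e1: "(\<integral>x. \<psi> x * (\<kappa> x * partial_deriv i \<phi> x) \<partial>lborel)
      = - (\<integral>x. g x * (\<kappa> x * \<phi> x) \<partial>lborel) - (\<integral>x. \<psi> x * (partial_deriv i \<kappa> x * \<phi> x) \<partial>lborel)"
    using i by simp
  have "(\<integral>x. \<kappa> x * partial_deriv i \<phi> x + partial_deriv i \<kappa> x * \<phi> x \<partial>lborel) = 0"
    using integral_partial_deriv_eq_0[OF t1, of i] unfolding pd .
  then have e2: "(\<integral>x. \<kappa> x * partial_deriv i \<phi> x \<partial>lborel) = - (\<integral>x. partial_deriv i \<kappa> x * \<phi> x \<partial>lborel)"
    using i by simp
  have "(\<integral>x. (\<kappa> x * (\<psi> x - c)) * partial_deriv i \<phi> x \<partial>lborel)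
      = (\<integral>x. \<psi> x * (\<kappa> x * partial_deriv i \<phi> x) - c * (\<kappa> x * partial_deriv i \<phi> x) \<partial>lborel)"
    by (simp add: algebra_simps)
  also have "\<dots> = (\<integral>x. \<psi> x * (\<kappa> x * partial_deriv i \<phi> x) \<partial>lborel) - c * (\<integral>x. \<kappa> x * partial_deriv i \<phi> x \<partial>lborel)"
    using i by simp
  also have "\<dots> = - ((\<integral>x. g x * (\<kappa> x * \<phi> x) \<partial>lborel)
      + (\<integral>x. \<psi> x * (partial_deriv i \<kappa> x * \<phi> x) \<partial>lborel) - c * (\<integral>x. partial_deriv i \<kappa> x * \<phi> x \<partial>lborel))"
    using e1 e2 by simp
  also have "(\<integral>x. g x * (\<kappa> x * \<phi> x) \<partial>lborel)
      + (\<integral>x. \<psi> x * (partial_deriv i \<kappa> x * \<phi> x) \<partial>lborel) - c * (\<integral>x. partial_deriv i \<kappa> x * \<phi> x \<partial>lborel)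
    = (\<integral>x. g x * (\<kappa> x * \<phi> x) + \<psi> x * (partial_deriv i \<kappa> x * \<phi> x) - c * (partial_deriv i \<kappa> x * \<phi> x) \<partial>lborel)"
    using i by simp
  also have "\<dots> = (\<integral>x. (\<kappa> x * g x + partial_deriv i \<kappa> x * (\<psi> x - c)) * \<phi> x \<partial>lborel)"
    by (simp add: algebra_simps)
  finally show ?thesis .
qed

subsection \<open>Existence of stream functions\<close>

text \<open>Turns cut-offs into a partition of unity: the product on the right vanishes wherever
  some factor b j equals 1.\<close>

lemma sum_prod_telescope:
  fixes b :: "nat \<Rightarrow> 'a::comm_ring_1"
  shows "(\<Sum>k<n. b k * (\<Prod>j<k. 1 - b j)) = 1 - (\<Prod>j<n. 1 - b j)"
  by (induction n) (simp_all add: algebra_simps)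

text \<open>The constant \<open>c\<close> is the value of the stream function off \<open>\<Omega>\<close> near \<open>z\<close>; for \<open>z\<close> inside
  \<open>\<Omega>\<close> it is arbitrary, since a small ball does not meet the complement.\<close>

lemma closure_local_data:
  fixes k :: "plane \<Rightarrow> real"
  assumes "open \<Omega>" "lipschitz_boundary \<Omega>" "z \<in> closure \<Omega>"
    and const: "\<And>C. connected C \<Longrightarrow> C \<subseteq> - closure \<Omega> \<Longrightarrow> k constant_on C"
  obtains s c where "s > 0" "\<And>y. y \<in> ball z s \<Longrightarrow> y \<notin> closure \<Omega> \<Longrightarrow> k y = c"
    "\<And>\<epsilon>. \<epsilon> > 0 \<Longrightarrow> \<exists>a \<delta>. \<delta> > 0 \<and> norm a + \<delta> < \<epsilon> \<and> (\<forall>x\<in>closure \<Omega> \<inter> cball z s. \<forall>y\<in>cball a \<delta>. x + y \<in> \<Omega>)"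
proof (cases "z \<in> \<Omega>")
  case True
  then obtain r where r: "r > 0" "cball z r \<subseteq> \<Omega>" using \<open>open \<Omega>\<close> open_contains_cball by blast
  show ?thesis
  proof (rule that[of "r / 2" 0])
    show "r / 2 > 0" using r by simp
    show "k y = 0" if "y \<in> ball z (r / 2)" "y \<notin> closure \<Omega>" for y
    proof -
      have "y \<in> cball z r" using that(1) r(1) by simp
      then have "y \<in> closure \<Omega>" using r(2) closure_subset by blast
      with that(2) show ?thesis by blast
    qed
    fix \<epsilon> :: real assume "\<epsilon> > 0"
    define \<delta> where "\<delta> = min (\<epsilon> / 2) (r / 2)"
    have \<delta>: "\<delta> > 0" "\<delta> < \<epsilon>" "\<delta> \<le> r / 2" using r \<open>\<epsilon> > 0\<close> by (auto simp: \<delta>_def)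
    have "x + y \<in> \<Omega>" if "x \<in> cball z (r / 2)" "y \<in> cball 0 \<delta>" for x y
    proof -
      have "dist z (x + y) \<le> dist z x + norm y" using dist_triangle[of z "x + y" x] by (simp add: dist_norm)
      then have "x + y \<in> cball z r" using that \<delta> by simp
      then show ?thesis using r by blast
    qed
    then show "\<exists>a \<delta>. \<delta> > 0 \<and> norm a + \<delta> < \<epsilon> \<and> (\<forall>x\<in>closure \<Omega> \<inter> cball z (r / 2). \<forall>y\<in>cball a \<delta>. x + y \<in> \<Omega>)"
      using \<delta> by (intro exI[of _ 0] exI[of _ \<delta>]) auto
  qed
next
  case False
  then have "z \<in> frontier \<Omega>" using assms(1,3) by (simp add: frontier_def interior_open)
  obtain s C where s: "s > 0" and C: "connected C" "ball z s \<inter> - closure \<Omega> \<subseteq> C" "C \<subseteq> - closure \<Omega>"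
    and push: "\<And>\<epsilon>. \<epsilon> > 0 \<Longrightarrow> \<exists>a \<delta>. \<delta> > 0 \<and> norm a + \<delta> < \<epsilon> \<and> (\<forall>x\<in>closure \<Omega> \<inter> cball z s. \<forall>y\<in>cball a \<delta>. x + y \<in> \<Omega>)"
    using lipschitz_boundary_local[OF assms(2,1) \<open>z \<in> frontier \<Omega>\<close>] by metis
  obtain c where "\<And>y. y \<in> C \<Longrightarrow> k y = c" using const[OF C(1,3)] by (auto simp: constant_on_def)
  then show ?thesis using that[OF s _ push] C(2) by blast
qed

lemma frontier_in_closure_exterior:
  assumes "open \<Omega>" "lipschitz_boundary \<Omega>" "z \<in> frontier \<Omega>"
  shows "z \<in> closure (- closure \<Omega>)"
  using lipschitz_boundary_local[OF assms(2,1,3)] by metis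

lemma exterior_boundary_subset_frontier:
  assumes "open \<Omega>"
  shows "exterior_boundary \<Omega> \<subseteq> frontier \<Omega>"
proof
  fix x assume x: "x \<in> exterior_boundary \<Omega>"
  then have "x \<in> closure \<Omega>"
    using frontier_outside_subset[of "closure \<Omega>"] by (auto simp: exterior_boundary_def)
  moreover have "x \<notin> \<Omega>"
  proof
    assume "x \<in> \<Omega>"
    have "x \<in> closure (outside (closure \<Omega>))" using x by (simp add: exterior_boundary_def frontier_def)
    moreover have "\<Omega> \<inter> outside (closure \<Omega>) = {}" using outside_no_overlap[of "closure \<Omega>"] closure_subset by blast
    then have "\<Omega> \<inter> closure (outside (closure \<Omega>)) = {}" using open_Int_closure_eq_empty[OF assms] by blast
    ultimately show False using \<open>x \<in> \<Omega>\<close> by blast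
  qed
  ultimately show "x \<in> frontier \<Omega>" using assms by (simp add: frontier_def interior_open)
qed

context bounded_open_set
begin

lemma stream_function_exists:
  assumes lip: "lipschitz_boundary \<Omega>" and u: "L2 \<Omega> u"
    and ortho: "\<And>\<phi>. \<phi> \<in> H1 \<Omega> \<Longrightarrow> (\<integral>x. u x \<bullet> grad \<Omega> \<phi> x \<partial>lebesgue_on \<Omega>) = 0"
  obtains \<psi> where "\<psi> \<in> streamfunctions \<Omega>" "AE x in lebesgue_on \<Omega>. perp_grad \<Omega> \<psi> x = u x"
proof -
  obtain R where R: "\<Omega> \<subseteq> ball 0 R" using bounded_subset_ballD[OF bd, of 0] by blast
  have "\<forall>i. \<exists>U. sq_int U \<and> (\<forall>x. x \<notin> \<Omega> \<longrightarrow> U x = 0) \<and> (AE x in lebesgue_on \<Omega>. u x $ i = U x)"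
  proof
    fix i
    have Li: "L2 \<Omega> (\<lambda>x. u x $ i)" using u by (rule L2_nth)
    obtain U where U: "U \<in> borel_measurable borel" "\<And>x. x \<notin> \<Omega> \<Longrightarrow> U x = 0" "AE x in lebesgue_on \<Omega>. u x $ i = U x"
      using borel_representative[OF borel L2_measurable[OF Li]] by metis
    have [measurable]: "U \<in> borel_measurable borel" by fact
    have "AE x in lebesgue_on \<Omega>. norm (U x) \<le> 1 * norm (u x $ i)" using U(3) by eventually_elim simp
    then have "L2 \<Omega> U" by (rule L2_bound[OF Li borel_measurable_lebesgue_on[OF U(1)]])
    then have "integrable lborel (\<lambda>x. indicator \<Omega> x * (U x)\<^sup>2)"
      using integrable_lebesgue_on_iff[OF borel, of "\<lambda>x. (U x)\<^sup>2"] by (simp add: L2_def)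
    moreover have "(\<lambda>x. indicator \<Omega> x * (U x)\<^sup>2) = (\<lambda>x. (U x)\<^sup>2)"
      using U(2) by (auto simp: indicator_def fun_eq_iff)
    ultimately have "sq_int U" using U(1) by (simp add: sq_int_def)
    then show "\<exists>U. sq_int U \<and> (\<forall>x. x \<notin> \<Omega> \<longrightarrow> U x = 0) \<and> (AE x in lebesgue_on \<Omega>. u x $ i = U x)"
      using U by blast
  qed
  from choice[OF this] obtain U where
    U: "\<And>i. sq_int (U i)" "\<And>i x. x \<notin> \<Omega> \<Longrightarrow> U i x = 0" "\<And>i. AE x in lebesgue_on \<Omega>. u x $ i = U i x"
    by blast
  have Um: "U i \<in> borel_measurable borel" for i using U(1) by (simp add: sq_int_def)
  have divfree: "(\<integral>x. U 1 x * g x $ 1 + U 2 x * g x $ 2 \<partial>lborel) = 0"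
    if g: "L2 \<Omega> \<Phi>" "L2 \<Omega> g" "weak_gradient \<Omega> \<Phi> g" "g \<in> borel_measurable borel" for \<Phi> g
  proof -
    have gi: "(\<lambda>x. g x $ i) \<in> borel_measurable borel" for i
    proof -
      have "(\<lambda>y :: plane. y $ i) \<in> borel_measurable borel"
        by (intro borel_measurable_continuous_onI continuous_intros)
      from measurable_compose[OF g(4) this] show ?thesis .
    qed
    define F where "F x = U 1 x * g x $ 1 + U 2 x * g x $ 2" for x
    have Fm: "F \<in> borel_measurable borel"
      unfolding F_def by (intro borel_measurable_add borel_measurable_times gi Um)
    have H: "\<Phi> \<in> H1 \<Omega>" using g by (intro H1I)
    have "AE x in lebesgue_on \<Omega>. u x \<bullet> grad \<Omega> \<Phi> x = F x"
      using U(3)[of 1] U(3)[of 2] grad_eq[OF g(1,2,3)]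
      by eventually_elim (simp add: F_def inner_vec_def sum_2)
    then have "(\<integral>x. u x \<bullet> grad \<Omega> \<Phi> x \<partial>lebesgue_on \<Omega>) = (\<integral>x. F x \<partial>lebesgue_on \<Omega>)"
      using L2_integrable_inner[OF u grad_L2[OF H]] borel_measurable_lebesgue_on[OF Fm]
      by (intro integral_cong_AE) auto
    also have "\<dots> = (\<integral>x. indicator \<Omega> x * F x \<partial>lborel)" by (rule integral_lebesgue_on[OF borel Fm])
    also have "\<dots> = (\<integral>x. F x \<partial>lborel)"
      using U(2) by (intro Bochner_Integration.integral_cong) (auto simp: F_def indicator_def)
    finally show ?thesis using ortho[OF H] by (simp add: F_def)
  qed
  obtain \<psi> where \<psi>: "\<psi> \<in> borel_measurable borel" "\<And>M. sq_int (\<lambda>x. indicator (ball 0 M) x * \<psi> x)"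
    and \<psi>1: "\<And>\<phi>. \<phi> \<in> test_fun UNIV \<Longrightarrow> (\<integral>x. \<psi> x * partial_deriv 1 \<phi> x \<partial>lborel) = (\<integral>x. U 2 x * \<phi> x \<partial>lborel)"
    and \<psi>2: "\<And>\<phi>. \<phi> \<in> test_fun UNIV \<Longrightarrow> (\<integral>x. \<psi> x * partial_deriv 2 \<phi> x \<partial>lborel) = - (\<integral>x. U 1 x * \<phi> x \<partial>lborel)"
    and \<psi>0: "\<And>x. x $ 2 \<le> - R \<Longrightarrow> \<psi> x = 0"
    by (rule potential_exists[OF R U(1)[of 1] U(1)[of 2] U(2) U(2) divfree]) (assumption | rule that)+
  \<comment> \<open>The gradient that \<psi> has to have: its rotation by \<open>perp_grad\<close>
    is (U 1, U 2).\<close>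
  define G where "G i x = (if i = 1 then - U 2 x else U 1 x)" for i :: 2 and x
  have Gsq: "sq_int (G i)" for i
    using sq_int_cmult[OF U(1)[of 2], of "- 1"] U(1)[of 1] by (cases "i = 1") (simp_all add: G_def[abs_def])
  have G0: "G i x = 0" if "x \<notin> \<Omega>" for i x using U(2)[OF that] by (simp add: G_def)
  have Gm: "G i \<in> borel_measurable borel" for i using Gsq by (simp add: sq_int_def)
  have weak: "(\<integral>x. \<psi> x * partial_deriv i \<phi> x \<partial>lborel) = - (\<integral>x. G i x * \<phi> x \<partial>lborel)" if "\<phi> \<in> test_fun UNIV" for \<phi> i
    using \<psi>1[OF that] \<psi>2[OF that] exhaust_2[of i] by (auto simp: G_def)

  have locconst: "\<exists>r>0. ball x r \<subseteq> - closure \<Omega> \<and> (\<exists>c. AE y in lborel. y \<in> ball x r \<longrightarrow> \<psi> y = c)" if x: "x \<in> - closure \<Omega>" for x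
  proof -
    have "open (- closure \<Omega>)" by (intro open_Compl closed_closure)
    then obtain r where r: "r > 0" "ball x r \<subseteq> - closure \<Omega>" using x open_contains_ball by blast
    have "\<exists>c. AE y in lborel. y \<in> ball x (r / 2) \<longrightarrow> \<psi> y = c"
    proof (rule weakly_constant_on_ball[OF \<psi>])
      show "r / 2 > 0" using r by simp
      fix \<phi> i assume \<phi>: "\<phi> \<in> test_fun (ball x (2 * (r / 2)))"
      have out: "\<phi> y = 0" if "y \<notin> ball x r" for y using that test_funE[OF \<phi>] by auto
      have disj: "ball x r \<inter> \<Omega> = {}" using r(2) closure_subset by blast
      have z: "G i y * \<phi> y = 0" for y
      proof (cases "y \<in> \<Omega>")
        case True
        then have "y \<notin> ball x r" using disj by blast
        then show ?thesis by (simp add: out)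
      qed (simp add: G0)
      have "\<phi> \<in> test_fun UNIV" using \<phi> test_fun_mono by blast
      from weak[OF this, of i] show "(\<integral>x. \<psi> x * partial_deriv i \<phi> x \<partial>lborel) = 0" by (simp add: z)
    qed
    moreover have "ball x (r / 2) \<subseteq> - closure \<Omega>" using r subset_ball[of "r / 2" r x] by auto
    ultimately show ?thesis using r(1) by (intro exI[of _ "r / 2"]) auto
  qed
  obtain k where kAE: "AE y in lborel. y \<in> - closure \<Omega> \<longrightarrow> \<psi> y = k y"
    and kconst: "\<And>C. connected C \<Longrightarrow> C \<subseteq> - closure \<Omega> \<Longrightarrow> k constant_on C"
    and kval: "\<And>x c r. x \<in> - closure \<Omega> \<Longrightarrow> r > 0 \<Longrightarrow> AE y in lborel. y \<in> ball x r \<longrightarrow> \<psi> y = c \<Longrightarrow> k x = c"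
    by (rule locally_constant_representative[OF locconst]) (assumption | rule that)+
  have kout: "k y = 0" if y: "y \<in> outside (closure \<Omega>)" for y
  proof -
    have sub: "outside (closure \<Omega>) \<subseteq> - closure \<Omega>" using outside_no_overlap[of "closure \<Omega>"] by blast
    have "bounded (closure \<Omega>)" using bd by (rule bounded_closure)
    then have "connected (outside (closure \<Omega>))" by (rule connected_outside) simp
    from kconst[OF this sub] obtain c where c: "\<And>y. y \<in> outside (closure \<Omega>) \<Longrightarrow> k y = c"
      by (auto simp: constant_on_def)
    \<comment> \<open>The unit ball around p lies below the line x_2 = - R, where \<psi> vanishes
      identically, and p itself lies in the unbounded exterior component.\<close>
    define p :: plane where "p = (- \<bar>R\<bar> - 1) *\<^sub>R axis 2 1"
    have "closure \<Omega> \<subseteq> cball 0 R" using R by (intro closure_minimal) auto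
    moreover have "norm p = \<bar>R\<bar> + 1" by (simp add: p_def)
    then have "p \<in> - cball 0 R" by simp
    ultimately have pout: "p \<in> outside (closure \<Omega>)" using outside_subset_convex[OF convex_cball] by blast
    have "\<psi> y = 0" if "y \<in> ball p 1" for y
    proof (rule \<psi>0)
      have "\<bar>(y - p) $ 2\<bar> \<le> norm (y - p)" by (rule component_le_norm_cart)
      also have "\<dots> < 1" using that by (simp add: dist_norm norm_minus_commute)
      finally have "\<bar>y $ 2 - p $ 2\<bar> < 1" by simp
      moreover have "p $ 2 = - \<bar>R\<bar> - 1" by (simp add: p_def)
      ultimately show "y $ 2 \<le> - R" by linarith
    qed
    then have "k p = 0" using pout sub by (intro kval[of p 1]) auto
    then show ?thesis using c[OF y] c[OF pout] by simp
  qed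

  have "\<forall>z. \<exists>s c. z \<in> closure \<Omega> \<longrightarrow> s > 0 \<and> (\<forall>y. y \<in> ball z s \<longrightarrow> y \<notin> closure \<Omega> \<longrightarrow> k y = c) \<and>
    (\<forall>\<epsilon>>0. \<exists>a \<delta>. \<delta> > 0 \<and> norm a + \<delta> < \<epsilon> \<and> (\<forall>x\<in>closure \<Omega> \<inter> cball z s. \<forall>y\<in>cball a \<delta>. x + y \<in> \<Omega>))"
    using closure_local_data[OF op lip _ kconst] by metis
  from choice[OF this] obtain s where "\<forall>z. \<exists>c. z \<in> closure \<Omega> \<longrightarrow> s z > 0 \<and> (\<forall>y. y \<in> ball z (s z) \<longrightarrow> y \<notin> closure \<Omega> \<longrightarrow> k y = c) \<and>
    (\<forall>\<epsilon>>0. \<exists>a \<delta>. \<delta> > 0 \<and> norm a + \<delta> < \<epsilon> \<and> (\<forall>x\<in>closure \<Omega> \<inter> cball z (s z). \<forall>y\<in>cball a \<delta>. x + y \<in> \<Omega>))"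
    by blast
  from choice[OF this] obtain c where sc: "\<forall>z. z \<in> closure \<Omega> \<longrightarrow> s z > 0 \<and> (\<forall>y. y \<in> ball z (s z) \<longrightarrow> y \<notin> closure \<Omega> \<longrightarrow> k y = c z) \<and>
    (\<forall>\<epsilon>>0. \<exists>a \<delta>. \<delta> > 0 \<and> norm a + \<delta> < \<epsilon> \<and> (\<forall>x\<in>closure \<Omega> \<inter> cball z (s z). \<forall>y\<in>cball a \<delta>. x + y \<in> \<Omega>))"
    by blast
  have spos: "s z > 0" if "z \<in> closure \<Omega>" for z using sc that by blast
  have kc: "k y = c z" if "z \<in> closure \<Omega>" "y \<in> ball z (s z)" "y \<notin> closure \<Omega>" for y z using sc that by blast
  have push: "\<exists>a \<delta>. \<delta> > 0 \<and> norm a + \<delta> < \<epsilon> \<and> (\<forall>x\<in>closure \<Omega> \<inter> cball z (s z). \<forall>y\<in>cball a \<delta>. x + y \<in> \<Omega>)"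
    if "z \<in> closure \<Omega>" "\<epsilon> > 0" for z \<epsilon> using sc that by blast

  have "compact (closure \<Omega>)" using bd by simp
  moreover have "closure \<Omega> \<subseteq> (\<Union>z\<in>closure \<Omega>. ball z (s z / 3))"
    using spos by (intro subsetI UN_I) auto
  ultimately obtain F where F: "F \<subseteq> closure \<Omega>" "finite F" "closure \<Omega> \<subseteq> (\<Union>z\<in>F. ball z (s z / 3))"
    using compactE_image[of "closure \<Omega>" "closure \<Omega>" "\<lambda>z. ball z (s z / 3)"] by auto
  obtain h and n :: nat where h: "bij_betw h {0..<n} F"
    using ex_bij_betw_nat_finite[OF F(2)] by blast
  have hF: "h j \<in> closure \<Omega>" if "j < n" for j using h that F(1) by (auto simp: bij_betw_def)
  have "\<forall>z. \<exists>b. z \<in> closure \<Omega> \<longrightarrow> b \<in> test_fun UNIV \<and> (\<forall>x\<in>ball z (s z / 3). b x = 1) \<and> (\<forall>x. b x \<noteq> 0 \<longrightarrow> x \<in> ball z (s z))"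
    using cutoff_exists[OF spos] by metis
  from choice[OF this] obtain b0 where b0: "\<And>z. z \<in> closure \<Omega> \<Longrightarrow> b0 z \<in> test_fun UNIV"
    "\<And>z x. z \<in> closure \<Omega> \<Longrightarrow> x \<in> ball z (s z / 3) \<Longrightarrow> b0 z x = 1"
    "\<And>z x. z \<in> closure \<Omega> \<Longrightarrow> b0 z x \<noteq> 0 \<Longrightarrow> x \<in> ball z (s z)"
    by blast
  \<comment> \<open>Each cut-off is multiplied by the complements of the preceding ones; by the
    telescoping identity the sum is 1 on the closure of \<Omega>.\<close>
  define \<chi>\<^sub>0 where "\<chi>\<^sub>0 j x = b0 (h j) x * (\<Prod>i<j. 1 - b0 (h i) x)" for j x
  have \<chi>test: "\<chi>\<^sub>0 j \<in> test_fun UNIV" if "j < n" for j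
  proof -
    have "smooth (\<lambda>x. \<Prod>i<j. 1 - b0 (h i) x)"
      using that by (intro smooth_prod smooth_diff smooth_const test_fun_smooth[OF b0(1)] hF) auto
    from test_fun_mult[OF this b0(1)[OF hF[OF that]]] show ?thesis
      by (simp add: \<chi>\<^sub>0_def[abs_def] mult.commute)
  qed
  have \<chi>supp: "x \<in> ball (h j) (s (h j))" if "j < n" "\<chi>\<^sub>0 j x \<noteq> 0" for j x
    using that b0(3)[OF hF[OF that(1)]] by (auto simp: \<chi>\<^sub>0_def)
  have \<chi>sum: "(\<Sum>j<n. \<chi>\<^sub>0 j x) = 1" if "x \<in> closure \<Omega>" for x
  proof -
    obtain z where "z \<in> F" "x \<in> ball z (s z / 3)" using F(3) \<open>x \<in> closure \<Omega>\<close> by blast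
    then obtain j where j: "j < n" "x \<in> ball (h j) (s (h j) / 3)"
      using h by (auto simp: bij_betw_def)
    then have "1 - b0 (h j) x = 0" using b0(2)[OF hF[OF j(1)] j(2)] by simp
    then have "(\<Prod>i<n. 1 - b0 (h i) x) = 0" using j(1) by (intro prod_zero) auto
    then show ?thesis unfolding \<chi>\<^sub>0_def sum_prod_telescope by simp
  qed
  \<comment> \<open>The smooth carrier of the boundary values, blending the local exterior
    constants. On \<Omega> the pieces v j below sum to \<psi> - w.\<close>
  define w where "w x = (\<Sum>j<n. c (h j) * \<chi>\<^sub>0 j x)" for x
  have wsm: "smooth w"
    unfolding w_def by (intro smooth_sum smooth_cmult test_fun_smooth[OF \<chi>test]) auto
  define v where "v j x = \<chi>\<^sub>0 j x * (\<psi> x - c (h j))" for j x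
  have vH10: "v j \<in> H10 \<Omega>" if j: "j < n" for j
  proof -
    let ?K = "closure \<Omega> \<inter> cball (h j) (s (h j))"
    have t: "\<chi>\<^sub>0 j \<in> test_fun UNIV" by (rule \<chi>test[OF j])
    have td: "partial_deriv i (\<chi>\<^sub>0 j) \<in> test_fun UNIV" for i by (rule test_fun_partial_deriv[OF t])
    obtain M where M: "\<And>x. x \<notin> ball 0 M \<Longrightarrow> \<chi>\<^sub>0 j x = 0" "\<And>x i. x \<notin> ball 0 M \<Longrightarrow> partial_deriv i (\<chi>\<^sub>0 j) x = 0"
      using test_fun_in_ball[OF t] by metis
    have sqf: "sq_int (\<lambda>x. b x * (\<psi> x - c (h j)))" if b: "b \<in> test_fun UNIV" for b
      using sq_int_diff[OF sq_int_test_fun_mult[OF \<psi> b] sq_int_cmult[OF sq_int_test_fun[OF b], of "c (h j)"]]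
      by (simp add: right_diff_distrib mult.commute)
    define H where "H i x = \<chi>\<^sub>0 j x * G i x + partial_deriv i (\<chi>\<^sub>0 j) x * (\<psi> x - c (h j))" for i x
    show ?thesis
    proof (rule H10_of_pushable[where R = M and G = H and K = ?K])
      show "sq_int (v j)" unfolding v_def by (rule sqf[OF t])
      show "v j x = 0" if "x \<notin> ball 0 M" for x using M(1)[OF that] by (simp add: v_def)
      show "sq_int (H i)" for i
        unfolding H_def
      proof (rule sq_int_add[OF _ sqf[OF td]])
        obtain B where B: "\<And>x. \<bar>\<chi>\<^sub>0 j x\<bar> \<le> B" using test_fun_bounded[OF t] by metis
        show "sq_int (\<lambda>x. \<chi>\<^sub>0 j x * G i x)"
          by (rule sq_int_bound[OF Gsq[of i] borel_measurable_times[OF test_fun_borel[OF t] Gm], where M = B])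
            (simp add: abs_mult mult_right_mono B)
      qed
      show "H i x = 0" if "x \<notin> ball 0 M" for i x using M(1)[OF that] M(2)[OF that] by (simp add: H_def)
      show "(\<integral>x. v j x * partial_deriv i \<phi> x \<partial>lborel) = - (\<integral>x. H i x * \<phi> x \<partial>lborel)" if "\<phi> \<in> test_fun UNIV" for \<phi> i
        unfolding v_def H_def by (rule weak_gradient_cutoff[OF \<psi> Gsq weak t that])
      show "compact ?K" using bd by (intro closed_Int_compact) auto
      \<comment> \<open>Outside the ball the cut-off vanishes; inside it but off the closure, \<psi>
        agrees almost everywhere with k, which is the subtracted constant.\<close>
      show "AE y in lborel. y \<notin> ?K \<longrightarrow> v j y = 0"
        using kAE
      proof eventually_elim
        case (elim y)
        show ?case
        proof
          assume y: "y \<notin> ?K"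
          show "v j y = 0"
          proof (rule ccontr)
            assume "v j y \<noteq> 0"
            then have "\<chi>\<^sub>0 j y \<noteq> 0" "\<psi> y \<noteq> c (h j)" by (auto simp: v_def)
            moreover from this have yb: "y \<in> ball (h j) (s (h j))" using \<chi>supp[OF j] by blast
            ultimately show False using y elim kc[OF hF[OF j] yb] by auto
          qed
        qed
      qed
      show "\<exists>a \<delta>. \<delta> > 0 \<and> norm a + \<delta> < \<epsilon> \<and> (\<forall>k\<in>?K. \<forall>y\<in>cball a \<delta>. k + y \<in> \<Omega>)" if "\<epsilon> > 0" for \<epsilon>
        by (rule push[OF hF[OF j] that])
    qed
  qed
  define D where "D x = (\<Sum>j<n. v j x)" for x
  have DH10: "D \<in> H10 \<Omega>" unfolding D_def by (rule H10_sum) (use vH10 in auto)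
  define \<Psi> where "\<Psi> x = D x + w x" for x
  have \<Psi>eq: "\<Psi> x = \<psi> x" if "x \<in> \<Omega>" for x
  proof -
    have "x \<in> closure \<Omega>" using that closure_subset by blast
    have "\<Psi> x = (\<Sum>j<n. \<chi>\<^sub>0 j x * \<psi> x)"
      by (simp add: \<Psi>_def D_def w_def v_def sum.distrib[symmetric] algebra_simps)
    then show ?thesis using \<chi>sum[OF \<open>x \<in> closure \<Omega>\<close>] by (simp flip: sum_distrib_right)
  qed
  have \<Psi>H1: "\<Psi> \<in> H1 \<Omega>" unfolding \<Psi>_def by (rule H1_add[OF H10_H1[OF DH10] smooth_H1[OF wsm]])

  \<comment> \<open>An exterior point y close enough to x lies in the ball of every cut-off that is
    nonzero at x, so all constants entering w x equal k y and the partition of unity sums them to k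
    y.\<close>
  have wnear: "\<exists>t>0. \<forall>y\<in>ball x t. y \<notin> closure \<Omega> \<longrightarrow> k y = w x" if x: "x \<in> closure \<Omega>" for x
  proof -
    let ?J = "{j. j < n \<and> \<chi>\<^sub>0 j x \<noteq> 0}"
    have "open (\<Inter>j\<in>?J. ball (h j) (s (h j)))" by (intro open_INT) auto
    moreover have "x \<in> (\<Inter>j\<in>?J. ball (h j) (s (h j)))" using \<chi>supp by blast
    ultimately obtain t where t: "t > 0" "ball x t \<subseteq> (\<Inter>j\<in>?J. ball (h j) (s (h j)))"
      by (rule openE)
    have "k y = w x" if y: "y \<in> ball x t" "y \<notin> closure \<Omega>" for y
    proof -
      have "w x = (\<Sum>j<n. k y * \<chi>\<^sub>0 j x)"
        unfolding w_def
      proof (rule sum.cong[OF refl])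
        fix j assume "j \<in> {..<n}"
        then have j: "j < n" by simp
        show "c (h j) * \<chi>\<^sub>0 j x = k y * \<chi>\<^sub>0 j x"
        proof (cases "\<chi>\<^sub>0 j x = 0")
          case False
          then have "y \<in> ball (h j) (s (h j))" using t(2) y(1) j by blast
          then show ?thesis using kc[OF hF[OF j] _ y(2)] by simp
        qed simp
      qed
      then show ?thesis using \<chi>sum[OF x] by (simp flip: sum_distrib_left)
    qed
    with t(1) show ?thesis by blast
  qed
  have wout: "w x = 0" if x: "x \<in> exterior_boundary \<Omega>" for x
  proof -
    have "x \<in> closure \<Omega>" using x exterior_boundary_subset_frontier[OF op] by (auto simp: frontier_def)
    then obtain t where t: "t > 0" "\<And>y. y \<in> ball x t \<Longrightarrow> y \<notin> closure \<Omega> \<Longrightarrow> k y = w x" using wnear by blast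
    have "x \<in> closure (outside (closure \<Omega>))" using x by (simp add: exterior_boundary_def frontier_def)
    then obtain y where y: "y \<in> outside (closure \<Omega>)" "dist y x < t" using t(1) by (auto simp: closure_approachable)
    have "y \<notin> closure \<Omega>" using y(1) outside_no_overlap[of "closure \<Omega>"] by blast
    then show ?thesis using t(2)[of y] y(2) kout[OF y(1)] by (simp add: dist_commute)
  qed
  \<comment> \<open>Nearby frontier points have a common exterior neighbour y, because the frontier
    lies in the closure of the exterior; both values of w equal k y, so w is locally constant on
    \<Gamma>.\<close>
  have wcomp: "\<exists>c. \<forall>x\<in>\<Gamma>. w x = c" if \<Gamma>: "connected \<Gamma>" "\<Gamma> \<subseteq> frontier \<Omega>" for \<Gamma>
  proof -
    have "w constant_on \<Gamma>"
    proof (rule locally_constant_imp_constant[OF \<Gamma>(1)])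
      fix a assume "a \<in> \<Gamma>"
      then have "a \<in> closure \<Omega>" using \<Gamma>(2) by (auto simp: frontier_def)
      then obtain t where t: "t > 0" "\<And>y. y \<in> ball a t \<Longrightarrow> y \<notin> closure \<Omega> \<Longrightarrow> k y = w a" using wnear by blast
      show "\<exists>T. openin (top_of_set \<Gamma>) T \<and> a \<in> T \<and> (\<forall>x\<in>T. w x = w a)"
      proof (intro exI conjI ballI)
        show "openin (top_of_set \<Gamma>) (\<Gamma> \<inter> ball a t)" by (rule openin_open_Int) simp
        show "a \<in> \<Gamma> \<inter> ball a t" using \<open>a \<in> \<Gamma>\<close> t by simp
        fix x assume x: "x \<in> \<Gamma> \<inter> ball a t"
        then have xf: "x \<in> frontier \<Omega>" using \<Gamma>(2) by blast
        then have "x \<in> closure \<Omega>" by (auto simp: frontier_def)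
        then obtain t' where t': "t' > 0" "\<And>y. y \<in> ball x t' \<Longrightarrow> y \<notin> closure \<Omega> \<Longrightarrow> k y = w x" using wnear by blast
        have op2: "open (ball a t \<inter> ball x t')" by (intro open_Int open_ball)
        have "x \<in> (ball a t \<inter> ball x t') \<inter> closure (- closure \<Omega>)"
          using x t'(1) frontier_in_closure_exterior[OF op lip xf] by simp
        then have "(ball a t \<inter> ball x t') \<inter> - closure \<Omega> \<noteq> {}"
          using open_Int_closure_eq_empty[OF op2, of "- closure \<Omega>"] by blast
        then obtain y where "y \<in> ball a t" "y \<in> ball x t'" "y \<notin> closure \<Omega>" by blast
        then show "w x = w a" using t(2) t'(2) by metis
      qed
    qed
    then show ?thesis by (simp add: constant_on_def)
  qed
  have "has_trace \<Omega> \<Psi> w"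
    unfolding has_trace_def
  proof (intro conjI)
    show "w \<in> borel_measurable borel" by (rule smooth_borel[OF wsm])
    obtain \<phi> where \<phi>: "\<And>n. \<phi> n \<in> test_fun \<Omega>" "H1_conv \<Omega> \<phi> D" using H10_approx[OF DH10] by metis
    show "\<exists>\<phi>. (\<forall>n. smooth (\<phi> n)) \<and> H1_conv \<Omega> \<phi> \<Psi> \<and>
       (\<lambda>n. \<integral>\<^sup>+x\<in>frontier \<Omega>. ennreal ((\<phi> n x - w x)\<^sup>2) \<partial>arc_measure) \<longlonglongrightarrow> 0"
    proof (intro exI conjI allI)
      show "smooth (\<lambda>x. \<phi> n x + w x)" for n by (intro smooth_add test_fun_smooth[OF \<phi>(1)] wsm)
      show "H1_conv \<Omega> (\<lambda>n x. \<phi> n x + w x) \<Psi>" using \<phi>(2) by (simp add: H1_conv_def \<Psi>_def)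
      \<comment> \<open>The test functions vanish on the frontier, so the approximants coincide with
        w there and the integrand is 0 whatever \<open>arc_measure\<close> is.\<close>
      have zero: "ennreal ((\<phi> n x + w x - w x)\<^sup>2) * indicator (frontier \<Omega>) x = 0" for n x
      proof (cases "x \<in> frontier \<Omega>")
        case True
        then have "x \<notin> \<Omega>" using op by (simp add: frontier_def interior_open)
        then have "\<phi> n x = 0" using test_funE[OF \<phi>(1)] by metis
        then show ?thesis by simp
      qed simp
      show "(\<lambda>n. \<integral>\<^sup>+x\<in>frontier \<Omega>. ennreal ((\<phi> n x + w x - w x)\<^sup>2) \<partial>arc_measure) \<longlonglongrightarrow> 0"
        unfolding zero by simp
    qed
  qed
  moreover have "\<exists>c. AE x in arc_measure. x \<in> \<Gamma> \<longrightarrow> w x = c" if \<Gamma>: "\<Gamma> \<in> components (frontier \<Omega>)" for \<Gamma>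
  proof -
    obtain c where "\<forall>x\<in>\<Gamma>. w x = c"
      using wcomp[OF in_components_connected[OF \<Gamma>] in_components_subset[OF \<Gamma>]] by blast
    then show ?thesis by (intro exI[of _ c] AE_I2) blast
  qed
  ultimately have "\<Psi> \<in> streamfunctions \<Omega>"
    using \<Psi>H1 wout unfolding streamfunctions_def by (auto intro!: exI[of _ w])
  moreover have "AE x in lebesgue_on \<Omega>. perp_grad \<Omega> \<Psi> x = u x"
  proof -
    define g where "g x = (\<chi> i. G i x)" for x
    have Lg: "L2 \<Omega> g" unfolding g_def using Gsq by (intro L2_vec sq_int_L2)
    have "weak_gradient \<Omega> \<psi> g" unfolding g_def by (rule weak_gradient_of_plane[OF borel \<psi>(1) Gm weak])
    moreover have "(\<integral>x. \<Psi> x * partial_deriv i \<phi> x \<partial>lebesgue_on \<Omega>) = (\<integral>x. \<psi> x * partial_deriv i \<phi> x \<partial>lebesgue_on \<Omega>)" for i \<phi>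
      by (rule Bochner_Integration.integral_cong) (auto simp: \<Psi>eq)
    ultimately have "weak_gradient \<Omega> \<Psi> g" by (simp add: weak_gradient_def)
    from grad_eq[OF H1_L2[OF \<Psi>H1] Lg this] U(3)[of 1] U(3)[of 2] show ?thesis
      by eventually_elim (simp add: perp_grad_def g_def G_def vec_eq_iff forall_2)
  qed
  ultimately show ?thesis by (rule that)
qed

end

section \<open>Duality\<close>

text \<open>The coordinate x_1 is the smooth multiplier that recovers the integral of a test
  function from its first partial derivative.\<close>

lemma smooth_component: "smooth (\<lambda>x::plane. x $ i)"
proof -
  have D: "((\<lambda>x::plane. x $ i) has_derivative (\<lambda>h. h $ i)) (at x)" for x
    by (rule bounded_linear_imp_has_derivative) (rule bounded_linear_vec_nth)
  have pd: "partial_deriv j (\<lambda>x::plane. x $ i) = (\<lambda>x. axis j 1 $ i)" for j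
    by (rule ext) (rule partial_deriv_eq[OF D])
  have "Ck k (\<lambda>x::plane. x $ i)" for k
  proof (cases k)
    case 0
    then show ?thesis by (simp add: continuous_on_component)
  next
    case (Suc m)
    have "(\<lambda>x::plane. x $ i) differentiable_on UNIV"
      using D by (auto simp: differentiable_on_UNIV_iff differentiable_def)
    then show ?thesis using Suc by (simp add: pd Ck_const)
  qed
  then show ?thesis by (simp add: smooth_def)
qed

context bounded_open_set
begin

section \<open>Test functions with nonzero gradient\<close>

lemma mollifier_in_open_set:
  assumes "\<Omega> \<noteq> {}"
  obtains \<phi> where "\<phi> \<in> test_fun \<Omega>" "(\<integral>x. \<phi> x \<partial>lborel) = 1"
proof -
  obtain a where "a \<in> \<Omega>" using assms by blast
  then obtain r where r: "r > 0" "cball a r \<subseteq> \<Omega>" using op open_contains_cball by blast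
  obtain \<phi> where \<phi>: "mollifier a r \<phi>" using mollifier_exists[OF r(1)] by metis
  then have "\<phi> \<in> test_fun \<Omega>"
    using r(2) by (intro test_funI[of _ "cball a r"]) (auto simp: mollifier_def test_fun_smooth less_imp_le)
  then show ?thesis using that \<phi> by (auto simp: mollifier_def)
qed

lemma test_fun_AE_zero:
  assumes \<phi>: "\<phi> \<in> test_fun \<Omega>" and zero: "AE x in lebesgue_on \<Omega>. \<phi> x = 0"
  shows "(\<integral>x. \<phi> x \<partial>lborel) = 0"
proof (rule integral_eq_zero_AE)
  have "AE x in lborel. x \<in> \<Omega> \<longrightarrow> \<phi> x = 0" using zero by (simp add: AE_lebesgue_on_iff[OF borel])
  then show "AE x in lborel. \<phi> x = 0"
    by eventually_elim (use test_funE[OF \<phi>] in metis)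
qed

lemma grad_norm_zero_imp:
  assumes "u \<in> H1 \<Omega>" "grad_norm u = 0"
  shows "AE x in lebesgue_on \<Omega>. grad \<Omega> u x = 0"
proof -
  have "(\<integral>x. (norm (grad \<Omega> u x))\<^sup>2 \<partial>lebesgue_on \<Omega>) = 0"
    using assms(2) L2norm_square[of \<Omega> "grad \<Omega> u"] by simp
  then have "AE x in lebesgue_on \<Omega>. (norm (grad \<Omega> u x))\<^sup>2 = 0"
    using integral_nonneg_eq_0_iff_AE[OF L2_norm_square[OF grad_L2[OF assms(1)]]] by simp
  then show ?thesis by eventually_elim simp
qed

text \<open>Integration by parts against x_1 writes the integral of \<phi> as minus that of x_1
  times the first derivative, which would vanish with the gradient.\<close>

lemma test_fun_grad_norm_nonzero:
  assumes \<phi>: "\<phi> \<in> test_fun \<Omega>" and "(\<integral>x. \<phi> x \<partial>lborel) \<noteq> 0"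
  shows "grad_norm \<phi> \<noteq> 0"
proof
  assume "grad_norm \<phi> = 0"
  have s: "smooth \<phi>" by (rule test_fun_smooth[OF \<phi>])
  have \<phi>U: "\<phi> \<in> test_fun UNIV" using \<phi> test_fun_mono by blast
  have "AE x in lebesgue_on \<Omega>. partial_deriv 1 \<phi> x = 0"
    using grad_norm_zero_imp[OF test_fun_H1[OF \<phi>] \<open>grad_norm \<phi> = 0\<close>] grad_smooth[OF s]
    by eventually_elim (simp add: classical_grad_def vec_eq_iff)
  then have "AE x in lborel. x \<in> \<Omega> \<longrightarrow> partial_deriv 1 \<phi> x = 0" by (simp add: AE_lebesgue_on_iff[OF borel])
  then have z: "AE x in lborel. x $ 1 * partial_deriv 1 \<phi> x = 0"
    by eventually_elim (use test_funE[OF test_fun_partial_deriv[OF \<phi>]] in \<open>metis mult_zero_right\<close>)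
  have "partial_deriv 1 (\<lambda>x::plane. x $ 1) x = 1" for x
    using partial_deriv_eq[OF bounded_linear_imp_has_derivative[OF bounded_linear_vec_nth[of 1]], of 1 x]
    by (simp add: axis_def)
  then have "(\<integral>x. \<phi> x \<partial>lborel) = - (\<integral>x. x $ 1 * partial_deriv 1 \<phi> x \<partial>lborel)"
    using integration_by_parts[OF smooth_component[of 1] \<phi>U, of 1] by simp
  also have "\<dots> = 0" using integral_eq_zero_AE[OF z] by simp
  finally show False using assms(2) by simp
qed

text \<open>Supplies competitors for the quadratic form; the constant approximating sequence \<phi>
  already realises the zero trace.\<close>

lemma test_fun_streamfunction:
  assumes \<phi>: "\<phi> \<in> test_fun \<Omega>"
  shows "\<phi> \<in> streamfunctions \<Omega>"
proof -
  have "has_trace \<Omega> \<phi> (\<lambda>x. 0)"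
    unfolding has_trace_def
  proof (intro conjI exI allI)
    show "smooth \<phi>" for n :: nat by (rule test_fun_smooth[OF \<phi>])
    show "H1_conv \<Omega> (\<lambda>n. \<phi>) \<phi>" by (rule H1_conv_const)
    have zero: "ennreal ((\<phi> x - 0)\<^sup>2) * indicator (frontier \<Omega>) x = 0" for x
    proof (cases "x \<in> frontier \<Omega>")
      case True
      then have "x \<notin> \<Omega>" using op by (simp add: frontier_def interior_open)
      then have "\<phi> x = 0" using test_funE[OF \<phi>] by metis
      then show ?thesis by simp
    qed simp
    show "(\<lambda>n. \<integral>\<^sup>+x\<in>frontier \<Omega>. ennreal ((\<phi> x - 0)\<^sup>2) \<partial>arc_measure) \<longlonglongrightarrow> 0"
      unfolding zero by simp
  qed simp
  then show ?thesis
    using test_fun_H1[OF \<phi>] unfolding streamfunctions_def by auto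
qed

section \<open>Consequences of the trilinear estimate\<close>

definition trilinear_hyp :: "real \<Rightarrow> bool" where
  "trilinear_hyp c \<longleftrightarrow> (\<forall>\<xi>\<in>H10 \<Omega>. \<forall>T\<in>H10 \<Omega>. \<forall>\<psi>\<in>streamfunctions \<Omega>.
      advection \<Omega> (perp_grad \<Omega> \<psi>) T \<xi> \<le> c * grad_norm \<xi> * grad_norm \<psi> * grad_norm T)"

lemma streamfunctions_H1: "\<psi> \<in> streamfunctions \<Omega> \<Longrightarrow> \<psi> \<in> H1 \<Omega>"
  by (simp add: streamfunctions_def)

text \<open>The hypothesis is one-sided; replacing \<eta> by - \<eta>, which has the same gradient
  norm, bounds the absolute value.\<close>

lemma trilinear_bound_perp_grad:
  assumes c: "trilinear_hyp c" and \<psi>: "\<psi> \<in> streamfunctions \<Omega>"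
  shows "trilinear_bound (perp_grad \<Omega> \<psi>) (c * grad_norm \<psi>)"
  unfolding trilinear_bound_def
proof (intro conjI ballI impI)
  show "L2 \<Omega> (perp_grad \<Omega> \<psi>)" by (rule perp_grad_L2[OF streamfunctions_H1[OF \<psi>]])
  fix \<eta> T assume \<eta>: "\<eta> \<in> H10 \<Omega>" "ess_bounded \<Omega> \<eta>" and T: "T \<in> H10 \<Omega>"
  have adv: "advection \<Omega> (perp_grad \<Omega> \<psi>) T \<zeta> = adv_int (perp_grad \<Omega> \<psi>) T \<zeta>" if "ess_bounded \<Omega> \<zeta>" for \<zeta>
    using that by (simp add: advection_def adv_int_def)
  have "adv_int (perp_grad \<Omega> \<psi>) T \<eta> \<le> c * grad_norm \<eta> * grad_norm \<psi> * grad_norm T"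
    using c \<eta> T \<psi> unfolding trilinear_hyp_def adv[OF \<eta>(2), symmetric] by blast
  moreover have "adv_int (perp_grad \<Omega> \<psi>) T (\<lambda>x. (- 1) * \<eta> x) \<le> c * grad_norm (\<lambda>x. (- 1) * \<eta> x) * grad_norm \<psi> * grad_norm T"
    using c H10_cmult[OF \<eta>(1)] T \<psi> unfolding trilinear_hyp_def adv[OF ess_bounded_cmult[OF \<eta>(2)], symmetric] by blast
  moreover have "adv_int (perp_grad \<Omega> \<psi>) T (\<lambda>x. (- 1) * \<eta> x) = - adv_int (perp_grad \<Omega> \<psi>) T \<eta>"
    by (simp add: adv_int_def)
  ultimately have "\<bar>adv_int (perp_grad \<Omega> \<psi>) T \<eta>\<bar> \<le> c * grad_norm \<eta> * grad_norm \<psi> * grad_norm T"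
    unfolding grad_norm_cmult[OF H10_H1[OF \<eta>(1)]] by simp
  then show "\<bar>adv_int (perp_grad \<Omega> \<psi>) T \<eta>\<bar> \<le> c * grad_norm \<psi> * grad_norm \<eta> * grad_norm T"
    by (simp add: mult_ac)
qed

lemma zero_H10: "(\<lambda>x. 0) \<in> H10 \<Omega>"
  by (rule test_fun_H10[OF test_fun_zero])

lemma dual_form_eq:
  assumes "\<psi> \<in> H1 \<Omega>" "\<theta> \<in> H1 \<Omega>"
  shows "dual_form \<Omega> Pe a \<xi> \<psi> \<theta> = a * (grad_norm \<psi>)\<^sup>2 + (grad_norm \<theta>)\<^sup>2 - Pe * advection \<Omega> (perp_grad \<Omega> \<psi>) \<theta> \<xi>"
  using L2_norm_square[OF grad_L2[OF assms(1)]] L2_norm_square[OF grad_L2[OF assms(2)]]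
  by (simp add: dual_form_def L2norm_square)

text \<open>Evaluating the form at (\<phi>, 0) kills the advection term and leaves a times a
  positive number. The sign of a is needed to discard a (1 - ||grad \<psi>||^2) in weak
  duality.\<close>

lemma dual_feasible_nonneg:
  assumes c: "trilinear_hyp c" and "\<Omega> \<noteq> {}" and feas: "dual_feasible \<Omega> Pe a \<xi>"
  shows "a \<ge> 0"
proof -
  obtain \<phi> where \<phi>: "\<phi> \<in> test_fun \<Omega>" "(\<integral>x. \<phi> x \<partial>lborel) = 1"
    using mollifier_in_open_set[OF assms(2)] by metis
  have s: "\<phi> \<in> streamfunctions \<Omega>" by (rule test_fun_streamfunction[OF \<phi>(1)])
  have "\<xi> \<in> H10 \<Omega>" using feas by (simp add: dual_feasible_def)
  have "\<bar>advection \<Omega> (perp_grad \<Omega> \<phi>) (\<lambda>x. 0) \<xi>\<bar> \<le> 0"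
    using advection_le[OF trilinear_bound_perp_grad[OF c s] zero_H10 \<open>\<xi> \<in> H10 \<Omega>\<close>] by (simp add: grad_norm_zero)
  moreover have "dual_form \<Omega> Pe a \<xi> \<phi> (\<lambda>x. 0) \<ge> 0" using feas s zero_H10 by (simp add: dual_feasible_def)
  ultimately have "a * (grad_norm \<phi>)\<^sup>2 \<ge> 0"
    by (simp add: dual_form_eq streamfunctions_H1[OF s] H10_H1[OF zero_H10] grad_norm_zero)
  moreover have "(grad_norm \<phi>)\<^sup>2 > 0" using test_fun_grad_norm_nonzero[OF \<phi>(1)] \<phi>(2) by simp
  ultimately show ?thesis by (simp add: zero_le_mult_iff)
qed

section \<open>Weak duality\<close>

lemma admissible_streamfunction:
  assumes lip: "lipschitz_boundary \<Omega>" and u: "u \<in> admissible \<Omega> Pe" and "Pe \<ge> 0"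
  obtains \<psi> where "\<psi> \<in> streamfunctions \<Omega>" "AE x in lebesgue_on \<Omega>. u x = Pe *\<^sub>R perp_grad \<Omega> \<psi> x" "grad_norm \<psi> \<le> 1"
proof -
  have uL: "L2 \<Omega> u" and ortho: "\<And>\<phi>. \<phi> \<in> H1 \<Omega> \<Longrightarrow> (\<integral>x. u x \<bullet> grad \<Omega> \<phi> x \<partial>lebesgue_on \<Omega>) = 0"
    and le: "L2norm \<Omega> u \<le> Pe"
    using u by (auto simp: admissible_def)
  \<comment> \<open>For Pe = 0 the factor 1 / Pe is 0, so a stream function of the zero field is
    produced; the required identity then holds because u vanishes almost everywhere.\<close>
  have L: "L2 \<Omega> (\<lambda>x. (1 / Pe) *\<^sub>R u x)" by (rule L2_scaleR[OF uL])
  have ortho': "(\<integral>x. ((1 / Pe) *\<^sub>R u x) \<bullet> grad \<Omega> \<phi> x \<partial>lebesgue_on \<Omega>) = 0" if "\<phi> \<in> H1 \<Omega>" for \<phi>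
    using ortho[OF that] by simp
  obtain \<psi> where \<psi>: "\<psi> \<in> streamfunctions \<Omega>" "AE x in lebesgue_on \<Omega>. perp_grad \<Omega> \<psi> x = (1 / Pe) *\<^sub>R u x"
    by (rule stream_function_exists[OF lip L ortho']) (assumption | rule that)+
  have n: "grad_norm \<psi> = \<bar>1 / Pe\<bar> * L2norm \<Omega> u"
    using L2norm_cong[OF \<psi>(2) perp_grad_L2[OF streamfunctions_H1[OF \<psi>(1)]] L]
    by (simp only: L2norm_scaleR perp_grad_L2norm)
  show ?thesis
  proof (rule that[OF \<psi>(1)])
    show "grad_norm \<psi> \<le> 1"
    proof (cases "Pe = 0")
      case False
      then show ?thesis using n le \<open>Pe \<ge> 0\<close> by (simp add: pos_divide_le_eq)
    qed (use n in simp)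
    show "AE x in lebesgue_on \<Omega>. u x = Pe *\<^sub>R perp_grad \<Omega> \<psi> x"
    proof (cases "Pe = 0")
      case True
      then have "L2norm \<Omega> u = 0" using le L2norm_nonneg[of \<Omega> u] by simp
      then have "(\<integral>x. (norm (u x))\<^sup>2 \<partial>lebesgue_on \<Omega>) = 0" using L2norm_square[of \<Omega> u] by simp
      then have "AE x in lebesgue_on \<Omega>. (norm (u x))\<^sup>2 = 0"
        using integral_nonneg_eq_0_iff_AE[OF L2_norm_square[OF uL]] by simp
      then show ?thesis by eventually_elim (simp add: True)
    next
      case False
      from \<psi>(2) show ?thesis by eventually_elim (simp add: False)
    qed
  qed
qed

text \<open>With \<open>\<theta> = T - \<xi> / 2\<close> the duality gap is \<open>\<parallel>\<nabla>\<theta>\<parallel>\<^sup>2 - advection u \<theta> \<xi> + a\<close>, because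
  \<open>advection u \<xi> \<xi> = 0\<close>; it exceeds the dual quadratic form by \<open>a (1 - \<parallel>\<nabla>\<psi>\<parallel>\<^sup>2)\<close>.\<close>

lemma weak_duality:
  assumes lip: "lipschitz_boundary \<Omega>" and "\<Omega> \<noteq> {}" and c: "trilinear_hyp c" and "Pe \<ge> 0"
    and u: "u \<in> admissible \<Omega> Pe" and sol: "weak_solution \<Omega> f u T" and feas: "dual_feasible \<Omega> Pe a \<xi>"
  shows "f \<xi> - (\<integral>x. (norm (grad \<Omega> \<xi> x))\<^sup>2 \<partial>lebesgue_on \<Omega>) / 4 - a \<le> (\<integral>x. (norm (grad \<Omega> T x))\<^sup>2 \<partial>lebesgue_on \<Omega>)"
proof -
  obtain \<psi> where \<psi>: "\<psi> \<in> streamfunctions \<Omega>" "AE x in lebesgue_on \<Omega>. u x = Pe *\<^sub>R perp_grad \<Omega> \<psi> x" "grad_norm \<psi> \<le> 1"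
    using admissible_streamfunction[OF lip u \<open>Pe \<ge> 0\<close>] by metis
  have uL: "L2 \<Omega> u" and ortho: "\<And>\<phi>. \<phi> \<in> H1 \<Omega> \<Longrightarrow> (\<integral>x. u x \<bullet> grad \<Omega> \<phi> x \<partial>lebesgue_on \<Omega>) = 0"
    using u by (auto simp: admissible_def)
  have T: "T \<in> H10 \<Omega>" and \<xi>: "\<xi> \<in> H10 \<Omega>"
    using sol feas by (auto simp: weak_solution_def dual_feasible_def)
  note b = trilinear_bound_perp_grad[OF c \<psi>(1)]
  \<comment> \<open>Linearity and the cancellation for advection by u are available only through
    this bound, inherited from \<psi>.\<close>
  note ub = advection_cmult_field(1)[OF b uL \<psi>(2) T \<xi>]
  define \<theta> where "\<theta> x = T x - (1 / 2) * \<xi> x" for x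
  have \<theta>: "\<theta> \<in> H10 \<Omega>" unfolding \<theta>_def by (rule H10_diff[OF T H10_cmult[OF \<xi>]])
  have "advection \<Omega> u \<theta> \<xi> = advection \<Omega> u T \<xi>"
    unfolding \<theta>_def using advection_diff_cmult[OF ub T \<xi> \<xi>, of "1 / 2"] advection_self[OF ub ortho \<xi>] by simp
  then have adv: "advection \<Omega> u T \<xi> = Pe * advection \<Omega> (perp_grad \<Omega> \<psi>) \<theta> \<xi>"
    using advection_cmult_field(2)[OF b uL \<psi>(2) \<theta> \<xi>] by simp
  have "dual_form \<Omega> Pe a \<xi> \<psi> \<theta> \<ge> 0" using feas \<psi>(1) \<theta> by (simp add: dual_feasible_def)
  then have q: "Pe * advection \<Omega> (perp_grad \<Omega> \<psi>) \<theta> \<xi> \<le> a * (grad_norm \<psi>)\<^sup>2 + (grad_norm \<theta>)\<^sup>2"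
    by (simp add: dual_form_eq streamfunctions_H1[OF \<psi>(1)] H10_H1[OF \<theta>])
  have "(grad_norm \<psi>)\<^sup>2 \<le> 1" using \<psi>(3) L2norm_nonneg[of \<Omega> "grad \<Omega> \<psi>"] by (simp add: power_le_one)
  then have "a * (grad_norm \<psi>)\<^sup>2 \<le> a"
    using dual_feasible_nonneg[OF c assms(2) feas] by (simp add: mult_left_le)
  moreover have eq: "(\<integral>x. grad \<Omega> \<xi> x \<bullet> grad \<Omega> T x \<partial>lebesgue_on \<Omega>) + advection \<Omega> u T \<xi> - f \<xi> = 0"
    using sol \<xi> by (simp add: weak_solution_def)
  moreover have "(grad_norm \<theta>)\<^sup>2 = (\<integral>x. (norm (grad \<Omega> T x))\<^sup>2 \<partial>lebesgue_on \<Omega>)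
      - (\<integral>x. grad \<Omega> \<xi> x \<bullet> grad \<Omega> T x \<partial>lebesgue_on \<Omega>) + (\<integral>x. (norm (grad \<Omega> \<xi> x))\<^sup>2 \<partial>lebesgue_on \<Omega>) / 4"
  proof -
    have H: "T \<in> H1 \<Omega>" "\<xi> \<in> H1 \<Omega>" "(\<lambda>x. (1 / 2) * \<xi> x) \<in> H1 \<Omega>" using T \<xi> H10_H1 H1_cmult by blast+
    have i: "integrable (lebesgue_on \<Omega>) (\<lambda>x. (norm (grad \<Omega> T x))\<^sup>2)" "integrable (lebesgue_on \<Omega>) (\<lambda>x. (norm (grad \<Omega> \<xi> x))\<^sup>2)"
      "integrable (lebesgue_on \<Omega>) (\<lambda>x. grad \<Omega> \<xi> x \<bullet> grad \<Omega> T x)"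
      using H by (auto intro: L2_norm_square L2_integrable_inner grad_L2)
    have "AE x in lebesgue_on \<Omega>. grad \<Omega> \<theta> x = grad \<Omega> T x - (1 / 2) *\<^sub>R grad \<Omega> \<xi> x"
      using grad_diff[OF H(1,3)] grad_cmult[OF H(2), of "1 / 2"] unfolding \<theta>_def[abs_def] by eventually_elim simp
    then have "AE x in lebesgue_on \<Omega>. (norm (grad \<Omega> \<theta> x))\<^sup>2
        = (norm (grad \<Omega> T x))\<^sup>2 - grad \<Omega> \<xi> x \<bullet> grad \<Omega> T x + (norm (grad \<Omega> \<xi> x))\<^sup>2 / 4"
      by eventually_elim (simp add: power2_norm_eq_inner inner_diff_left inner_diff_right inner_commute)
    then have "(\<integral>x. (norm (grad \<Omega> \<theta> x))\<^sup>2 \<partial>lebesgue_on \<Omega>)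
        = (\<integral>x. (norm (grad \<Omega> T x))\<^sup>2 - grad \<Omega> \<xi> x \<bullet> grad \<Omega> T x + (norm (grad \<Omega> \<xi> x))\<^sup>2 / 4 \<partial>lebesgue_on \<Omega>)"
      using i L2_norm_square[OF grad_L2[OF H10_H1[OF \<theta>]]] by (intro integral_cong_AE) auto
    then show ?thesis using i by (simp add: L2norm_square)
  qed
  ultimately show ?thesis using q adv by linarith
qed

lemma primal_ge_dual:
  assumes "lipschitz_boundary \<Omega>" "\<Omega> \<noteq> {}" "trilinear_hyp c" "Pe \<ge> 0"
  shows "dual_value \<Omega> f Pe \<le> primal_value \<Omega> f Pe"
  unfolding dual_value_def primal_value_def
  by (intro SUP_least INF_greatest) (use weak_duality[OF assms] in auto)

section \<open>The lower bound for the dual value\<close>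

lemma dual_feasible_scaled:
  assumes c: "trilinear_hyp c" "c > 0" and "Pe \<ge> 0" and \<xi>: "\<xi> \<in> H10 \<Omega>"
  shows "dual_feasible \<Omega> Pe (c\<^sup>2 * Pe\<^sup>2 * (grad_norm \<xi>)\<^sup>2 / 4) \<xi>"
  unfolding dual_feasible_def
proof (intro conjI ballI \<xi>)
  fix \<psi> \<theta> assume \<psi>: "\<psi> \<in> streamfunctions \<Omega>" and \<theta>: "\<theta> \<in> H10 \<Omega>"
  define X Y Z where "X = grad_norm \<xi>" and "Y = grad_norm \<psi>" and "Z = grad_norm \<theta>"
  have "Pe * advection \<Omega> (perp_grad \<Omega> \<psi>) \<theta> \<xi> \<le> Pe * (c * X * Y * Z)"
    using c \<xi> \<psi> \<theta> \<open>Pe \<ge> 0\<close> unfolding trilinear_hyp_def X_def Y_def Z_def by (intro mult_left_mono) auto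
  \<comment> \<open>Young's inequality, as nonnegativity of the square of c Pe X Y / 2 - Z; it
    dictates the coefficient a.\<close>
  also have "\<dots> \<le> c\<^sup>2 * Pe\<^sup>2 * X\<^sup>2 / 4 * Y\<^sup>2 + Z\<^sup>2"
    using zero_le_power2[of "c * Pe * X * Y / 2 - Z"] by (simp add: power2_eq_square algebra_simps)
  finally show "dual_form \<Omega> Pe (c\<^sup>2 * Pe\<^sup>2 * (grad_norm \<xi>)\<^sup>2 / 4) \<xi> \<psi> \<theta> \<ge> 0"
    by (simp add: dual_form_eq streamfunctions_H1[OF \<psi>] H10_H1[OF \<theta>] X_def Y_def Z_def)
qed

lemma dual_value_ge_ratio:
  assumes f: "f \<in> Hminus1 \<Omega>" and c: "trilinear_hyp c" "c > 0" and "Pe \<ge> 0" and \<phi>: "\<phi> \<in> H10 \<Omega>"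
  shows "ereal ((\<bar>f \<phi>\<bar> / grad_norm \<phi>)\<^sup>2 / (1 + c\<^sup>2 * Pe\<^sup>2)) \<le> dual_value \<Omega> f Pe"
proof -
  define K where "K = 1 + c\<^sup>2 * Pe\<^sup>2"
  have K: "K > 0" unfolding K_def by (simp add: add_pos_nonneg)
  define N where "N = grad_norm \<phi>"
  \<comment> \<open>The maximiser of t f(\<phi>) - K N^2 t^2 / 4, the dual objective along multiples
    of \<phi>.\<close>
  define t where "t = 2 * f \<phi> / (K * N\<^sup>2)"
  define \<xi> where "\<xi> x = t * \<phi> x" for x
  have \<xi>: "\<xi> \<in> H10 \<Omega>" unfolding \<xi>_def by (rule H10_cmult[OF \<phi>])
  have N\<xi>: "(grad_norm \<xi>)\<^sup>2 = t\<^sup>2 * N\<^sup>2"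
    unfolding \<xi>_def grad_norm_cmult[OF H10_H1[OF \<phi>]] by (simp add: N_def power_mult_distrib)
  have f\<xi>: "f \<xi> = t * f \<phi>" using f \<phi> by (simp add: Hminus1_def \<xi>_def[abs_def])
  have "(\<bar>f \<phi>\<bar> / N)\<^sup>2 / K = f \<xi> - (grad_norm \<xi>)\<^sup>2 / 4 - c\<^sup>2 * Pe\<^sup>2 * (grad_norm \<xi>)\<^sup>2 / 4"
  proof (cases "N = 0")
    \<comment> \<open>Division by 0 gives 0, so both the ratio and t are 0 here.\<close>
    case True
    then show ?thesis by (simp add: N\<xi> f\<xi> t_def)
  next
    case False
    have "f \<xi> - (grad_norm \<xi>)\<^sup>2 / 4 - c\<^sup>2 * Pe\<^sup>2 * (grad_norm \<xi>)\<^sup>2 / 4 = t * f \<phi> - K * N\<^sup>2 * t\<^sup>2 / 4"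
      by (simp add: N\<xi> f\<xi> K_def field_simps)
    also have "\<dots> = (f \<phi>)\<^sup>2 / (N\<^sup>2 * K)"
      using False K by (simp add: t_def power2_eq_square field_simps)
    finally show ?thesis by (simp add: power_divide)
  qed
  then have "ereal ((\<bar>f \<phi>\<bar> / N)\<^sup>2 / K)
      = ereal (f \<xi> - (\<integral>x. (norm (grad \<Omega> \<xi> x))\<^sup>2 \<partial>lebesgue_on \<Omega>) / 4 - c\<^sup>2 * Pe\<^sup>2 * (grad_norm \<xi>)\<^sup>2 / 4)"
    by (simp add: L2norm_square)
  also have "\<dots> \<le> dual_value \<Omega> f Pe"
    unfolding dual_value_def
    using dual_feasible_scaled[OF c \<open>Pe \<ge> 0\<close> \<xi>]
    by (intro SUP_upper2[of "(c\<^sup>2 * Pe\<^sup>2 * (grad_norm \<xi>)\<^sup>2 / 4, \<xi>)"]) auto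
  finally show ?thesis by (simp add: K_def N_def)
qed

text \<open>A real supremum is meaningful only over a nonempty set that is bounded above; both are
  checked here. A vanishing gradient norm causes no trouble, since the quotient is then 0.\<close>

lemma Hminus1_norm_facts:
  assumes f: "f \<in> Hminus1 \<Omega>" and "\<Omega> \<noteq> {}"
  shows "{\<phi> \<in> H10 \<Omega>. \<not> (AE x in lebesgue_on \<Omega>. \<phi> x = 0)} \<noteq> {}"
    and "bdd_above ((\<lambda>\<phi>. \<bar>f \<phi>\<bar> / grad_norm \<phi>) ` {\<phi> \<in> H10 \<Omega>. \<not> (AE x in lebesgue_on \<Omega>. \<phi> x = 0)})"
    and "Hminus1_norm \<Omega> f \<ge> 0"
proof -
  obtain \<phi> where \<phi>: "\<phi> \<in> test_fun \<Omega>" "(\<integral>x. \<phi> x \<partial>lborel) = 1"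
    using mollifier_in_open_set[OF assms(2)] by metis
  then have in_set: "\<phi> \<in> {\<phi> \<in> H10 \<Omega>. \<not> (AE x in lebesgue_on \<Omega>. \<phi> x = 0)}"
    using test_fun_H10 test_fun_AE_zero by force
  then show "{\<phi> \<in> H10 \<Omega>. \<not> (AE x in lebesgue_on \<Omega>. \<phi> x = 0)} \<noteq> {}" by blast
  obtain C where C: "\<And>\<phi>. \<phi> \<in> H10 \<Omega> \<Longrightarrow> \<bar>f \<phi>\<bar> \<le> C * grad_norm \<phi>"
    using f unfolding Hminus1_def by blast
  have "\<bar>f \<phi>\<bar> / grad_norm \<phi> \<le> \<bar>C\<bar>" if "\<phi> \<in> H10 \<Omega>" for \<phi>
  proof (cases "grad_norm \<phi> = 0")
    case False
    then have "grad_norm \<phi> > 0" using L2norm_nonneg[of \<Omega> "grad \<Omega> \<phi>"] by simp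
    then show ?thesis using C[OF that] by (simp add: pos_divide_le_eq) (smt (verit) mult_right_mono)
  qed simp
  then show bdd: "bdd_above ((\<lambda>\<phi>. \<bar>f \<phi>\<bar> / grad_norm \<phi>) ` {\<phi> \<in> H10 \<Omega>. \<not> (AE x in lebesgue_on \<Omega>. \<phi> x = 0)})"
    by (intro bdd_aboveI[of _ "\<bar>C\<bar>"]) auto
  show "Hminus1_norm \<Omega> f \<ge> 0"
    unfolding Hminus1_norm_def by (rule cSUP_upper2[OF bdd in_set]) (simp add: L2norm_nonneg)
qed

text \<open>The ratio bound is rewritten with a square root so that the supremum can be taken, and
  then squared back. An infinite dual value is trivial, and minus infinity is excluded by the ratio
  bound at the zero function.\<close>

lemma dual_value_ge:
  assumes f: "f \<in> Hminus1 \<Omega>" and "\<Omega> \<noteq> {}" and c: "trilinear_hyp c" "c > 0" and "Pe \<ge> 0"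
  shows "ereal ((Hminus1_norm \<Omega> f)\<^sup>2 / (1 + c\<^sup>2 * Pe\<^sup>2)) \<le> dual_value \<Omega> f Pe"
proof -
  define K where "K = 1 + c\<^sup>2 * Pe\<^sup>2"
  have K: "K > 0" unfolding K_def by (simp add: add_pos_nonneg)
  note facts = Hminus1_norm_facts[OF f assms(2)]
  note ratio = dual_value_ge_ratio[OF f c \<open>Pe \<ge> 0\<close>, folded K_def]
  show ?thesis
  proof (cases "dual_value \<Omega> f Pe")
    case (real d)
    have "\<bar>f \<phi>\<bar> / grad_norm \<phi> \<le> sqrt (K * d)" if "\<phi> \<in> H10 \<Omega>" for \<phi>
      using ratio[OF that] K real by (intro real_le_rsqrt) (simp add: pos_divide_le_eq mult.commute)
    then have le: "Hminus1_norm \<Omega> f \<le> sqrt (K * d)"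
      unfolding Hminus1_norm_def using facts(1) by (intro cSUP_least) auto
    have "d \<ge> 0" using ratio[OF zero_H10] real K
      by (smt (verit, best) divide_nonneg_pos ereal_less_eq(3) zero_le_power2)
    have "(Hminus1_norm \<Omega> f)\<^sup>2 \<le> K * d"
      using power_mono[OF le facts(3), of 2] K \<open>d \<ge> 0\<close> by simp
    then have "(Hminus1_norm \<Omega> f)\<^sup>2 / K \<le> d" using K by (simp add: pos_divide_le_eq mult.commute)
    then show ?thesis using real by (simp add: K_def)
  next
    case MInf
    then show ?thesis using ratio[OF zero_H10] by simp
  qed simp
qed

text \<open>The supremum runs over functions that are not almost everywhere zero. A null \<phi>
  would have null gradient, and boundedness of f would force f \<phi> = 0.\<close>

lemma Hminus1_norm_pos:
  assumes f: "f \<in> Hminus1 \<Omega>" and "\<Omega> \<noteq> {}" and \<phi>: "\<phi> \<in> H10 \<Omega>" "f \<phi> \<noteq> 0"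
  shows "Hminus1_norm \<Omega> f > 0"
proof -
  obtain C where C: "\<bar>f \<phi>\<bar> \<le> C * grad_norm \<phi>" using f \<phi>(1) by (auto simp: Hminus1_def)
  have N: "grad_norm \<phi> > 0"
    using C \<phi>(2) L2norm_nonneg[of \<Omega> "grad \<Omega> \<phi>"] by (cases "grad_norm \<phi> = 0") auto
  have "\<not> (AE x in lebesgue_on \<Omega>. \<phi> x = 0)"
  proof
    assume z: "AE x in lebesgue_on \<Omega>. \<phi> x = 0"
    have "weak_gradient \<Omega> \<phi> (\<lambda>x. 0)"
      unfolding weak_gradient_def
    proof (intro ballI allI)
      fix \<eta> i
      have "AE x in lebesgue_on \<Omega>. \<phi> x * partial_deriv i \<eta> x = 0" using z by eventually_elim simp
      then show "(\<integral>x. \<phi> x * partial_deriv i \<eta> x \<partial>lebesgue_on \<Omega>) = - (\<integral>x. (0 :: plane) $ i * \<eta> x \<partial>lebesgue_on \<Omega>)"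
        by (simp add: integral_eq_zero_AE)
    qed
    from grad_eq[OF H1_L2[OF H10_H1[OF \<phi>(1)]] L2_zero this]
    have "grad_norm \<phi> = L2norm \<Omega> (\<lambda>x. 0 :: plane)"
      by (rule L2norm_cong[OF _ grad_L2[OF H10_H1[OF \<phi>(1)]] L2_zero])
    then show False using N by (simp add: L2norm_def)
  qed
  then have "\<bar>f \<phi>\<bar> / grad_norm \<phi> \<le> Hminus1_norm \<Omega> f"
    unfolding Hminus1_norm_def using \<phi>(1) by (intro cSUP_upper Hminus1_norm_facts(2)[OF f assms(2)]) auto
  moreover have "\<bar>f \<phi>\<bar> / grad_norm \<phi> > 0" using N \<phi>(2) by simp
  ultimately show ?thesis by linarith
qed

section \<open>The cooling efficiency\<close>

lemma cooling_efficiency_le: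
  assumes f: "f \<in> Hminus1 \<Omega>" and "\<Omega> \<noteq> {}" and \<phi>: "\<phi> \<in> H10 \<Omega>" "f \<phi> \<noteq> 0"
    and le: "ereal ((Hminus1_norm \<Omega> f)\<^sup>2 / K) \<le> primal_value \<Omega> f Pe" and "K > 0"
  shows "cooling_efficiency \<Omega> f Pe \<le> ereal K"
proof -
  define h where "h = (Hminus1_norm \<Omega> f)\<^sup>2"
  have h: "h > 0" using Hminus1_norm_pos[OF f assms(2) \<phi>] by (simp add: h_def)
  show ?thesis
  proof (cases "primal_value \<Omega> f Pe")
    case (real j)
    have "h / K \<le> j" using le real by (simp add: h_def)
    moreover have "h / K > 0" using h \<open>K > 0\<close> by simp
    ultimately have "j > 0" by linarith
    then have "h / j \<le> K" using \<open>h / K \<le> j\<close> \<open>K > 0\<close> by (simp add: pos_divide_le_eq mult.commute)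
    then show ?thesis using real \<open>j > 0\<close> by (simp add: cooling_efficiency_def h_def)
  next
    \<comment> \<open>An infinite primal value, as over an empty set of competitors, makes the
      extended quotient 0.\<close>
    case PInf
    then show ?thesis using \<open>K > 0\<close> by (simp add: cooling_efficiency_def)
  next
    case MInf
    then show ?thesis using le by simp
  qed
qed

end

theorem theorem2p4:
  fixes \<Omega> :: "(real ^ 2) set" and f :: "(real ^ 2 \<Rightarrow> real) \<Rightarrow> real" and c :: real
  assumes "open \<Omega>" and "connected \<Omega>" and "\<Omega> \<noteq> {}" and "bounded \<Omega>"
    and "lipschitz_boundary \<Omega>"
    and "f \<in> Hminus1 \<Omega>"
    and "c > 0"
    and "\<forall>\<xi>\<in>H10 \<Omega>. \<forall>T\<in>H10 \<Omega>. \<forall>\<psi>\<in>streamfunctions \<Omega>.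
      advection \<Omega> (perp_grad \<Omega> \<psi>) T \<xi>
        \<le> c * L2norm \<Omega> (grad \<Omega> \<xi>) * L2norm \<Omega> (grad \<Omega> \<psi>) * L2norm \<Omega> (grad \<Omega> T)"
  shows "(\<forall>Pe\<ge>0. primal_value \<Omega> f Pe \<ge> dual_value \<Omega> f Pe \<and>
            dual_value \<Omega> f Pe \<ge> ereal ((Hminus1_norm \<Omega> f)\<^sup>2 / (1 + c\<^sup>2 * Pe\<^sup>2))) \<and>
         ((\<exists>\<phi>\<in>H10 \<Omega>. f \<phi> \<noteq> 0) \<longrightarrow>
            (\<forall>Pe\<ge>0. cooling_efficiency \<Omega> f Pe \<le> ereal (1 + c\<^sup>2 * Pe\<^sup>2)))"
proof -
  interpret bounded_open_set \<Omega> using assms(1,4) by unfold_locales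
  have c: "trilinear_hyp c" using assms(8) unfolding trilinear_hyp_def .
  have main: "dual_value \<Omega> f Pe \<le> primal_value \<Omega> f Pe"
    "ereal ((Hminus1_norm \<Omega> f)\<^sup>2 / (1 + c\<^sup>2 * Pe\<^sup>2)) \<le> dual_value \<Omega> f Pe" if "Pe \<ge> 0" for Pe
    using primal_ge_dual[OF assms(5,3) c that] dual_value_ge[OF assms(6,3) c assms(7) that] by auto
  have "cooling_efficiency \<Omega> f Pe \<le> ereal (1 + c\<^sup>2 * Pe\<^sup>2)" if "\<phi> \<in> H10 \<Omega>" "f \<phi> \<noteq> 0" "Pe \<ge> 0" for \<phi> Pe
    by (rule cooling_efficiency_le[OF assms(6,3) that(1,2) order_trans[OF main(2,1)[OF that(3)]]])
      (simp add: add_pos_nonneg)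
  with main show ?thesis by blast
qed

end
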